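(* Let $R:=k[t_1,\dots,t_d]$ be the polynomial ring over a field $k$ in indeterminates $t_1,\dots,t_d$ of upper degree two, viewed as a DG algebra with zero differential. If $\operatorname{char}k\neq 2$ and $d\geq 8$, then there is a semifree DG $R$-module $G$ with $H^0(G)\cong k\cong H^3(G)$ and $H^j(G)=0$ for all $j\neq 0,3$, and such that $\operatorname{rank}_R G<2^d$. Consequently, it is not true that for every field $k$, every $d$, and every semifree DG $R$-module $F$ with $\operatorname{rank}_k H(F)$ finite and non-zero one has $\operatorname{rank}_R F\geq 2^d$.
   Context: A DG $R$-module is a graded $R$-module $F$ equipped with an $R$-linear endomorphism $d$ of (upper) degree $1$ with $d^2=0$; $H(F)=\bigoplus_j H^j(F)$ denotes its cohomology, where $H^j$ is the component of upper degree $j$. A DG $R$-module $F$ is semifree if there is a chain of graded submodules \[ 0=F(-1)\subseteq F(0)\subseteq F(1)\subseteq\cdots\subseteq\bigcup_{i\geq 0}F(i)=F \] such that each $F(i)/F(i-1)$ is a graded free $R$-module and $d(F(i))\subseteq F(i-1)$ for all $i$. In particular, ignoring the differential, $F$ is a graded free $R$-module, and $\operatorname{rank}_R F$ denotes its rank. *)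

theory Defs
  imports
    "HOL-Algebra.Module"
    "HOL-Algebra.AbelCoset"
    "HOL-Algebra.Multiplicative_Group"
    "HOL-Algebra.Indexed_Polynomials"
    "HOL-Library.Extended_Nat"
begin

section \<open>Modules and bases\<close>

definition linear_map ::
  "('r, 'y) ring_scheme \<Rightarrow> ('r, 'm, 'x) module_scheme \<Rightarrow> ('r, 'n, 'z) module_scheme \<Rightarrow> ('m \<Rightarrow> 'n) \<Rightarrow> bool"
  where "linear_map R M N f \<longleftrightarrow>
    f \<in> hom (add_monoid M) (add_monoid N) \<and>
    (\<forall>a\<in>carrier R. \<forall>x\<in>carrier M. f (a \<odot>\<^bsub>M\<^esub> x) = a \<odot>\<^bsub>N\<^esub> f x)"

definition module_iso ::
  "('r, 'y) ring_scheme \<Rightarrow> ('r, 'm, 'x) module_scheme \<Rightarrow> ('r, 'n, 'z) module_scheme \<Rightarrow> bool"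
  where "module_iso R M N \<longleftrightarrow>
    (\<exists>f. linear_map R M N f \<and> bij_betw f (carrier M) (carrier N))"

definition regular_module :: "('r, 'y) ring_scheme \<Rightarrow> ('r, 'r) module"
  where "regular_module R =
    \<lparr>carrier = carrier R, monoid.mult = monoid.mult R, one = one R, zero = zero R, add = add R,
     smult = monoid.mult R\<rparr>"

definition restrict_scalars ::
  "('k \<Rightarrow> 'r) \<Rightarrow> ('r, 'm, 'x) module_scheme \<Rightarrow> ('k, 'm) module"
  where "restrict_scalars \<phi> M =
    \<lparr>carrier = carrier M, monoid.mult = monoid.mult M, one = one M, zero = zero M, add = add M,
     smult = (\<lambda>a x. \<phi> a \<odot>\<^bsub>M\<^esub> x)\<rparr>"

text \<open>The coefficient functions \<open>c\<close> are total on the type, hence required to vanish off \<open>B\<close>.\<close>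

definition is_basis ::
  "('r, 'y) ring_scheme \<Rightarrow> ('r, 'm, 'x) module_scheme \<Rightarrow> 'm set \<Rightarrow> bool"
  where "is_basis R M B \<longleftrightarrow> B \<subseteq> carrier M \<and>
    (\<forall>x\<in>carrier M. \<exists>!c.
       (\<forall>b. c b \<in> carrier R) \<and> finite {b. c b \<noteq> \<zero>\<^bsub>R\<^esub>} \<and> {b. c b \<noteq> \<zero>\<^bsub>R\<^esub>} \<subseteq> B \<and>
       x = (\<Oplus>\<^bsub>M\<^esub>b\<in>{b. c b \<noteq> \<zero>\<^bsub>R\<^esub>}. c b \<odot>\<^bsub>M\<^esub> b))"

text \<open>
  Over a nonzero commutative ring all bases of a free module have the same cardinality, so the
  infimum is the size of any basis. Infinite rank is \<open>\<infinity>\<close>; a module without a basis also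
  gets the value \<open>\<infinity>\<close>, but the rank is only used for free modules.
\<close>

definition free_rank :: "('r, 'y) ring_scheme \<Rightarrow> ('r, 'm, 'x) module_scheme \<Rightarrow> enat"
  where "free_rank R M =
    (INF B\<in>{B. is_basis R M B}. if finite B then enat (card B) else \<infinity>)"


section \<open>Graded modules\<close>

text \<open>
  A grading is given by its homogeneous components. The grading of the ground ring \<open>R\<close> is passed
  as a separate argument \<open>A\<close>. All degrees are upper degrees.
\<close>

record ('r, 'm) gmodule = "('r, 'm) module" +
  gr :: "int \<Rightarrow> 'm set"

definition homog_decomp :: "('r, 'm, 'x) gmodule_scheme \<Rightarrow> (int \<Rightarrow> 'm) \<Rightarrow> 'm \<Rightarrow> bool"
  where "homog_decomp M c x \<longleftrightarrow>
    (\<forall>j. c j \<in> gr M j) \<and> finite {j. c j \<noteq> \<zero>\<^bsub>M\<^esub>} \<and>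
    x = (\<Oplus>\<^bsub>M\<^esub>j\<in>{j. c j \<noteq> \<zero>\<^bsub>M\<^esub>}. c j)"

definition graded_module ::
  "('r, 'y) ring_scheme \<Rightarrow> (int \<Rightarrow> 'r set) \<Rightarrow> ('r, 'm, 'x) gmodule_scheme \<Rightarrow> bool"
  where "graded_module R A M \<longleftrightarrow>
    module R M \<and>
    (\<forall>j. subgroup (gr M j) (add_monoid M)) \<and>
    (\<forall>x\<in>carrier M. \<exists>!c. homog_decomp M c x) \<and>
    (\<forall>i j. \<forall>a\<in>A i. \<forall>x\<in>gr M j. a \<odot>\<^bsub>M\<^esub> x \<in> gr M (i + j))"

definition graded_submodule ::
  "('r, 'y) ring_scheme \<Rightarrow> ('r, 'm, 'x) gmodule_scheme \<Rightarrow> 'm set \<Rightarrow> bool"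
  where "graded_submodule R M N \<longleftrightarrow>
    submodule N R M \<and> (\<forall>x\<in>N. \<forall>c. homog_decomp M c x \<longrightarrow> (\<forall>j. c j \<in> N))"

definition restrict_gmodule ::
  "('r, 'm, 'x) gmodule_scheme \<Rightarrow> 'm set \<Rightarrow> ('r, 'm, 'x) gmodule_scheme"
  where "restrict_gmodule M N = M\<lparr>carrier := N, gr := (\<lambda>j. gr M j \<inter> N)\<rparr>"

text \<open>The multiplicative ring fields inherited by module records play no role.\<close>

definition quotient_gmodule ::
  "('r, 'm, 'x) gmodule_scheme \<Rightarrow> 'm set \<Rightarrow> ('r, 'm set) gmodule"
  where "quotient_gmodule M N =
    \<lparr>carrier = a_rcosets\<^bsub>M\<^esub> N, monoid.mult = undefined, one = undefined, zero = N, add = set_add M,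
     smult = (\<lambda>a S. \<Union>x\<in>S. N +>\<^bsub>M\<^esub> (a \<odot>\<^bsub>M\<^esub> x)),
     gr = (\<lambda>j. (\<lambda>x. N +>\<^bsub>M\<^esub> x) ` gr M j)\<rparr>"

definition graded_free ::
  "('r, 'y) ring_scheme \<Rightarrow> ('r, 'm, 'x) gmodule_scheme \<Rightarrow> bool"
  where "graded_free R M \<longleftrightarrow> (\<exists>B. is_basis R M B \<and> (\<forall>b\<in>B. \<exists>j. b \<in> gr M j))"


section \<open>DG modules over a graded ring with zero differential\<close>

text \<open>
  No signs occur in the linearity of the differential: the ring has zero differential, and in the
  application it lives in even degrees.
\<close>

record ('r, 'm) dgmodule = "('r, 'm) gmodule" +
  diff :: "'m \<Rightarrow> 'm"

definition dg_module ::
  "('r, 'y) ring_scheme \<Rightarrow> (int \<Rightarrow> 'r set) \<Rightarrow> ('r, 'm, 'x) dgmodule_scheme \<Rightarrow> bool"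
  where "dg_module R A M \<longleftrightarrow>
    graded_module R A M \<and>
    linear_map R M M (diff M) \<and>
    (\<forall>j. \<forall>x\<in>gr M j. diff M x \<in> gr M (j + 1)) \<and>
    (\<forall>x\<in>carrier M. diff M (diff M x) = \<zero>\<^bsub>M\<^esub>)"

definition cocycles :: "('r, 'm, 'x) dgmodule_scheme \<Rightarrow> 'm set"
  where "cocycles M = {x \<in> carrier M. diff M x = \<zero>\<^bsub>M\<^esub>}"

definition coboundaries :: "('r, 'm, 'x) dgmodule_scheme \<Rightarrow> 'm set"
  where "coboundaries M = diff M ` carrier M"

definition cohomology :: "('r, 'm, 'x) dgmodule_scheme \<Rightarrow> ('r, 'm set) gmodule"
  where "cohomology M = quotient_gmodule (restrict_gmodule M (cocycles M)) (coboundaries M)"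

definition semifree ::
  "('r, 'y) ring_scheme \<Rightarrow> (int \<Rightarrow> 'r set) \<Rightarrow> ('r, 'm, 'x) dgmodule_scheme \<Rightarrow> bool"
  where "semifree R A M \<longleftrightarrow>
    dg_module R A M \<and>
    (\<exists>F :: int \<Rightarrow> 'm set.
       F (-1) = {\<zero>\<^bsub>M\<^esub>} \<and>
       (\<forall>i\<ge>-1. graded_submodule R M (F i)) \<and>
       (\<forall>i\<ge>0. F (i - 1) \<subseteq> F i) \<and>
       (\<Union>i\<in>{0..}. F i) = carrier M \<and>
       (\<forall>i\<ge>0. graded_free R (quotient_gmodule (restrict_gmodule M (F i)) (F (i - 1)))) \<and>
       (\<forall>i\<ge>0. diff M ` F i \<subseteq> F (i - 1)))"


section \<open>The polynomial ring\<close>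

text \<open>
  Monomials are multisets of variables and polynomials map monomials to coefficients, as in
  \<^theory>\<open>HOL-Algebra.Indexed_Polynomials\<close>, which supplies the carrier, the constants and
  addition, but no product of polynomials. The variables \<open>t\<^sub>1, \<dots>, t\<^sub>d\<close> are indexed by \<open>0, \<dots>, d - 1\<close>.
\<close>

type_synonym 'a npoly = "nat multiset \<Rightarrow> 'a"

definition mpoly_ring :: "('a, 'y) ring_scheme \<Rightarrow> nat \<Rightarrow> 'a npoly ring"
  where "mpoly_ring K d =
    \<lparr>carrier = ring.indexed_pset K {..<d} (carrier K),
     monoid.mult = (\<lambda>P Q m. \<Oplus>\<^bsub>K\<^esub>u\<in>{u. u \<subseteq># m}. P u \<otimes>\<^bsub>K\<^esub> Q (m - u)),
     one = ring.indexed_const K \<one>\<^bsub>K\<^esub>,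
     zero = ring.indexed_const K \<zero>\<^bsub>K\<^esub>,
     add = ring.indexed_padd K\<rparr>"

text \<open>Every variable has degree two.\<close>

definition mpoly_grading :: "('a, 'y) ring_scheme \<Rightarrow> nat \<Rightarrow> int \<Rightarrow> 'a npoly set"
  where "mpoly_grading K d j =
    {P \<in> carrier (mpoly_ring K d). \<forall>m. P m \<noteq> \<zero>\<^bsub>K\<^esub> \<longrightarrow> 2 * int (size m) = j}"

text \<open>
  The library's \<^const>\<open>group.ord\<close> is \<open>0\<close> for elements of infinite order, which matches the
  convention for characteristic zero.
\<close>

definition ring_char :: "('a, 'y) ring_scheme \<Rightarrow> nat"
  where "ring_char K = group.ord (add_monoid K) \<one>\<^bsub>K\<^esub>"

text \<open>
  The total cohomology and its component of degree \<open>j\<close>, as vector spaces over \<open>K\<close>, where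
  \<open>K\<close> acts through the constant polynomials.
\<close>

definition cohomology_vs ::
  "('a, 'y) ring_scheme \<Rightarrow> ('a npoly, 'm, 'x) dgmodule_scheme \<Rightarrow> ('a, 'm set) module"
  where "cohomology_vs K M = restrict_scalars (ring.indexed_const K) (cohomology M)"

definition cohomology_at ::
  "('a, 'y) ring_scheme \<Rightarrow> ('a npoly, 'm, 'x) dgmodule_scheme \<Rightarrow> int \<Rightarrow> ('a, 'm set) module"
  where "cohomology_at K M j = (cohomology_vs K M)\<lparr>carrier := gr (cohomology M) j\<rparr>"

end

theory Submission
  imports Defs "HOL-Library.Nat_Bijection" "HOL-Number_Theory.Residues"
begin

text \<open>
  Let \<open>R\<close> be the polynomial ring and \<open>\<Lambda>\<close> the exterior algebra on \<open>e\<^sub>0, \<dots>, e\<^bsub>d-1\<^esub>\<close> over the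
  field. The Koszul complex \<open>R \<otimes> \<Lambda>\<close> is free of rank \<open>2 ^ d\<close>, its differential \<open>\<kappa>\<close> sends \<open>e\<^sub>j\<close>
  to \<open>t\<^sub>j\<close>, and its cohomology is the field in degree zero. Contraction with a two-form with
  constant coefficients is an endomorphism \<open>\<omega>\<close> of this complex of degree \<open>-2\<close>. Its mapping
  cone, suitably shifted, has cohomology the field in degrees 0 and 3, and its rank is twice
  \<open>2 ^ d\<close>.

  The matrix of \<open>\<omega>\<close> has entries in the field. Every invertible submatrix of it can be split
  off from the cone together with its rows and columns, and this does not change the
  cohomology. Thus \<open>\<omega>\<close> should have large rank. For the form
  \<open>e\<^sub>0 e\<^sub>1 + e\<^sub>2 e\<^sub>3 + e\<^sub>4 e\<^sub>5 + e\<^sub>6 e\<^sub>7\<close>, contraction removes one of these four pairs of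
  indices in all possible ways. Pairs of which a basis vector contains exactly one index are
  inert, so that \<open>\<omega>\<close> decomposes into the operators that lower Boolean lattices of rank \<open>n \<le> 4\<close>
  by one level. For \<open>d = 8\<close> there are 16, 32, 24, 8 and 1 copies of these with
  \<open>n = 0, 1, 2, 3, 4\<close>. If two is invertible, they contain invertible submatrices of sizes 0,
  1, 2, 5 and 9, which in all copies together amount to 129 out of \<open>2 ^ 8 = 256\<close> rows. The
  other indices multiply both numbers by \<open>2 ^ (d - 8)\<close>. What is left of the cone has rank
  \<open>2 * (256 - 129) * 2 ^ (d - 8) = 254 * 2 ^ (d - 8) < 2 ^ d\<close>.

  The splitting is done by a homotopy \<open>h\<close> with \<open>h D h = h\<close>, built from the inverse of the
  submatrix (\<open>partial_contraction\<close>, \<open>cone_partial_contraction\<close>). The result lives on the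
  surviving coordinates, hence it is free, and exterior degree filters it
  (\<open>free_dg_module_semifree\<close>). The cohomology is computed with an explicit contraction of the
  Koszul complex that is linear over the field (\<open>koszul_contraction\<close>): two functionals on
  cocycles vanish exactly on the coboundaries (\<open>\<Phi>_boundary\<close>, \<open>\<Phi>_exact\<close>), and this determines
  the cohomology (\<open>cohomology_by_functionals\<close>). The failure of the rank conjecture follows for
  the field with three elements and \<open>d = 8\<close>.
\<close>

section \<open>Modules of functions\<close>

text \<open>
  The free module on \<open>I\<close>. Its elements are total functions that vanish off \<open>I\<close>, so that
  equality of elements is equality of functions and matrices of operators may be written
  without reference to \<open>I\<close>.
\<close>

definition fun_module :: "('r, 'y) ring_scheme \<Rightarrow> 'i set \<Rightarrow> ('r, 'i \<Rightarrow> 'r) module"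
  where "fun_module R I =
    \<lparr>carrier = {f. (\<forall>i. f i \<in> carrier R) \<and> (\<forall>i. i \<notin> I \<longrightarrow> f i = \<zero>\<^bsub>R\<^esub>)},
     monoid.mult = undefined, one = undefined, zero = (\<lambda>i. \<zero>\<^bsub>R\<^esub>),
     add = (\<lambda>f g i. f i \<oplus>\<^bsub>R\<^esub> g i), smult = (\<lambda>a f i. a \<otimes>\<^bsub>R\<^esub> f i)\<rparr>"

lemma fun_module_simps [simp]:
  "zero (fun_module R I) = (\<lambda>i. \<zero>\<^bsub>R\<^esub>)"
  "add (fun_module R I) = (\<lambda>f g i. f i \<oplus>\<^bsub>R\<^esub> g i)"
  "smult (fun_module R I) = (\<lambda>a f i. a \<otimes>\<^bsub>R\<^esub> f i)"
  by (simp_all add: fun_module_def)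

lemma fun_module_carrier:
  "carrier (fun_module R I) = {f. (\<forall>i. f i \<in> carrier R) \<and> (\<forall>i. i \<notin> I \<longrightarrow> f i = \<zero>\<^bsub>R\<^esub>)}"
  by (simp add: fun_module_def)

lemma fun_moduleI:
  assumes "\<And>i. f i \<in> carrier R" "\<And>i. i \<notin> I \<Longrightarrow> f i = \<zero>\<^bsub>R\<^esub>"
  shows "f \<in> carrier (fun_module R I)"
  using assms by (simp add: fun_module_carrier)

lemma fun_moduleD: "f \<in> carrier (fun_module R I) \<Longrightarrow> f i \<in> carrier R"
  by (simp add: fun_module_carrier)

lemma fun_module_outside: "f \<in> carrier (fun_module R I) \<Longrightarrow> i \<notin> I \<Longrightarrow> f i = \<zero>\<^bsub>R\<^esub>"
  by (simp add: fun_module_carrier)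

context cring
begin

lemma fun_module_module: "module R (fun_module R I)"
proof (rule moduleI)
  show "abelian_group (fun_module R I)"
  proof (rule abelian_groupI)
    fix x assume x: "x \<in> carrier (fun_module R I)"
    then show "\<exists>y\<in>carrier (fun_module R I). y \<oplus>\<^bsub>fun_module R I\<^esub> x = \<zero>\<^bsub>fun_module R I\<^esub>"
      by (intro bexI[of _ "\<lambda>i. \<ominus> x i"]) (auto simp: fun_module_carrier l_neg)
  qed (auto simp: fun_module_carrier a_ac)
qed (auto simp: fun_module_carrier l_distr r_distr m_assoc is_cring)

lemma fun_module_uminus:
  assumes "f \<in> carrier (fun_module R I)"
  shows "\<ominus>\<^bsub>fun_module R I\<^esub> f = (\<lambda>i. \<ominus> f i)"
proof -
  interpret F: module R "fun_module R I" by (rule fun_module_module)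
  have "(\<lambda>i. \<ominus> f i) \<in> carrier (fun_module R I)"
    using assms by (auto simp: fun_module_carrier)
  then show ?thesis
    using assms by (intro F.minus_equality) (auto simp: fun_module_carrier l_neg)
qed

lemma fun_module_minus:
  assumes "f \<in> carrier (fun_module R I)" "g \<in> carrier (fun_module R I)"
  shows "f \<ominus>\<^bsub>fun_module R I\<^esub> g = (\<lambda>i. f i \<ominus> g i)"
  using assms by (simp add: a_minus_def fun_module_uminus)

lemma fun_module_finsum:
  assumes "finite A" "\<And>a. a \<in> A \<Longrightarrow> f a \<in> carrier (fun_module R I)"
  shows "(\<Oplus>\<^bsub>fun_module R I\<^esub>a\<in>A. f a) = (\<lambda>i. \<Oplus>a\<in>A. f a i)"
proof -
  interpret F: module R "fun_module R I" by (rule fun_module_module)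
  show ?thesis using assms
  proof (induction A rule: finite_induct)
    case (insert a A)
    then have "(\<lambda>a. f a i) \<in> A \<rightarrow> carrier R" "f a i \<in> carrier R" for i
      by (auto intro: fun_moduleD)
    then show ?case using insert by (simp add: F.M.finsum_insert Pi_def)
  qed simp
qed

lemma additive_subgroup_finsum:
  assumes "additive_subgroup H R" "finite A" "\<And>a. a \<in> A \<Longrightarrow> f a \<in> H"
  shows "(\<Oplus>a\<in>A. f a) \<in> H"
proof -
  interpret H: additive_subgroup H R by fact
  show ?thesis using assms(2,3)
  proof (induction A rule: finite_induct)
    case (insert a A)
    then have "f \<in> A \<rightarrow> carrier R" "f a \<in> carrier R" using H.a_subset by auto
    then show ?case using insert by simp
  qed simp
qed

lemma linear_mapI:
  assumes "\<And>f. f \<in> carrier (fun_module R I) \<Longrightarrow> T f \<in> carrier (fun_module R J)"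
    and "\<And>f g i. f \<in> carrier (fun_module R I) \<Longrightarrow> g \<in> carrier (fun_module R I)
           \<Longrightarrow> T (\<lambda>i. f i \<oplus> g i) i = T f i \<oplus> T g i"
    and "\<And>a f i. a \<in> carrier R \<Longrightarrow> f \<in> carrier (fun_module R I)
           \<Longrightarrow> T (\<lambda>i. a \<otimes> f i) i = a \<otimes> T f i"
  shows "linear_map R (fun_module R I) (fun_module R J) T"
  using assms by (auto simp: linear_map_def hom_def fun_eq_iff)

text \<open>
  The Koszul differential and the contraction with a two-form have this shape: their \<open>a\<close>-th
  summand reads the argument at \<open>k a i\<close> with weight \<open>c a i\<close>.
\<close>

lemma linear_map_matrix:
  assumes "finite A" "\<And>a i. a \<in> A \<Longrightarrow> c a i \<in> carrier R"
    and "\<And>a i. a \<in> A \<Longrightarrow> i \<notin> J \<Longrightarrow> k a i \<notin> I"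
  shows "linear_map R (fun_module R I) (fun_module R J) (\<lambda>f i. \<Oplus>a\<in>A. c a i \<otimes> f (k a i))"
proof (rule linear_mapI)
  fix f assume f: "f \<in> carrier (fun_module R I)"
  show "(\<lambda>i. \<Oplus>a\<in>A. c a i \<otimes> f (k a i)) \<in> carrier (fun_module R J)"
  proof (rule fun_moduleI)
    show "(\<Oplus>a\<in>A. c a i \<otimes> f (k a i)) \<in> carrier R" for i
      using assms f by (intro finsum_closed) (auto simp: fun_module_carrier)
    show "(\<Oplus>a\<in>A. c a i \<otimes> f (k a i)) = \<zero>" if "i \<notin> J" for i
    proof -
      have "(\<Oplus>a\<in>A. c a i \<otimes> f (k a i)) = (\<Oplus>a\<in>A. \<zero>)"
        using assms f that by (intro finsum_cong') (auto simp: fun_module_carrier)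
      then show ?thesis by (simp add: finsum_zero)
    qed
  qed
  fix i
  show "(\<Oplus>a\<in>A. c a i \<otimes> (b \<otimes> f (k a i))) = b \<otimes> (\<Oplus>a\<in>A. c a i \<otimes> f (k a i))"
    if "b \<in> carrier R" for b
    using assms f that by (subst finsum_rdistr) (auto intro!: finsum_cong' simp: m_lcomm fun_module_carrier)
  fix g assume g: "g \<in> carrier (fun_module R I)"
  show "(\<Oplus>a\<in>A. c a i \<otimes> (f (k a i) \<oplus> g (k a i)))
      = (\<Oplus>a\<in>A. c a i \<otimes> f (k a i)) \<oplus> (\<Oplus>a\<in>A. c a i \<otimes> g (k a i))"
  proof -
    have "(\<Oplus>a\<in>A. c a i \<otimes> (f (k a i) \<oplus> g (k a i))) = (\<Oplus>a\<in>A. c a i \<otimes> f (k a i) \<oplus> c a i \<otimes> g (k a i))"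
      using assms f g by (intro finsum_cong') (auto simp: r_distr fun_module_carrier)
    also have "\<dots> = (\<Oplus>a\<in>A. c a i \<otimes> f (k a i)) \<oplus> (\<Oplus>a\<in>A. c a i \<otimes> g (k a i))"
      using assms f g by (intro finsum_addf) (auto simp: fun_module_carrier)
    finally show ?thesis .
  qed
qed

lemma linear_map_closed:
  "linear_map R (fun_module R I) (fun_module R J) T \<Longrightarrow> f \<in> carrier (fun_module R I)
    \<Longrightarrow> T f \<in> carrier (fun_module R J)"
  by (auto simp: linear_map_def hom_def)

lemma linear_map_add:
  "linear_map R (fun_module R I) (fun_module R J) T \<Longrightarrow> f \<in> carrier (fun_module R I)
    \<Longrightarrow> g \<in> carrier (fun_module R I) \<Longrightarrow> T (\<lambda>i. f i \<oplus> g i) = (\<lambda>i. T f i \<oplus> T g i)"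
  by (auto simp: linear_map_def hom_def)

lemma linear_map_smult:
  "linear_map R (fun_module R I) (fun_module R J) T \<Longrightarrow> a \<in> carrier R \<Longrightarrow> f \<in> carrier (fun_module R I)
    \<Longrightarrow> T (\<lambda>i. a \<otimes> f i) = (\<lambda>i. a \<otimes> T f i)"
  by (auto simp: linear_map_def)

lemma linear_map_uminus:
  assumes T: "linear_map R (fun_module R I) (fun_module R J) T" and f: "f \<in> carrier (fun_module R I)"
  shows "T (\<lambda>i. \<ominus> f i) = (\<lambda>i. \<ominus> T f i)"
proof -
  have "T (\<lambda>i. \<ominus> \<one> \<otimes> f i) = (\<lambda>i. \<ominus> \<one> \<otimes> T f i)"
    using T f by (intro linear_map_smult) auto
  then show ?thesis using f linear_map_closed[OF T f] by (simp add: l_minus fun_module_carrier)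
qed

lemma linear_map_minus:
  assumes T: "linear_map R (fun_module R I) (fun_module R J) T"
    and f: "f \<in> carrier (fun_module R I)" and g: "g \<in> carrier (fun_module R I)"
  shows "T (\<lambda>i. f i \<ominus> g i) = (\<lambda>i. T f i \<ominus> T g i)"
proof -
  have "(\<lambda>i. \<ominus> g i) \<in> carrier (fun_module R I)"
    using g by (auto simp: fun_module_carrier)
  then show ?thesis
    unfolding a_minus_def using linear_map_add[OF T f] linear_map_uminus[OF T g] by simp
qed

lemma linear_map_zero:
  assumes T: "linear_map R (fun_module R I) (fun_module R J) T"
  shows "T (\<lambda>i. \<zero>) = (\<lambda>i. \<zero>)"
proof -
  have z: "(\<lambda>i. \<zero>) \<in> carrier (fun_module R I)" by (rule fun_moduleI) auto
  have "T (\<lambda>i. \<zero> \<otimes> \<zero>) = (\<lambda>i. \<zero> \<otimes> T (\<lambda>i. \<zero>) i)"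
    using T z linear_map_smult[OF T zero_closed z] by simp
  then show ?thesis using linear_map_closed[OF T z] by (simp add: fun_module_carrier)
qed

text \<open>
  The terms at \<open>(i, j)\<close> and \<open>(j, i)\<close> cancel. This gives the vanishing of the square of the
  Koszul differential.
\<close>

lemma alternating_finsum_zero:
  assumes "\<And>i j. i < n \<Longrightarrow> j < n \<Longrightarrow> a i j \<in> carrier R"
    and "\<And>i j. i < n \<Longrightarrow> j < n \<Longrightarrow> i \<noteq> j \<Longrightarrow> a i j = \<ominus> a j i"
    and "\<And>i. i < n \<Longrightarrow> a i i = \<zero>"
  shows "(\<Oplus>i\<in>{..<n::nat}. \<Oplus>j\<in>{..<n}. a i j) = \<zero>"
  using assms
proof (induction n)
  case (Suc n)
  let ?r = "\<Oplus>j\<in>{..<n}. a n j"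
  have r: "?r \<in> carrier R" using Suc.prems(1) by (intro finsum_closed) auto
  have "(\<Oplus>i\<in>{..<n}. a i n) = (\<Oplus>i\<in>{..<n}. \<ominus> \<one> \<otimes> a n i)"
  proof (intro finsum_cong')
    fix i assume "i \<in> {..<n}"
    then show "a i n = \<ominus> \<one> \<otimes> a n i" using Suc.prems(1)[of n i] Suc.prems(2)[of i n] by (simp add: l_minus)
  qed (use Suc.prems(1) in auto)
  also have "\<dots> = \<ominus> ?r"
    using r Suc.prems(1) by (subst finsum_rdistr[symmetric]) (auto simp: l_minus)
  finally have col: "(\<Oplus>i\<in>{..<n}. a i n) = \<ominus> ?r" .
  have "(\<Oplus>i\<in>{..<n}. \<Oplus>j\<in>{..<Suc n}. a i j) = (\<Oplus>i\<in>{..<n}. a i n \<oplus> (\<Oplus>j\<in>{..<n}. a i j))"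
    using Suc.prems(1) by (intro finsum_cong') (auto simp: lessThan_Suc intro!: finsum_closed)
  also have "\<dots> = (\<Oplus>i\<in>{..<n}. a i n) \<oplus> (\<Oplus>i\<in>{..<n}. \<Oplus>j\<in>{..<n}. a i j)"
    using Suc.prems(1) by (intro finsum_addf) (auto intro!: finsum_closed)
  also have "\<dots> = \<ominus> ?r \<oplus> \<zero>"
  proof -
    have "(\<Oplus>i\<in>{..<n}. \<Oplus>j\<in>{..<n}. a i j) = \<zero>"
      by (rule Suc.IH) (fact Suc.prems(1)[OF less_SucI less_SucI], fact Suc.prems(2)[OF less_SucI less_SucI],
          fact Suc.prems(3)[OF less_SucI])
    then show ?thesis by (simp only: col)
  qed
  finally have rows: "(\<Oplus>i\<in>{..<n}. \<Oplus>j\<in>{..<Suc n}. a i j) = \<ominus> ?r" using r by simp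
  have "(\<Oplus>j\<in>{..<Suc n}. a n j) = ?r"
    using Suc.prems(1) Suc.prems(3)[of n] r by (simp add: lessThan_Suc Pi_def)
  then show ?case
    using rows r Suc.prems(1) by (simp add: lessThan_Suc Pi_def r_neg)
qed simp

end

section \<open>Sums over Boolean lattices\<close>

text \<open>
  A list of \<open>n\<close> truth values stands for a subset of an \<open>n\<close>-element set. At such a subset,
  \<open>up_sum\<close> sums the values of \<open>f\<close> over all subsets with one more element.
\<close>

primrec (in ring) up_sum :: "bool list \<Rightarrow> (bool list \<Rightarrow> 'a) \<Rightarrow> 'a" where
  "up_sum [] f = \<zero>"
| "up_sum (b # bs) f = (if b then \<zero> else f (True # bs)) \<oplus> up_sum bs (\<lambda>cs. f (b # cs))"

text \<open>
  Rows and columns of an invertible square submatrix of \<open>up_sum\<close>: the columns are the members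
  of \<open>sources\<close> and the rows are the members of \<open>targets\<close>. For \<open>n = 1, 2, 3\<close> the submatrix has
  the full rank 1, 2, 5 of \<open>up_sum\<close>. For \<open>n = 4\<close> it has rank 9, one less than is possible.
  Between levels one and two, if \<open>n \<ge> 3\<close>, the columns are the edges of a triangle, together
  with a pendant edge at its first vertex if \<open>n = 4\<close>, and the rows are the vertices. The
  incidence matrix of a triangle has determinant two up to sign, and this is where the
  characteristic enters. All other blocks are identity matrices.
\<close>

definition sources :: "bool list set" where
  "sources = {[True],
     [True, False], [True, True],
     [True, False, False], [True, True, False], [True, False, True], [False, True, True],
     [True, True, True],
     [True, False, False, False],
     [True, True, False, False], [True, False, True, False], [False, True, True, False],
     [True, False, False, True],
     [False, True, True, True], [True, False, True, True], [True, True, False, True],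
     [True, True, True, True]}"

definition targets :: "bool list set" where
  "targets = {[False],
     [False, False], [True, False],
     [False, False, False], [True, False, False], [False, True, False], [False, False, True],
     [True, True, False],
     [False, False, False, False],
     [True, False, False, False], [False, True, False, False], [False, False, True, False],
     [False, False, False, True],
     [False, True, True, False], [True, False, True, False], [True, True, False, False],
     [True, True, True, False]}"

text \<open>
  The element \<open>u\<close> is one half. It is a parameter because the polynomial ring, where the
  construction takes place, is not a field.
\<close>

locale half_ring = cring +
  fixes u
  assumes u_closed [simp, intro]: "u \<in> carrier R" and u_half: "u \<oplus> u = \<one>"
begin

text \<open>
  A function on the vertices of a triangle that is given by its sums \<open>a, b, c\<close> over the edges
  has the value \<open>(a + b - c) / 2\<close> at the common vertex of the first two edges. The same
  formula with edges and vertices exchanged inverts the incidence matrix of the triangle.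
\<close>

definition half_comb :: "'a \<Rightarrow> 'a \<Rightarrow> 'a \<Rightarrow> 'a" where
  "half_comb a b c = u \<otimes> (a \<oplus> b \<ominus> c)"

text \<open>
  The inverse of the submatrix of \<open>up_sum\<close> described by \<open>sources\<close> and \<open>targets\<close>, extended by
  zero. The difference in three of the rows for \<open>n = 4\<close> removes the contribution of the
  pendant edge.
\<close>

definition part_inv :: "bool list \<Rightarrow> (bool list \<Rightarrow> 'a) \<Rightarrow> 'a" where
  "part_inv bs f =
    (if bs = [True] then f [False]
     else if bs = [True, False] then f [False, False]
     else if bs = [True, True] then f [True, False]
     else if bs = [True, False, False] then f [False, False, False]
     else if bs = [True, True, False] then half_comb (f [True, False, False]) (f [False, True, False]) (f [False, False, True])
     else if bs = [True, False, True] then half_comb (f [True, False, False]) (f [False, False, True]) (f [False, True, False])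
     else if bs = [False, True, True] then half_comb (f [False, True, False]) (f [False, False, True]) (f [True, False, False])
     else if bs = [True, True, True] then f [True, True, False]
     else if bs = [True, False, False, False] then f [False, False, False, False]
     else if bs = [True, True, False, False] then half_comb (f [True, False, False, False] \<ominus> f [False, False, False, True]) (f [False, True, False, False]) (f [False, False, True, False])
     else if bs = [True, False, True, False] then half_comb (f [True, False, False, False] \<ominus> f [False, False, False, True]) (f [False, False, True, False]) (f [False, True, False, False])
     else if bs = [False, True, True, False] then half_comb (f [False, True, False, False]) (f [False, False, True, False]) (f [True, False, False, False] \<ominus> f [False, False, False, True])
     else if bs = [True, False, False, True] then f [False, False, False, True]
     else if bs = [False, True, True, True] then f [False, True, True, False]
     else if bs = [True, False, True, True] then f [True, False, True, False]
     else if bs = [True, True, False, True] then f [True, True, False, False]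
     else if bs = [True, True, True, True] then f [True, True, True, False]
     else \<zero>)"

lemma part_inv_outside: "bs \<notin> sources \<Longrightarrow> part_inv bs f = \<zero>"
  by (auto simp: sources_def part_inv_def)

lemma part_inv_simps [simp]:
  "part_inv [True] f = f [False]"
  "part_inv [True, False] f = f [False, False]"
  "part_inv [True, True] f = f [True, False]"
  "part_inv [True, False, False] f = f [False, False, False]"
  "part_inv [True, True, False] f = half_comb (f [True, False, False]) (f [False, True, False]) (f [False, False, True])"
  "part_inv [True, False, True] f = half_comb (f [True, False, False]) (f [False, False, True]) (f [False, True, False])"
  "part_inv [False, True, True] f = half_comb (f [False, True, False]) (f [False, False, True]) (f [True, False, False])"
  "part_inv [True, True, True] f = f [True, True, False]"
  "part_inv [True, False, False, False] f = f [False, False, False, False]"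
  "part_inv [True, True, False, False] f = half_comb (f [True, False, False, False] \<ominus> f [False, False, False, True]) (f [False, True, False, False]) (f [False, False, True, False])"
  "part_inv [True, False, True, False] f = half_comb (f [True, False, False, False] \<ominus> f [False, False, False, True]) (f [False, False, True, False]) (f [False, True, False, False])"
  "part_inv [False, True, True, False] f = half_comb (f [False, True, False, False]) (f [False, False, True, False]) (f [True, False, False, False] \<ominus> f [False, False, False, True])"
  "part_inv [True, False, False, True] f = f [False, False, False, True]"
  "part_inv [False, True, True, True] f = f [False, True, True, False]"
  "part_inv [True, False, True, True] f = f [True, False, True, False]"
  "part_inv [True, True, False, True] f = f [True, True, False, False]"
  "part_inv [True, True, True, True] f = f [True, True, True, False]"
  by (simp_all add: part_inv_def)

lemma part_inv_zero [simp]: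
  "part_inv [False] f = \<zero>"
  "part_inv [False, False] f = \<zero>"
  "part_inv [False, True] f = \<zero>"
  "part_inv [False, False, False] f = \<zero>"
  "part_inv [False, True, False] f = \<zero>"
  "part_inv [False, False, True] f = \<zero>"
  "part_inv [False, False, False, False] f = \<zero>"
  "part_inv [False, True, False, False] f = \<zero>"
  "part_inv [False, False, True, False] f = \<zero>"
  "part_inv [False, False, False, True] f = \<zero>"
  "part_inv [False, True, False, True] f = \<zero>"
  "part_inv [False, False, True, True] f = \<zero>"
  "part_inv [True, True, True, False] f = \<zero>"
  by (simp_all add: part_inv_def)

lemma half_add: "x \<in> carrier R \<Longrightarrow> u \<otimes> x \<oplus> u \<otimes> x = x"
  by (metis l_distr l_one u_closed u_half)

lemma half_comb_closed [simp]:
  "a \<in> carrier R \<Longrightarrow> b \<in> carrier R \<Longrightarrow> c \<in> carrier R \<Longrightarrow> half_comb a b c \<in> carrier R"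
  by (simp add: half_comb_def)

lemma half_comb_add:
  assumes "a \<in> carrier R" "b \<in> carrier R" "c \<in> carrier R" "a' \<in> carrier R" "b' \<in> carrier R" "c' \<in> carrier R"
  shows "half_comb (a \<oplus> a') (b \<oplus> b') (c \<oplus> c') = half_comb a b c \<oplus> half_comb a' b' c'"
proof -
  have "(a \<oplus> a') \<oplus> (b \<oplus> b') \<ominus> (c \<oplus> c') = (a \<oplus> b \<ominus> c) \<oplus> (a' \<oplus> b' \<ominus> c')"
    using assms by algebra
  then show ?thesis using assms by (simp add: half_comb_def r_distr)
qed

lemma half_comb_smult:
  assumes "x \<in> carrier R" "a \<in> carrier R" "b \<in> carrier R" "c \<in> carrier R"
  shows "half_comb (x \<otimes> a) (x \<otimes> b) (x \<otimes> c) = x \<otimes> half_comb a b c"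
proof -
  have "x \<otimes> a \<oplus> x \<otimes> b \<ominus> x \<otimes> c = x \<otimes> (a \<oplus> b \<ominus> c)"
    using assms by algebra
  then show ?thesis using assms by (simp add: half_comb_def m_lcomm)
qed

lemma half_comb_pair:
  assumes "a \<in> carrier R" "b \<in> carrier R" "c \<in> carrier R"
  shows "half_comb a b c \<oplus> half_comb a c b = a"
proof -
  have "(a \<oplus> b \<ominus> c) \<oplus> (a \<oplus> c \<ominus> b) = a \<oplus> a" using assms by algebra
  then have "half_comb a b c \<oplus> half_comb a c b = u \<otimes> (a \<oplus> a)"
    using assms by (simp add: half_comb_def r_distr[symmetric])
  then show ?thesis using assms half_add by (simp add: r_distr)
qed

lemma half_comb_triangle:
  assumes "a \<in> carrier R" "b \<in> carrier R" "c \<in> carrier R"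
  shows "half_comb (a \<oplus> b) (a \<oplus> c) (b \<oplus> c) = a"
proof -
  have "(a \<oplus> b) \<oplus> (a \<oplus> c) \<ominus> (b \<oplus> c) = a \<oplus> a" using assms by algebra
  then show ?thesis using assms half_add by (simp add: half_comb_def r_distr)
qed

lemma half_comb_commute:
  "a \<in> carrier R \<Longrightarrow> b \<in> carrier R \<Longrightarrow> half_comb a b c = half_comb b a c"
  by (simp add: half_comb_def a_comm)

lemma part_inv_cong:
  assumes "\<And>cs. cs \<in> targets \<Longrightarrow> f cs = g cs"
  shows "part_inv bs f = part_inv bs g"
proof (cases "bs \<in> sources")
  case True
  have "\<forall>cs\<in>targets. f cs = g cs" using assms by blast
  then have eqs: "f [False] = g [False]" "f [False, False] = g [False, False]" "f [True, False] = g [True, False]"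
    "f [False, False, False] = g [False, False, False]" "f [True, False, False] = g [True, False, False]"
    "f [False, True, False] = g [False, True, False]" "f [False, False, True] = g [False, False, True]"
    "f [True, True, False] = g [True, True, False]"
    "f [False, False, False, False] = g [False, False, False, False]"
    "f [True, False, False, False] = g [True, False, False, False]"
    "f [False, True, False, False] = g [False, True, False, False]"
    "f [False, False, True, False] = g [False, False, True, False]"
    "f [False, False, False, True] = g [False, False, False, True]"
    "f [False, True, True, False] = g [False, True, True, False]"
    "f [True, False, True, False] = g [True, False, True, False]"
    "f [True, True, False, False] = g [True, True, False, False]"
    "f [True, True, True, False] = g [True, True, True, False]"
    unfolding targets_def by (simp_all only: ball_simps insert_iff)
  show ?thesis using True unfolding sources_def
    by (elim insertE emptyE) (simp_all only: part_inv_simps eqs)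
qed (simp add: part_inv_outside)

text \<open>
  The partial inverse lowers the size by one and uses no coefficients other than signs and
  \<open>u\<close>. Homogeneity of all operators derived from it rests on this fact.
\<close>

lemma part_inv_mem:
  assumes H: "additive_subgroup H R" "\<And>x. x \<in> H \<Longrightarrow> u \<otimes> x \<in> H"
    and f: "\<And>cs. length cs = length bs \<Longrightarrow> Suc (count_list cs True) = count_list bs True \<Longrightarrow> f cs \<in> H"
  shows "part_inv bs f \<in> H"
proof -
  interpret H: additive_subgroup H R by fact
  have diff: "x \<ominus> y \<in> H" if "x \<in> H" "y \<in> H" for x y using that by (simp add: a_minus_def)
  have comb: "half_comb x y z \<in> H" if "x \<in> H" "y \<in> H" "z \<in> H" for x y z
    using that by (simp add: half_comb_def diff H(2))
  show ?thesis
  proof (cases "bs \<in> sources")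
    case True
    then show ?thesis unfolding sources_def
      by (elim insertE emptyE; simp only: part_inv_simps; (intro comb diff)?; intro f; simp)
  qed (simp add: part_inv_outside)
qed

lemma part_inv_closed:
  assumes "\<And>cs. f cs \<in> carrier R" shows "part_inv bs f \<in> carrier R"
  by (cases "bs \<in> sources") (use assms in \<open>auto simp: part_inv_outside sources_def\<close>)

lemma part_inv_add:
  assumes "\<And>cs. f cs \<in> carrier R" "\<And>cs. g cs \<in> carrier R"
  shows "part_inv bs (\<lambda>cs. f cs \<oplus> g cs) = part_inv bs f \<oplus> part_inv bs g"
proof (cases "bs \<in> sources")
  case True
  have minus: "(a \<oplus> a') \<ominus> (b \<oplus> b') = (a \<ominus> b) \<oplus> (a' \<ominus> b')"
    if "a \<in> carrier R" "b \<in> carrier R" "a' \<in> carrier R" "b' \<in> carrier R" for a b a' b'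
    using that by algebra
  show ?thesis using True assms by (auto simp: sources_def half_comb_add minus)
qed (simp add: part_inv_outside)

lemma part_inv_smult:
  assumes "\<And>cs. f cs \<in> carrier R" "a \<in> carrier R"
  shows "part_inv bs (\<lambda>cs. a \<otimes> f cs) = a \<otimes> part_inv bs f"
proof (cases "bs \<in> sources")
  case True
  have minus: "a \<otimes> x \<ominus> a \<otimes> y = a \<otimes> (x \<ominus> y)" if "x \<in> carrier R" "y \<in> carrier R" for x y
    using that assms(2) by algebra
  show ?thesis using True assms by (auto simp: sources_def half_comb_smult minus)
qed (use assms in \<open>simp add: part_inv_outside\<close>)

text \<open>
  One half of the invertibility of the submatrix: on \<open>targets\<close>, \<open>part_inv\<close> is a right inverse
  of \<open>up_sum\<close>.
\<close>

lemma up_sum_part_inv: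
  assumes "bs \<in> targets" "\<And>cs. f cs \<in> carrier R"
  shows "up_sum bs (\<lambda>cs. part_inv cs f) = f bs"
proof -
  have pair: "half_comb a b c \<oplus> half_comb c a b = a" "half_comb b a c \<oplus> half_comb a c b = a"
    "half_comb b a c \<oplus> half_comb c a b = a"
    if "a \<in> carrier R" "b \<in> carrier R" "c \<in> carrier R" for a b c
    using half_comb_pair[OF that] half_comb_commute that by metis+
  have pair': "half_comb a b c \<oplus> (half_comb a c b \<oplus> e) = a \<oplus> e"
    if "a \<in> carrier R" "b \<in> carrier R" "c \<in> carrier R" "e \<in> carrier R" for a b c e
    using that half_comb_pair[OF that(1-3)] by (simp add: a_assoc[symmetric])
  have cancel: "a \<ominus> b \<oplus> b = a" if "a \<in> carrier R" "b \<in> carrier R" for a b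
    using that by algebra
  show ?thesis
    using assms by (auto simp: targets_def half_comb_pair pair pair' cancel)
qed

text \<open>
  The other half: \<open>part_inv\<close> is a left inverse of \<open>up_sum\<close> on functions that are supported in
  \<open>sources\<close>.
\<close>

lemma part_inv_up_sum:
  assumes "bs \<in> sources" "\<And>cs. f cs \<in> carrier R" "\<And>cs. cs \<notin> sources \<Longrightarrow> f cs = \<zero>"
  shows "part_inv bs (\<lambda>cs. up_sum cs f) = f bs"
proof -
  have z: "f [False] = \<zero>" "f [False, False] = \<zero>" "f [False, True] = \<zero>"
    "f [False, False, False] = \<zero>" "f [False, True, False] = \<zero>" "f [False, False, True] = \<zero>"
    "f [False, False, False, False] = \<zero>" "f [False, True, False, False] = \<zero>"
    "f [False, False, True, False] = \<zero>" "f [False, False, False, True] = \<zero>"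
    "f [False, True, False, True] = \<zero>" "f [False, False, True, True] = \<zero>"
    "f [True, True, True, False] = \<zero>"
    by (rule assms(3), simp add: sources_def)+
  have cancel: "a \<oplus> (b \<oplus> c) \<ominus> c = a \<oplus> b" if "a \<in> carrier R" "b \<in> carrier R" "c \<in> carrier R" for a b c
    using that by algebra
  have tri: "half_comb (b \<oplus> a) (a \<oplus> c) (b \<oplus> c) = a" "half_comb (b \<oplus> a) (c \<oplus> a) (b \<oplus> c) = a"
    "half_comb (a \<oplus> b) (c \<oplus> a) (b \<oplus> c) = a"
    "half_comb (a \<oplus> b) (a \<oplus> c) (c \<oplus> b) = a"
    "half_comb (b \<oplus> a) (a \<oplus> c) (c \<oplus> b) = a" "half_comb (b \<oplus> a) (c \<oplus> a) (c \<oplus> b) = a"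
    "half_comb (a \<oplus> b) (c \<oplus> a) (c \<oplus> b) = a"
    if "a \<in> carrier R" "b \<in> carrier R" "c \<in> carrier R" for a b c
    using half_comb_triangle[OF that] a_comm that by metis+
  show ?thesis using assms(1,2)
    by (auto simp: sources_def z cancel half_comb_triangle tri)
qed

end

section \<open>The polynomial ring\<close>

lemma (in abelian_monoid) finsum_swap:
  assumes "finite A" "finite B" "\<And>i j. i \<in> A \<Longrightarrow> j \<in> B \<Longrightarrow> f i j \<in> carrier G"
  shows "(\<Oplus>i\<in>A. \<Oplus>j\<in>B. f i j) = (\<Oplus>j\<in>B. \<Oplus>i\<in>A. f i j)"
  using assms(1,3)
proof (induction A rule: finite_induct)
  case empty
  show ?case by (simp add: finsum_zero)
next
  case (insert x A)
  have "(\<Oplus>i\<in>insert x A. \<Oplus>j\<in>B. f i j) = (\<Oplus>j\<in>B. f x j) \<oplus> (\<Oplus>j\<in>B. \<Oplus>i\<in>A. f i j)"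
    using insert by (simp add: finsum_closed Pi_def)
  also have "\<dots> = (\<Oplus>j\<in>B. f x j \<oplus> (\<Oplus>i\<in>A. f i j))"
    using insert by (intro finsum_addf[symmetric]) (auto intro!: finsum_closed)
  also have "\<dots> = (\<Oplus>j\<in>B. \<Oplus>i\<in>insert x A. f i j)"
    using insert by (intro finsum_cong') (auto intro!: finsum_closed)
  finally show ?case .
qed

lemma (in abelian_monoid) finsum_delta:
  assumes "finite A" "i \<in> A" "c \<in> carrier G"
  shows "(\<Oplus>j\<in>A. if j = i then c else \<zero>) = c"
  using finsum_singleton[of i A "\<lambda>_. c"] assms by (simp add: eq_commute)

lemma finite_submultisets: "finite {u :: 'c multiset. u \<subseteq># m}"
proof (rule finite_subset)
  show "{u. u \<subseteq># m} \<subseteq> mset ` {xs. set xs \<subseteq> set_mset m \<and> length xs \<le> size m}"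
  proof
    fix u assume u: "u \<in> {u. u \<subseteq># m}"
    obtain xs where xs: "mset xs = u" using ex_mset by blast
    have "set xs \<subseteq> set_mset m" using u xs by (auto dest: mset_subset_eqD)
    moreover have "length xs \<le> size m" using u xs size_mset_mono by fastforce
    ultimately show "u \<in> mset ` {xs. set xs \<subseteq> set_mset m \<and> length xs \<le> size m}"
      using xs by blast
  qed
  show "finite (mset ` {xs. set xs \<subseteq> set_mset m \<and> length xs \<le> size m})"
    by (intro finite_imageI finite_lists_length_le) simp
qed

context cring
begin

abbreviation Poly :: "nat \<Rightarrow> 'a npoly ring" where "Poly d \<equiv> mpoly_ring R d"

lemma monomial_in_Poly:
  assumes "k \<in> carrier R" "set_mset m \<subseteq> {..<d}"
  shows "(\<lambda>n. if n = m then k else \<zero>) \<in> indexed_pset {..<d} (carrier R)"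
  using assms(2)
proof (induction m)
  case empty
  then show ?case
    using indexed_pset.indexed_const[of k "carrier R" "{..<d}"] assms(1)
    by (simp add: indexed_const_def)
next
  case (add i m)
  have "(\<lambda>n. if n = add_mset i m then k else \<zero>) = indexed_pmult (\<lambda>n. if n = m then k else \<zero>) i"
    by (auto simp: indexed_pmult_def fun_eq_iff)
  then show ?case using add by (auto intro: indexed_pset.indexed_pmult)
qed

text \<open>
  The inductive description of polynomials is convenient for proving identities, whereas this
  one is convenient for operations that are defined coefficient by coefficient, such as taking
  homogeneous components.
\<close>

lemma Poly_carrier:
  "carrier (Poly d) =
    {P. (\<forall>m. P m \<in> carrier R) \<and> finite {m. P m \<noteq> \<zero>} \<and> (\<forall>m. P m \<noteq> \<zero> \<longrightarrow> set_mset m \<subseteq> {..<d})}"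
    (is "_ = ?S")
proof
  have "P \<in> ?S" if "P \<in> indexed_pset {..<d} (carrier R)" for P :: "'a npoly"
    using that
  proof (induction P rule: indexed_pset.induct)
    case (indexed_const k)
    then show ?case by (auto simp: indexed_const_def)
  next
    case (indexed_padd P Q)
    have "{m. P m \<oplus> Q m \<noteq> \<zero>} \<subseteq> {m. P m \<noteq> \<zero>} \<union> {m. Q m \<noteq> \<zero>}" by auto
    then have "finite {m. P m \<oplus> Q m \<noteq> \<zero>}" using indexed_padd by (auto intro: finite_subset)
    moreover have "set_mset m \<subseteq> {..<d}" if "P m \<oplus> Q m \<noteq> \<zero>" for m
      using indexed_padd that by (cases "P m = \<zero>"; cases "Q m = \<zero>") auto
    ultimately show ?case using indexed_padd by (simp add: indexed_padd_def)
  next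
    case (indexed_pmult P i)
    have "{m. indexed_pmult P i m \<noteq> \<zero>} \<subseteq> add_mset i ` {m. P m \<noteq> \<zero>}"
    proof
      fix m assume "m \<in> {m. indexed_pmult P i m \<noteq> \<zero>}"
      then have "i \<in># m" "P (m - {#i#}) \<noteq> \<zero>" by (auto simp: indexed_pmult_def split: if_splits)
      then show "m \<in> add_mset i ` {m. P m \<noteq> \<zero>}" by (intro image_eqI[of _ _ "m - {#i#}"]) auto
    qed
    then have "finite {m. indexed_pmult P i m \<noteq> \<zero>}" using indexed_pmult by (auto intro: finite_subset)
    moreover have "set_mset m \<subseteq> {..<d}" if "indexed_pmult P i m \<noteq> \<zero>" for m
    proof -
      have "i \<in># m" "P (m - {#i#}) \<noteq> \<zero>" using that by (auto simp: indexed_pmult_def split: if_splits)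
      then have "set_mset (m - {#i#}) \<subseteq> {..<d}" using indexed_pmult by blast
      then have "set_mset (add_mset i (m - {#i#})) \<subseteq> {..<d}" using indexed_pmult by simp
      then show ?thesis using \<open>i \<in># m\<close> by (simp only: insert_DiffM)
    qed
    moreover have "indexed_pmult P i m \<in> carrier R" for m
      using indexed_pmult by (auto simp: indexed_pmult_def)
    ultimately show ?case by blast
  qed
  then show "carrier (Poly d) \<subseteq> ?S" by (auto simp: mpoly_ring_def)
next
  have "P \<in> indexed_pset {..<d} (carrier R)"
    if "finite M" "{m. P m \<noteq> \<zero>} = M" "\<And>m. P m \<in> carrier R" "\<And>m. P m \<noteq> \<zero> \<Longrightarrow> set_mset m \<subseteq> {..<d}"
    for P :: "'a npoly" and M
    using that
  proof (induction M arbitrary: P rule: finite_induct)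
    case empty
    then have "P = indexed_const \<zero>" by (auto simp: indexed_const_def)
    then show ?case by (simp add: indexed_pset.indexed_const)
  next
    case (insert n M)
    define Q where "Q = P(n := \<zero>)"
    have "{m. Q m \<noteq> \<zero>} = {m. P m \<noteq> \<zero>} - {n}" by (auto simp: Q_def)
    then have "{m. Q m \<noteq> \<zero>} = M" using insert.hyps insert.prems(1) by simp
    moreover have "set_mset m \<subseteq> {..<d}" if "Q m \<noteq> \<zero>" for m
      using that insert.prems(3)[of m] by (simp add: Q_def split: if_splits)
    ultimately have "Q \<in> indexed_pset {..<d} (carrier R)"
      using insert.prems(2) by (intro insert.IH) (simp_all add: Q_def)
    moreover have "(\<lambda>m. if m = n then P n else \<zero>) \<in> indexed_pset {..<d} (carrier R)"
      using insert.prems by (intro monomial_in_Poly) auto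
    moreover have "P = indexed_padd Q (\<lambda>m. if m = n then P n else \<zero>)"
      using insert.prems by (auto simp: Q_def indexed_padd_def fun_eq_iff)
    ultimately show ?case by (metis indexed_pset.indexed_padd)
  qed
  then show "?S \<subseteq> carrier (Poly d)" by (auto simp: mpoly_ring_def)
qed

lemma Poly_add: "P \<oplus>\<^bsub>Poly d\<^esub> Q = (\<lambda>m. P m \<oplus> Q m)"
  by (simp add: mpoly_ring_def indexed_padd_def)

lemma Poly_zero: "\<zero>\<^bsub>Poly d\<^esub> = (\<lambda>m. \<zero>)"
  by (simp add: mpoly_ring_def indexed_zero_def)

lemma Poly_one: "\<one>\<^bsub>Poly d\<^esub> = (\<lambda>m. if m = {#} then \<one> else \<zero>)"
  by (simp add: mpoly_ring_def indexed_const_def)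

lemma Poly_mult: "P \<otimes>\<^bsub>Poly d\<^esub> Q = (\<lambda>m. \<Oplus>u\<in>{u. u \<subseteq># m}. P u \<otimes> Q (m - u))"
  by (simp add: mpoly_ring_def)

lemma Poly_coeff: "P \<in> carrier (Poly d) \<Longrightarrow> P m \<in> carrier R"
  by (simp add: Poly_carrier)

lemma Poly_abelian_group: "abelian_group (Poly d)"
proof (rule abelian_groupI)
  fix P Q assume P: "P \<in> carrier (Poly d)" and Q: "Q \<in> carrier (Poly d)"
  show "P \<oplus>\<^bsub>Poly d\<^esub> Q \<in> carrier (Poly d)"
    using P Q by (simp add: mpoly_ring_def indexed_pset.indexed_padd)
  show "P \<oplus>\<^bsub>Poly d\<^esub> Q = Q \<oplus>\<^bsub>Poly d\<^esub> P"
    using P Q by (simp add: Poly_add a_comm Poly_carrier)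
  fix S assume "S \<in> carrier (Poly d)"
  then show "P \<oplus>\<^bsub>Poly d\<^esub> Q \<oplus>\<^bsub>Poly d\<^esub> S = P \<oplus>\<^bsub>Poly d\<^esub> (Q \<oplus>\<^bsub>Poly d\<^esub> S)"
    using P Q by (simp add: Poly_add a_assoc Poly_carrier)
next
  show "\<zero>\<^bsub>Poly d\<^esub> \<in> carrier (Poly d)" by (simp add: Poly_zero Poly_carrier)
next
  fix P assume P: "P \<in> carrier (Poly d)"
  then show "\<zero>\<^bsub>Poly d\<^esub> \<oplus>\<^bsub>Poly d\<^esub> P = P" by (simp add: Poly_add Poly_zero Poly_carrier)
  have "(\<lambda>m. \<ominus> P m) \<in> carrier (Poly d)"
  proof -
    have "\<ominus> P m \<noteq> \<zero> \<longleftrightarrow> P m \<noteq> \<zero>" for m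
      using Poly_coeff[OF P] by (metis minus_minus minus_zero)
    then show ?thesis using P by (simp add: Poly_carrier)
  qed
  then show "\<exists>Q\<in>carrier (Poly d). Q \<oplus>\<^bsub>Poly d\<^esub> P = \<zero>\<^bsub>Poly d\<^esub>"
    using P by (intro bexI[of _ "\<lambda>m. \<ominus> P m"]) (simp_all add: Poly_add Poly_zero l_neg Poly_coeff[OF P])
qed

lemma Poly_const: "k \<in> carrier R \<Longrightarrow> indexed_const k \<in> carrier (Poly d)"
  by (simp add: mpoly_ring_def indexed_pset.indexed_const)

lemma Poly_const_mult:
  assumes "k \<in> carrier R" "P \<in> carrier (Poly d)"
  shows "indexed_const k \<otimes>\<^bsub>Poly d\<^esub> P = (\<lambda>m. k \<otimes> P m)"
proof
  fix m
  note P = Poly_coeff[OF assms(2)]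
  have "(indexed_const k \<otimes>\<^bsub>Poly d\<^esub> P) m
      = (\<Oplus>u\<in>{u. u \<subseteq># m}. if u = {#} then k \<otimes> P m else \<zero>)"
    unfolding Poly_mult using assms(1) P by (intro finsum_cong') (auto simp: indexed_const_def)
  then show "(indexed_const k \<otimes>\<^bsub>Poly d\<^esub> P) m = k \<otimes> P m"
    using assms(1) P by (simp add: finsum_delta finite_submultisets)
qed

text \<open>
  Together with additivity and the product with a constant this rule determines the product,
  because constants and multiplication by variables generate all polynomials. Closure and
  associativity then follow by induction on the first factor, without rearranging triple sums.
\<close>

lemma Poly_pmult_mult:
  assumes "P \<in> carrier (Poly d)" "Q \<in> carrier (Poly d)"
  shows "indexed_pmult P i \<otimes>\<^bsub>Poly d\<^esub> Q = indexed_pmult (P \<otimes>\<^bsub>Poly d\<^esub> Q) i"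
proof
  fix m
  note P = Poly_coeff[OF assms(1)] and Q = Poly_coeff[OF assms(2)]
  let ?f = "\<lambda>u. indexed_pmult P i u \<otimes> Q (m - u)"
  have cl: "?f u \<in> carrier R" for u
    using P Q by (auto simp: indexed_pmult_def)
  show "(indexed_pmult P i \<otimes>\<^bsub>Poly d\<^esub> Q) m = indexed_pmult (P \<otimes>\<^bsub>Poly d\<^esub> Q) i m"
  proof (cases "i \<in># m")
    case False
    then have "i \<notin># u" if "u \<subseteq># m" for u using that by (auto dest: mset_subset_eqD)
    then have "(\<Oplus>u\<in>{u. u \<subseteq># m}. ?f u) = (\<Oplus>u\<in>{u. u \<subseteq># m}. \<zero>)"
      using P Q by (intro finsum_cong') (auto simp: indexed_pmult_def)
    then show ?thesis using False by (simp add: Poly_mult indexed_pmult_def finsum_zero)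
  next
    case True
    have img: "add_mset i ` {u. u \<subseteq># m - {#i#}} = {u. u \<subseteq># m \<and> i \<in># u}"
    proof
      show "add_mset i ` {u. u \<subseteq># m - {#i#}} \<subseteq> {u. u \<subseteq># m \<and> i \<in># u}"
        using True by (auto simp: insert_subset_eq_iff)
      show "{u. u \<subseteq># m \<and> i \<in># u} \<subseteq> add_mset i ` {u. u \<subseteq># m - {#i#}}"
      proof
        fix u assume u: "u \<in> {u. u \<subseteq># m \<and> i \<in># u}"
        then have "u \<subseteq># add_mset i (m - {#i#})" using True by simp
        then show "u \<in> add_mset i ` {u. u \<subseteq># m - {#i#}}"
          using u by (intro image_eqI[of _ _ "u - {#i#}"]) (auto simp: subset_eq_diff_conv)
      qed
    qed
    have "(\<Oplus>u\<in>{u. u \<subseteq># m}. ?f u) = (\<Oplus>u\<in>{u. u \<subseteq># m \<and> i \<in># u}. ?f u)"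
      using P Q
      by (intro add.finprod_mono_neutral_cong_right) (auto simp: finite_submultisets indexed_pmult_def)
    also have "\<dots> = (\<Oplus>u\<in>add_mset i ` {u. u \<subseteq># m - {#i#}}. ?f u)" by (simp only: img)
    also have "\<dots> = (\<Oplus>u\<in>{u. u \<subseteq># m - {#i#}}. ?f (add_mset i u))"
      using cl by (intro finsum_reindex) (auto simp: inj_on_def)
    also have "\<dots> = (\<Oplus>u\<in>{u. u \<subseteq># m - {#i#}}. P u \<otimes> Q (m - {#i#} - u))"
      using P Q by (intro finsum_cong') (auto simp: indexed_pmult_def)
    finally show ?thesis using True by (simp add: Poly_mult indexed_pmult_def)
  qed
qed

lemma Poly_add_mult:
  assumes "P \<in> carrier (Poly d)" "P' \<in> carrier (Poly d)" "Q \<in> carrier (Poly d)"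
  shows "(P \<oplus>\<^bsub>Poly d\<^esub> P') \<otimes>\<^bsub>Poly d\<^esub> Q = P \<otimes>\<^bsub>Poly d\<^esub> Q \<oplus>\<^bsub>Poly d\<^esub> P' \<otimes>\<^bsub>Poly d\<^esub> Q"
proof
  fix m
  note cl = assms[THEN Poly_coeff]
  have "((P \<oplus>\<^bsub>Poly d\<^esub> P') \<otimes>\<^bsub>Poly d\<^esub> Q) m
      = (\<Oplus>u\<in>{u. u \<subseteq># m}. P u \<otimes> Q (m - u) \<oplus> P' u \<otimes> Q (m - u))"
    unfolding Poly_mult Poly_add using cl by (intro finsum_cong') (auto simp: l_distr)
  also have "\<dots> = (P \<otimes>\<^bsub>Poly d\<^esub> Q \<oplus>\<^bsub>Poly d\<^esub> P' \<otimes>\<^bsub>Poly d\<^esub> Q) m"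
    unfolding Poly_mult Poly_add using cl by (intro finsum_addf) auto
  finally show "((P \<oplus>\<^bsub>Poly d\<^esub> P') \<otimes>\<^bsub>Poly d\<^esub> Q) m = (P \<otimes>\<^bsub>Poly d\<^esub> Q \<oplus>\<^bsub>Poly d\<^esub> P' \<otimes>\<^bsub>Poly d\<^esub> Q) m" .
qed

lemma Poly_induct [consumes 1, case_names const add var]:
  assumes "P \<in> carrier (Poly d)"
    and "\<And>k. k \<in> carrier R \<Longrightarrow> T (indexed_const k)"
    and "\<And>P Q. P \<in> carrier (Poly d) \<Longrightarrow> Q \<in> carrier (Poly d) \<Longrightarrow> T P \<Longrightarrow> T Q \<Longrightarrow> T (P \<oplus>\<^bsub>Poly d\<^esub> Q)"
    and "\<And>P i. P \<in> carrier (Poly d) \<Longrightarrow> i < d \<Longrightarrow> T P \<Longrightarrow> T (indexed_pmult P i)"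
  shows "T P"
proof -
  have "P \<in> indexed_pset {..<d} (carrier R)" using assms(1) by (simp add: mpoly_ring_def)
  then show ?thesis
    by (induction P rule: indexed_pset.induct) (use assms(2-) in \<open>auto simp: mpoly_ring_def\<close>)
qed

lemma Poly_pmult_closed:
  assumes "P \<in> carrier (Poly d)" "i < d" shows "indexed_pmult P i \<in> carrier (Poly d)"
  using assms by (auto simp: mpoly_ring_def intro: indexed_pset.indexed_pmult)

lemma Poly_mult_closed:
  assumes "P \<in> carrier (Poly d)" "Q \<in> carrier (Poly d)"
  shows "P \<otimes>\<^bsub>Poly d\<^esub> Q \<in> carrier (Poly d)"
  using assms(1)
proof (induction rule: Poly_induct)
  case (const k)
  have "{m. k \<otimes> Q m \<noteq> \<zero>} \<subseteq> {m. Q m \<noteq> \<zero>}" "\<And>m. k \<otimes> Q m \<noteq> \<zero> \<Longrightarrow> Q m \<noteq> \<zero>"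
    using const by auto
  then have "(\<lambda>m. k \<otimes> Q m) \<in> carrier (Poly d)"
    using const assms(2) by (auto simp: Poly_carrier intro: finite_subset)
  then show ?case using const assms(2) by (simp add: Poly_const_mult)
next
  case (add P P')
  then show ?case using assms(2)
    by (simp add: Poly_add_mult abelian_monoid.a_closed[OF abelian_group.axioms(1)[OF Poly_abelian_group]])
next
  case (var P i)
  then show ?case using assms(2) by (simp add: Poly_pmult_mult Poly_pmult_closed)
qed

lemma Poly_mult_comm:
  assumes "P \<in> carrier (Poly d)" "Q \<in> carrier (Poly d)"
  shows "P \<otimes>\<^bsub>Poly d\<^esub> Q = Q \<otimes>\<^bsub>Poly d\<^esub> P"
proof
  fix m
  note cl = assms[THEN Poly_coeff]
  let ?S = "{u :: nat multiset. u \<subseteq># m}"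
  have img: "(\<lambda>u. m - u) ` ?S = ?S"
  proof
    show "?S \<subseteq> (\<lambda>u. m - u) ` ?S"
    proof
      fix u assume "u \<in> ?S"
      then show "u \<in> (\<lambda>u. m - u) ` ?S"
        by (intro image_eqI[of _ _ "m - u"]) (auto simp: subset_mset.diff_diff_right)
    qed
  qed auto
  have inj: "inj_on (\<lambda>u. m - u) ?S"
    by (rule inj_on_inverseI[where g = "\<lambda>u. m - u"]) (auto simp: subset_mset.diff_diff_right)
  have "(\<Oplus>u\<in>?S. P u \<otimes> Q (m - u)) = (\<Oplus>u\<in>(\<lambda>u. m - u) ` ?S. P u \<otimes> Q (m - u))"
    by (simp only: img)
  also have "\<dots> = (\<Oplus>u\<in>?S. P (m - u) \<otimes> Q (m - (m - u)))"
    using cl inj by (intro finsum_reindex) auto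
  also have "\<dots> = (\<Oplus>u\<in>?S. Q u \<otimes> P (m - u))"
    using cl by (intro finsum_cong') (auto simp: subset_mset.diff_diff_right m_comm)
  finally show "(P \<otimes>\<^bsub>Poly d\<^esub> Q) m = (Q \<otimes>\<^bsub>Poly d\<^esub> P) m" by (simp add: Poly_mult)
qed

lemma Poly_mult_assoc:
  assumes "P \<in> carrier (Poly d)" "Q \<in> carrier (Poly d)" "S \<in> carrier (Poly d)"
  shows "P \<otimes>\<^bsub>Poly d\<^esub> Q \<otimes>\<^bsub>Poly d\<^esub> S = P \<otimes>\<^bsub>Poly d\<^esub> (Q \<otimes>\<^bsub>Poly d\<^esub> S)"
  using assms(1)
proof (induction rule: Poly_induct)
  case (const k)
  have "indexed_const k \<otimes>\<^bsub>Poly d\<^esub> Q \<in> carrier (Poly d)"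
    using const assms by (intro Poly_mult_closed Poly_const)
  moreover have "(\<Oplus>u\<in>{u. u \<subseteq># m}. k \<otimes> Q u \<otimes> S (m - u)) = k \<otimes> (\<Oplus>u\<in>{u. u \<subseteq># m}. Q u \<otimes> S (m - u))" for m
    using const assms[THEN Poly_coeff]
    by (subst finsum_rdistr) (auto simp: finite_submultisets m_assoc intro!: finsum_cong')
  ultimately show ?case
    using const assms by (simp add: Poly_const_mult Poly_mult_closed) (simp add: Poly_mult)
next
  case (add P P')
  then show ?case using assms by (simp add: Poly_add_mult Poly_mult_closed)
next
  case (var P i)
  then show ?case using assms by (simp add: Poly_pmult_mult Poly_pmult_closed Poly_mult_closed)
qed

lemma Poly_cring: "cring (Poly d)"
proof (rule cringI[OF Poly_abelian_group])
  show "comm_monoid (Poly d)"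
  proof (rule comm_monoidI)
    show one: "\<one>\<^bsub>Poly d\<^esub> \<in> carrier (Poly d)"
      using Poly_const[of \<one>] by (simp add: Poly_one indexed_const_def)
    show "\<one>\<^bsub>Poly d\<^esub> \<otimes>\<^bsub>Poly d\<^esub> P = P" if "P \<in> carrier (Poly d)" for P
      using Poly_const_mult[of \<one> P d] that by (simp add: Poly_one indexed_const_def Poly_coeff[OF that])
  qed (simp_all add: Poly_mult_closed Poly_mult_assoc, simp add: Poly_mult_comm)
qed (rule Poly_add_mult)

end

section \<open>Pairs of indices\<close>

text \<open>
  Pair \<open>i\<close> consists of the indices \<open>2 * i\<close> and \<open>Suc (2 * i)\<close>. The two-form is the sum of the
  first four pairs, and it adds or removes whole pairs. The pairs that meet \<open>S\<close> in one element
  are therefore never changed, and \<open>S\<close> is determined by its other indices and the list of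
  truth values \<open>bits S\<close>, which tells which of the remaining pairs \<open>even_pairs S\<close> it contains.
  The function \<open>fill\<close> replaces these truth values.
\<close>

definition set_pair :: "nat \<Rightarrow> bool \<Rightarrow> nat set \<Rightarrow> nat set" where
  "set_pair i b S = {k. if k div 2 = i then b else k \<in> S}"

primrec fill :: "nat list \<Rightarrow> bool list \<Rightarrow> nat set \<Rightarrow> nat set" where
  "fill [] bs S = S"
| "fill (i # is) bs S = set_pair i (hd bs) (fill is (tl bs) S)"

definition even_pairs :: "nat set \<Rightarrow> nat list" where
  "even_pairs S = filter (\<lambda>i. 2 * i \<in> S \<longleftrightarrow> Suc (2 * i) \<in> S) [0..<4]"

definition bits :: "nat set \<Rightarrow> bool list" where
  "bits S = map (\<lambda>i. 2 * i \<in> S) (even_pairs S)"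

lemma div2_eq: "k div 2 = i \<longleftrightarrow> k = 2 * i \<or> k = Suc (2 * i)" for k :: nat
  by auto

lemma mem_set_pair: "k \<in> set_pair i b S \<longleftrightarrow> (if k div 2 = i then b else k \<in> S)"
  by (simp add: set_pair_def)

lemma set_pair_True: "set_pair i True S = insert (2 * i) (insert (Suc (2 * i)) S)"
  by (simp add: set_pair_def div2_eq) blast

lemma set_pair_False: "set_pair i False S = S - {2 * i, Suc (2 * i)}"
  by (simp add: set_pair_def div2_eq) blast

lemma finite_set_pair: "finite S \<Longrightarrow> finite (set_pair i b S)"
  by (cases b) (simp_all add: set_pair_True set_pair_False)

lemma finite_fill: "finite S \<Longrightarrow> finite (fill is bs S)"
  by (induction "is" arbitrary: bs) (simp_all add: finite_set_pair)

lemma fill_outside: "k div 2 \<notin> set is \<Longrightarrow> k \<in> fill is bs S \<longleftrightarrow> k \<in> S"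
  by (induction "is" arbitrary: bs) (auto simp: mem_set_pair)

lemma fill_inside: "k div 2 \<in> set is \<Longrightarrow> k \<in> fill is bs S \<longleftrightarrow> k \<in> fill is bs T"
  by (induction "is" arbitrary: bs) (auto simp: mem_set_pair)

lemma fill_fill: "fill is bs (fill is cs S) = fill is bs S"
proof (rule Set.set_eqI)
  show "k \<in> fill is bs (fill is cs S) \<longleftrightarrow> k \<in> fill is bs S" for k
    by (cases "k div 2 \<in> set is") (simp_all add: fill_outside, metis fill_inside)
qed

lemma fill_pair: "i \<in> set is \<Longrightarrow> 2 * i \<in> fill is bs S \<longleftrightarrow> Suc (2 * i) \<in> fill is bs S"
  by (induction "is" arbitrary: bs) (auto simp: mem_set_pair)

lemma set_pair_self:
  "(2 * i \<in> S \<longleftrightarrow> Suc (2 * i) \<in> S) \<Longrightarrow> set_pair i (2 * i \<in> S) S = S"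
  by (auto simp: mem_set_pair div2_eq split: if_splits)

lemma fill_self:
  "(\<And>i. i \<in> set is \<Longrightarrow> 2 * i \<in> S \<longleftrightarrow> Suc (2 * i) \<in> S) \<Longrightarrow> fill is (map (\<lambda>i. 2 * i \<in> S) is) S = S"
proof (induction "is")
  case (Cons i "is")
  then have "fill is (map (\<lambda>i. 2 * i \<in> S) is) S = S" "set_pair i (2 * i \<in> S) S = S"
    by (simp, intro set_pair_self) simp
  then show ?case by (simp only: fill.simps list.map list.sel)
qed simp

lemma map_fill:
  "distinct is \<Longrightarrow> length bs = length is \<Longrightarrow> map (\<lambda>i. 2 * i \<in> fill is bs S) is = bs"
proof (induction "is" arbitrary: bs)
  case (Cons i "is")
  then obtain b bs' where bs: "bs = b # bs'" by (cases bs) auto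
  have "map (\<lambda>j. 2 * j \<in> set_pair i b (fill is bs' S)) is = map (\<lambda>j. 2 * j \<in> fill is bs' S) is"
    using Cons.prems(1) by (intro map_cong) (auto simp: mem_set_pair)
  also have "\<dots> = bs'" using Cons bs by simp
  finally have "map (\<lambda>j. 2 * j \<in> set_pair i b (fill is bs' S)) is = bs'" .
  moreover have "2 * i \<in> set_pair i b (fill is bs' S) \<longleftrightarrow> b" by (simp add: mem_set_pair)
  ultimately show ?case using bs by (simp only: fill.simps list.map list.sel)
qed simp

lemma distinct_even_pairs [simp]: "distinct (even_pairs S)"
  by (simp add: even_pairs_def)

lemma set_even_pairs: "i \<in> set (even_pairs S) \<longleftrightarrow> i < 4 \<and> (2 * i \<in> S \<longleftrightarrow> Suc (2 * i) \<in> S)"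
  by (auto simp: even_pairs_def)

lemma length_bits [simp]: "length (bits S) = length (even_pairs S)"
  by (simp add: bits_def)

lemma even_pairs_fill [simp]: "even_pairs (fill (even_pairs S) bs S) = even_pairs S"
proof -
  have "filter (\<lambda>i. 2 * i \<in> fill (even_pairs S) bs S \<longleftrightarrow> Suc (2 * i) \<in> fill (even_pairs S) bs S) [0..<4]
      = filter (\<lambda>i. 2 * i \<in> S \<longleftrightarrow> Suc (2 * i) \<in> S) [0..<4]"
  proof (intro filter_cong refl)
    fix i assume "i \<in> set [0..<4::nat]"
    then show "(2 * i \<in> fill (even_pairs S) bs S \<longleftrightarrow> Suc (2 * i) \<in> fill (even_pairs S) bs S)
        \<longleftrightarrow> (2 * i \<in> S \<longleftrightarrow> Suc (2 * i) \<in> S)"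
      by (cases "i \<in> set (even_pairs S)") (simp_all add: fill_pair fill_outside set_even_pairs)
  qed
  then show ?thesis by (simp only: even_pairs_def[symmetric])
qed

lemma bits_fill: "length bs = length (even_pairs S) \<Longrightarrow> bits (fill (even_pairs S) bs S) = bs"
  unfolding bits_def[of "fill (even_pairs S) bs S"] by (simp add: map_fill)

lemma fill_bits [simp]: "fill (even_pairs S) (bits S) S = S"
  unfolding bits_def by (rule fill_self) (simp add: set_even_pairs)

lemma card_set_pair:
  assumes "finite S" "2 * i \<in> S \<longleftrightarrow> Suc (2 * i) \<in> S"
  shows "card (set_pair i b S) + 2 * of_bool (2 * i \<in> S) = card S + 2 * of_bool b"
proof (cases "2 * i \<in> S")
  case True
  have "card (S - {2 * i, Suc (2 * i)}) + 2 = card S"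
  proof -
    have "{2 * i, Suc (2 * i)} \<subseteq> S" using True assms(2) by auto
    then have "card {2 * i, Suc (2 * i)} \<le> card S" using assms(1) card_mono by blast
    then show ?thesis using \<open>{2 * i, Suc (2 * i)} \<subseteq> S\<close> by (simp add: card_Diff_subset)
  qed
  then show ?thesis
    using True assms by (cases b) (auto simp: set_pair_True set_pair_False insert_absorb)
next
  case False
  then have "Suc (2 * i) \<notin> S" using assms by blast
  with False assms(1) show ?thesis by (cases b) (simp_all add: set_pair_True set_pair_False)
qed

lemma card_fill:
  assumes "finite S" "distinct is" "length bs = length is"
    and "\<And>i. i \<in> set is \<Longrightarrow> 2 * i \<in> S \<longleftrightarrow> Suc (2 * i) \<in> S"
  shows "card (fill is bs S) + 2 * count_list (map (\<lambda>i. 2 * i \<in> S) is) True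
    = card S + 2 * count_list bs True"
  using assms(2-)
proof (induction "is" arbitrary: bs)
  case (Cons i "is")
  then obtain b bs' where bs: "bs = b # bs'" by (cases bs) auto
  let ?X = "fill is bs' S"
  have i: "2 * i \<in> ?X \<longleftrightarrow> 2 * i \<in> S" "Suc (2 * i) \<in> ?X \<longleftrightarrow> Suc (2 * i) \<in> S"
    using Cons.prems(1) by (simp_all add: fill_outside)
  have "card ?X + 2 * count_list (map (\<lambda>i. 2 * i \<in> S) is) True = card S + 2 * count_list bs' True"
    using Cons bs by auto
  moreover have "card (set_pair i b ?X) + 2 * of_bool (2 * i \<in> S) = card ?X + 2 * of_bool b"
    using card_set_pair[of ?X i b] i Cons.prems(3)[of i] assms(1) by (simp add: finite_fill)
  ultimately show ?case by (cases "2 * i \<in> S"; cases b) (simp_all add: bs)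
qed simp

lemma card_fill_bits:
  assumes "finite S" "length bs = length (even_pairs S)" "Suc (count_list bs True) = count_list (bits S) True"
  shows "card (fill (even_pairs S) bs S) + 2 = card S"
  using card_fill[OF assms(1) distinct_even_pairs assms(2)] assms(3)
  by (simp add: set_even_pairs bits_def)

lemma fill_high: "fill (even_pairs S) bs S - {..<8} = S - {..<8}"
proof (rule Set.set_eqI)
  fix k :: nat
  show "k \<in> fill (even_pairs S) bs S - {..<8} \<longleftrightarrow> k \<in> S - {..<8}"
  proof (cases "k < 8")
    case False
    then have "k div 2 \<notin> set (even_pairs S)" by (auto simp: set_even_pairs)
    then show ?thesis using False by (simp add: fill_outside)
  qed simp
qed

section \<open>Contraction with a two-form and its partial inverse\<close>

context cring
begin

text \<open>
  A function \<open>x\<close> on finite sets is the element of the exterior algebra with coefficient \<open>x S\<close>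
  at the basis vector \<open>e\<^sub>S\<close>. Contraction removes indices from basis vectors, hence it reads
  the coefficients at larger sets. Removing an adjacent pair of indices introduces no sign.
\<close>

definition pair_coeff :: "nat \<Rightarrow> nat set \<Rightarrow> 'a" where
  "pair_coeff i S = (if 2 * i \<in> S \<or> Suc (2 * i) \<in> S then \<zero> else \<one>)"

definition pair_sum :: "(nat set \<Rightarrow> 'a) \<Rightarrow> nat set \<Rightarrow> 'a" where
  "pair_sum x S = (\<Oplus>i\<in>{..<4}. pair_coeff i S \<otimes> x (set_pair i True S))"

lemma pair_coeff_closed [simp]: "pair_coeff i S \<in> carrier R"
  by (simp add: pair_coeff_def)

lemma up_sum_cong:
  "(\<And>cs. length cs = length bs \<Longrightarrow> f cs = g cs) \<Longrightarrow> up_sum bs f = up_sum bs g"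
proof (induction bs arbitrary: f g)
  case (Cons b bs)
  have "up_sum bs (\<lambda>cs. f (b # cs)) = up_sum bs (\<lambda>cs. g (b # cs))"
    by (rule Cons.IH) (simp add: Cons.prems)
  then show ?case using Cons.prems[of "True # bs"] by simp
qed simp

lemma up_sum_fill:
  assumes "distinct is" "\<And>T. x T \<in> carrier R"
    and "\<And>i. i \<in> set is \<Longrightarrow> 2 * i \<in> S \<longleftrightarrow> Suc (2 * i) \<in> S"
  shows "up_sum (map (\<lambda>i. 2 * i \<in> S) is) (\<lambda>bs. x (fill is bs S))
    = (\<Oplus>i\<in>{i \<in> set is. 2 * i \<notin> S}. x (set_pair i True S))"
  using assms
proof (induction "is" arbitrary: x)
  case (Cons i "is")
  let ?b = "2 * i \<in> S"
  have "up_sum (map (\<lambda>i. 2 * i \<in> S) is) (\<lambda>cs. x (set_pair i ?b (fill is cs S)))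
      = (\<Oplus>j\<in>{j \<in> set is. 2 * j \<notin> S}. x (set_pair i ?b (set_pair j True S)))"
    using Cons.prems by (intro Cons.IH) auto
  also have "\<dots> = (\<Oplus>j\<in>{j \<in> set is. 2 * j \<notin> S}. x (set_pair j True S))"
  proof (intro finsum_cong')
    fix j assume "j \<in> {j \<in> set is. 2 * j \<notin> S}"
    then have "j \<noteq> i" using Cons.prems(1) by auto
    then have "set_pair i ?b (set_pair j True S) = set_pair j True S"
      using Cons.prems(3)[of i] by (auto simp: mem_set_pair div2_eq split: if_splits)
    then show "x (set_pair i ?b (set_pair j True S)) = x (set_pair j True S)" by simp
  qed (use Cons.prems in auto)
  finally have tail: "up_sum (map (\<lambda>i. 2 * i \<in> S) is) (\<lambda>cs. x (set_pair i ?b (fill is cs S)))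
      = (\<Oplus>j\<in>{j \<in> set is. 2 * j \<notin> S}. x (set_pair j True S))" .
  have "fill is (map (\<lambda>i. 2 * i \<in> S) is) S = S"
    using Cons.prems(3) by (intro fill_self) auto
  then have head: "x (set_pair i True (fill is (map (\<lambda>i. 2 * i \<in> S) is) S)) = x (set_pair i True S)"
    by simp
  have cl: "(\<Oplus>j\<in>{j \<in> set is. 2 * j \<notin> S}. x (set_pair j True S)) \<in> carrier R"
    using Cons.prems(2) by (intro finsum_closed) auto
  show ?case
  proof (cases ?b)
    case True
    have "{j \<in> set (i # is). 2 * j \<notin> S} = {j \<in> set is. 2 * j \<notin> S}" using True by auto
    then show ?thesis using True tail cl by (simp only: list.map up_sum.simps fill.simps list.sel if_True l_zero)
  next
    case False
    have "(\<Oplus>j\<in>{j \<in> set (i # is). 2 * j \<notin> S}. x (set_pair j True S))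
        = x (set_pair i True S) \<oplus> (\<Oplus>j\<in>{j \<in> set is. 2 * j \<notin> S}. x (set_pair j True S))"
    proof -
      have "{j \<in> set (i # is). 2 * j \<notin> S} = insert i {j \<in> set is. 2 * j \<notin> S}" using False by auto
      then show ?thesis using Cons.prems(1,2) by simp
    qed
    then show ?thesis using False tail head by (simp only: list.map up_sum.simps fill.simps list.sel if_False)
  qed
qed simp

text \<open>
  The contraction splits into copies of the operators on Boolean lattices of rank at most
  four, one for each choice of the indices that it cannot change.
\<close>

lemma pair_sum_bits:
  assumes "\<And>T. x T \<in> carrier R"
  shows "pair_sum x S = up_sum (bits S) (\<lambda>bs. x (fill (even_pairs S) bs S))"
proof -
  have "pair_sum x S = (\<Oplus>i\<in>{i \<in> set (even_pairs S). 2 * i \<notin> S}. x (set_pair i True S))"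
    unfolding pair_sum_def using assms
    by (intro add.finprod_mono_neutral_cong_right) (auto simp: set_even_pairs pair_coeff_def)
  also have "\<dots> = up_sum (bits S) (\<lambda>bs. x (fill (even_pairs S) bs S))"
    unfolding bits_def using assms by (intro up_sum_fill[symmetric]) (auto simp: set_even_pairs)
  finally show ?thesis .
qed

lemma pair_sum_mem:
  assumes "additive_subgroup H R"
    and "\<And>i. i < 4 \<Longrightarrow> 2 * i \<notin> S \<Longrightarrow> Suc (2 * i) \<notin> S \<Longrightarrow> x (set_pair i True S) \<in> H"
    and "\<And>T. x T \<in> carrier R"
  shows "pair_sum x S \<in> H"
proof -
  interpret H: additive_subgroup H R by fact
  show ?thesis unfolding pair_sum_def
    using assms by (intro additive_subgroup_finsum) (auto simp: pair_coeff_def)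
qed

lemma pair_sum_linear:
  assumes "8 \<le> d"
  shows "linear_map R (fun_module R (Pow {..<d})) (fun_module R (Pow {..<d})) pair_sum"
  unfolding pair_sum_def[abs_def]
  by (rule linear_map_matrix) (auto simp: set_pair_True)

end

context half_ring
begin

text \<open>
  The partial inverse of the contraction, assembled from the partial inverses on the Boolean
  lattices.
\<close>

definition pair_inv :: "(nat set \<Rightarrow> 'a) \<Rightarrow> nat set \<Rightarrow> 'a" where
  "pair_inv y S = part_inv (bits S) (\<lambda>bs. y (fill (even_pairs S) bs S))"

lemma part_inv_cong_length:
  assumes "\<And>cs. length cs = length bs \<Longrightarrow> f cs = g cs"
  shows "part_inv bs f = part_inv bs g"
proof (cases "bs \<in> sources")
  case True
  then have "part_inv bs f = part_inv bs (\<lambda>cs. if length cs = length bs then f cs else g cs)" for g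
    unfolding sources_def by (elim insertE emptyE) simp_all
  moreover have "(\<lambda>cs. if length cs = length bs then f cs else g cs) = g"
    using assms by auto
  ultimately show ?thesis by metis
qed (simp add: part_inv_outside)

lemma pair_inv_outside: "bits S \<notin> sources \<Longrightarrow> pair_inv y S = \<zero>"
  by (simp add: pair_inv_def part_inv_outside)

lemma pair_inv_closed: "(\<And>T. y T \<in> carrier R) \<Longrightarrow> pair_inv y S \<in> carrier R"
  by (simp add: pair_inv_def part_inv_closed)

lemma pair_inv_mem:
  assumes "additive_subgroup H R" "\<And>x. x \<in> H \<Longrightarrow> u \<otimes> x \<in> H" "finite S"
    and "\<And>T. finite T \<Longrightarrow> card T + 2 = card S \<Longrightarrow> T - {..<8} = S - {..<8} \<Longrightarrow> y T \<in> H"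
  shows "pair_inv y S \<in> H"
  unfolding pair_inv_def
proof (rule part_inv_mem[OF assms(1,2)])
  fix cs :: "bool list" assume "length cs = length (bits S)" "Suc (count_list cs True) = count_list (bits S) True"
  then show "y (fill (even_pairs S) cs S) \<in> H"
    using assms(3) by (intro assms(4) finite_fill card_fill_bits fill_high) simp_all
qed

lemma pair_inv_fill:
  assumes "length bs = length (even_pairs S)"
  shows "pair_inv y (fill (even_pairs S) bs S) = part_inv bs (\<lambda>cs. y (fill (even_pairs S) cs S))"
  using assms by (simp add: pair_inv_def bits_fill fill_fill)

lemma pair_sum_fill:
  assumes "length bs = length (even_pairs S)" "\<And>T. x T \<in> carrier R"
  shows "pair_sum x (fill (even_pairs S) bs S) = up_sum bs (\<lambda>cs. x (fill (even_pairs S) cs S))"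
  using assms by (simp add: pair_sum_bits bits_fill fill_fill)

lemma pair_sum_pair_inv:
  assumes "bits S \<in> targets" "\<And>T. y T \<in> carrier R"
  shows "pair_sum (pair_inv y) S = y S"
proof -
  have "pair_sum (pair_inv y) S
      = up_sum (bits S) (\<lambda>bs. part_inv bs (\<lambda>cs. y (fill (even_pairs S) cs S)))"
    using assms(2) by (subst pair_sum_bits) (auto simp: pair_inv_closed pair_inv_fill intro!: up_sum_cong)
  also have "\<dots> = y (fill (even_pairs S) (bits S) S)"
    using assms by (intro up_sum_part_inv)
  finally show ?thesis by simp
qed

lemma pair_inv_pair_sum:
  assumes "\<And>T. x T \<in> carrier R" "\<And>T. bits T \<notin> sources \<Longrightarrow> x T = \<zero>"
  shows "pair_inv (pair_sum x) S = x S"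
proof (cases "bits S \<in> sources")
  case True
  define f :: "bool list \<Rightarrow> 'a" where "f cs = (if length cs = length (even_pairs S) then x (fill (even_pairs S) cs S) else \<zero>)" for cs
  have "pair_inv (pair_sum x) S = part_inv (bits S) (\<lambda>bs. up_sum bs f)"
    unfolding pair_inv_def
  proof (rule part_inv_cong_length)
    fix cs :: "bool list" assume "length cs = length (bits S)"
    then show "pair_sum x (fill (even_pairs S) cs S) = up_sum cs f"
      using assms(1) by (auto simp: pair_sum_fill f_def intro: up_sum_cong)
  qed
  also have "\<dots> = f (bits S)"
    by (rule part_inv_up_sum[OF True]) (auto simp: f_def assms bits_fill)
  finally show ?thesis by (simp add: f_def)
qed (simp add: pair_inv_outside assms(2))

lemma pair_inv_eq_zero:
  assumes "\<And>T. bits T \<in> targets \<Longrightarrow> y T = \<zero>"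
  shows "pair_inv y S = \<zero>"
proof -
  define f :: "bool list \<Rightarrow> 'a" where "f cs = (if length cs = length (even_pairs S) then y (fill (even_pairs S) cs S) else \<zero>)" for cs
  have "pair_inv y S = part_inv (bits S) f"
    unfolding pair_inv_def by (rule part_inv_cong_length) (simp add: f_def)
  also have "\<dots> = part_inv (bits S) (\<lambda>_. \<zero>)"
    by (rule part_inv_cong) (auto simp: f_def assms bits_fill)
  also have "part_inv (bits S) (\<lambda>_. \<zero>) \<in> {\<zero>}"
    by (rule part_inv_mem) (auto intro!: additive_subgroupI add.triv_subgroup)
  finally show ?thesis by simp
qed

lemma pair_inv_linear:
  assumes "8 \<le> d"
  shows "linear_map R (fun_module R (Pow {..<d})) (fun_module R (Pow {..<d})) pair_inv"
proof (rule linear_mapI)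
  fix f assume f: "f \<in> carrier (fun_module R (Pow {..<d}))"
  have "pair_inv f S = \<zero>" if "\<not> S \<subseteq> {..<d}" for S
  proof -
    have "f (fill (even_pairs S) bs S) = \<zero>" for bs
    proof -
      have "\<not> fill (even_pairs S) bs S \<subseteq> {..<d}"
        using that fill_high[of S bs] assms by fastforce
      then show ?thesis using f by (simp add: fun_module_carrier)
    qed
    then have "pair_inv f S = part_inv (bits S) (\<lambda>_. \<zero>)" by (simp add: pair_inv_def)
    also have "\<dots> \<in> {\<zero>}"
      by (rule part_inv_mem) (auto intro!: additive_subgroupI add.triv_subgroup)
    finally show ?thesis by simp
  qed
  then show "pair_inv f \<in> carrier (fun_module R (Pow {..<d}))"
    using f by (auto simp: fun_module_carrier pair_inv_closed)
  fix S
  show "pair_inv (\<lambda>i. a \<otimes> f i) S = a \<otimes> pair_inv f S" if "a \<in> carrier R" for a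
    unfolding pair_inv_def using that fun_moduleD[OF f] by (intro part_inv_smult)
  fix g assume g: "g \<in> carrier (fun_module R (Pow {..<d}))"
  show "pair_inv (\<lambda>i. f i \<oplus> g i) S = pair_inv f S \<oplus> pair_inv g S"
    unfolding pair_inv_def using fun_moduleD[OF f] fun_moduleD[OF g] by (intro part_inv_add)
qed

end

section \<open>The Koszul differential\<close>

context cring
begin

text \<open>
  The sign with which \<open>e\<^sub>S\<close> occurs in the contraction of \<open>e\<^sub>T\<close> along the \<open>j\<close>-th coordinate,
  where \<open>T = insert j S\<close>. Counting the smaller indices keeps the sign meaningful for infinite
  \<open>S\<close> as well.
\<close>

definition sgn_ins :: "nat \<Rightarrow> nat set \<Rightarrow> 'a" where
  "sgn_ins j S = (if j \<in> S then \<zero> else if even (card {k \<in> S. k < j}) then \<one> else \<ominus> \<one>)"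

definition koszul :: "(nat \<Rightarrow> 'a) \<Rightarrow> nat \<Rightarrow> (nat set \<Rightarrow> 'a) \<Rightarrow> nat set \<Rightarrow> 'a" where
  "koszul t d x S = (\<Oplus>j\<in>{..<d}. (t j \<otimes> sgn_ins j S) \<otimes> x (insert j S))"

lemma sgn_ins_closed [simp]: "sgn_ins j S \<in> carrier R"
  by (simp add: sgn_ins_def)

lemma sgn_ins_insert_greater: "j < k \<Longrightarrow> sgn_ins j (insert k S) = sgn_ins j S"
proof -
  assume "j < k"
  then have "{i \<in> insert k S. i < j} = {i \<in> S. i < j}" by auto
  with \<open>j < k\<close> show ?thesis by (simp add: sgn_ins_def)
qed

lemma sgn_ins_insert_less:
  assumes "j < k" "j \<notin> S" shows "sgn_ins k (insert j S) = \<ominus> sgn_ins k S"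
proof -
  have "{i \<in> insert j S. i < k} = insert j {i \<in> S. i < k}" using assms(1) by auto
  with assms show ?thesis by (simp add: sgn_ins_def)
qed

lemma sgn_ins_anticommute:
  assumes "j \<noteq> k"
  shows "sgn_ins j S \<otimes> sgn_ins k (insert j S) = \<ominus> (sgn_ins k S \<otimes> sgn_ins j (insert k S))"
proof -
  have *: "sgn_ins j S \<otimes> sgn_ins k (insert j S) = \<ominus> (sgn_ins k S \<otimes> sgn_ins j (insert k S))"
    if "j < k" for j k
  proof (cases "j \<in> S")
    case True
    then show ?thesis by (simp add: sgn_ins_def)
  next
    case False
    then show ?thesis
      using that by (simp add: sgn_ins_insert_less sgn_ins_insert_greater r_minus m_comm)
  qed
  show ?thesis
  proof (cases "j < k")
    case False
    then show ?thesis using *[of k j] assms by simp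
  qed (rule *)
qed

lemma koszul_linear:
  assumes "\<And>j. j < d \<Longrightarrow> t j \<in> carrier R"
  shows "linear_map R (fun_module R (Pow {..<d})) (fun_module R (Pow {..<d})) (koszul t d)"
  unfolding koszul_def[abs_def] by (rule linear_map_matrix) (use assms in auto)

lemma koszul_mem:
  assumes H: "additive_subgroup H R" and t: "\<And>j. j < d \<Longrightarrow> t j \<in> carrier R"
    and x: "\<And>T. x T \<in> carrier R"
    and mem: "\<And>j. j < d \<Longrightarrow> j \<notin> S \<Longrightarrow> t j \<otimes> x (insert j S) \<in> H"
  shows "koszul t d x S \<in> H"
proof -
  interpret H: additive_subgroup H R by fact
  show ?thesis unfolding koszul_def
  proof (rule additive_subgroup_finsum[OF H])
    fix j assume j: "j \<in> {..<d}"
    then have "(t j \<otimes> sgn_ins j S) \<otimes> x (insert j S) = sgn_ins j S \<otimes> (t j \<otimes> x (insert j S))"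
      using t x by (simp add: m_assoc m_lcomm)
    also have "\<dots> \<in> H" using mem[of j] j t x by (auto simp: sgn_ins_def l_minus)
    finally show "(t j \<otimes> sgn_ins j S) \<otimes> x (insert j S) \<in> H" .
  qed simp
qed

lemma koszul_koszul:
  assumes t: "\<And>j. j < d \<Longrightarrow> t j \<in> carrier R" and x: "\<And>T. x T \<in> carrier R"
  shows "koszul t d (koszul t d x) S = \<zero>"
proof -
  let ?a = "\<lambda>j k. (t j \<otimes> sgn_ins j S) \<otimes> ((t k \<otimes> sgn_ins k (insert j S)) \<otimes> x (insert k (insert j S)))"
  have "koszul t d (koszul t d x) S = (\<Oplus>j\<in>{..<d}. \<Oplus>k\<in>{..<d}. ?a j k)"
    unfolding koszul_def[of t d "koszul t d x"]
  proof (intro finsum_cong')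
    fix j assume "j \<in> {..<d}"
    then show "(t j \<otimes> sgn_ins j S) \<otimes> koszul t d x (insert j S) = (\<Oplus>k\<in>{..<d}. ?a j k)"
      using t x by (simp add: koszul_def finsum_rdistr Pi_def)
  qed (use t x in \<open>auto intro!: finsum_closed\<close>)
  also have "\<dots> = \<zero>"
  proof (rule alternating_finsum_zero)
    fix j k assume jk: "j < d" "k < d"
    show "?a j k \<in> carrier R" using jk t x by simp
    show "?a j k = \<ominus> ?a k j" if "j \<noteq> k"
    proof -
      let ?x = "x (insert k (insert j S))"
      have a: "?a j k = (t j \<otimes> t k \<otimes> ?x) \<otimes> (sgn_ins j S \<otimes> sgn_ins k (insert j S))"
        using jk t x by (simp add: m_ac)
      have b: "?a k j = (t j \<otimes> t k \<otimes> ?x) \<otimes> (sgn_ins k S \<otimes> sgn_ins j (insert k S))"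
        using jk t x by (simp add: m_ac insert_commute[of k j])
      show ?thesis unfolding a b sgn_ins_anticommute[OF that] using jk t x by (simp add: r_minus)
    qed
  next
    fix j assume "j < d"
    then show "?a j j = \<zero>" using t x by (simp add: sgn_ins_def)
  qed
  finally show ?thesis .
qed

text \<open>
  A pair other than that of \<open>j\<close> contributes zero or two indices below \<open>j\<close> and so leaves the
  sign unchanged. If \<open>j\<close> belongs to the pair, both sides vanish.
\<close>

lemma sgn_ins_pair_coeff:
  "sgn_ins j S \<otimes> pair_coeff i (insert j S) = pair_coeff i S \<otimes> sgn_ins j (set_pair i True S)"
proof (cases "2 * i \<in> S \<or> Suc (2 * i) \<in> S")
  case True
  then have "pair_coeff i (insert j S) = \<zero>" "pair_coeff i S = \<zero>" by (auto simp: pair_coeff_def)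
  then show ?thesis by simp
next
  case False
  show ?thesis
  proof (cases "j div 2 = i")
    case True
    then have "pair_coeff i (insert j S) = \<zero>" "sgn_ins j (set_pair i True S) = \<zero>"
      by (auto simp: pair_coeff_def sgn_ins_def mem_set_pair div2_eq)
    then show ?thesis by simp
  next
    case ne: False
    then have j: "j \<noteq> 2 * i" "j \<noteq> Suc (2 * i)" by auto
    have "sgn_ins j (set_pair i True S) = sgn_ins j S"
    proof (cases "2 * i < j")
      case True
      then have "Suc (2 * i) < j" using j by linarith
      with True show ?thesis using False
        by (simp add: set_pair_True sgn_ins_insert_less)
    next
      case lt: False
      then have "j < 2 * i" using j by linarith
      then show ?thesis by (simp add: set_pair_True sgn_ins_insert_greater)
    qed
    moreover have "pair_coeff i (insert j S) = pair_coeff i S" using j by (auto simp: pair_coeff_def)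
    ultimately show ?thesis by (simp add: m_comm)
  qed
qed

text \<open>
  Contractions anticommute, so the even contraction with a two-form commutes with the Koszul
  differential.
\<close>

lemma koszul_pair_sum:
  assumes t: "\<And>j. j < d \<Longrightarrow> t j \<in> carrier R" and x: "\<And>T. x T \<in> carrier R"
  shows "koszul t d (pair_sum x) S = pair_sum (koszul t d x) S"
proof -
  let ?x = "\<lambda>j i. x (insert j (set_pair i True S))"
  let ?a = "\<lambda>j i. (t j \<otimes> ?x j i) \<otimes> (sgn_ins j S \<otimes> pair_coeff i (insert j S))"
  have comm: "set_pair i True (insert j S) = insert j (set_pair i True S)" for i j
    by (auto simp: set_pair_True)
  have "koszul t d (pair_sum x) S = (\<Oplus>j\<in>{..<d}. \<Oplus>i\<in>{..<4}. ?a j i)"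
    unfolding koszul_def[of t d "pair_sum x"]
  proof (intro finsum_cong')
    fix j assume j: "j \<in> {..<d}"
    have "(t j \<otimes> sgn_ins j S) \<otimes> pair_sum x (insert j S)
        = (\<Oplus>i\<in>{..<4}. (t j \<otimes> sgn_ins j S) \<otimes> (pair_coeff i (insert j S) \<otimes> ?x j i))"
      using t x j by (simp add: pair_sum_def finsum_rdistr Pi_def comm)
    also have "\<dots> = (\<Oplus>i\<in>{..<4}. ?a j i)"
      using t x j by (intro finsum_cong') (auto simp: m_ac)
    finally show "(t j \<otimes> sgn_ins j S) \<otimes> pair_sum x (insert j S) = (\<Oplus>i\<in>{..<4}. ?a j i)" .
  qed (use t x in \<open>auto intro!: finsum_closed\<close>)
  also have "\<dots> = (\<Oplus>i\<in>{..<4}. \<Oplus>j\<in>{..<d}. ?a j i)"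
    using t x by (intro finsum_swap) auto
  also have "\<dots> = pair_sum (koszul t d x) S"
    unfolding pair_sum_def
  proof (intro finsum_cong')
    fix i :: nat
    have "pair_coeff i S \<otimes> koszul t d x (set_pair i True S)
        = (\<Oplus>j\<in>{..<d}. pair_coeff i S \<otimes> ((t j \<otimes> sgn_ins j (set_pair i True S)) \<otimes> ?x j i))"
      using t x by (simp add: koszul_def finsum_rdistr Pi_def)
    also have "\<dots> = (\<Oplus>j\<in>{..<d}. ?a j i)"
      unfolding sgn_ins_pair_coeff using t x by (intro finsum_cong') (auto simp: m_ac)
    finally show "(\<Oplus>j\<in>{..<d}. ?a j i) = pair_coeff i S \<otimes> koszul t d x (set_pair i True S)" ..
  qed (use t x in \<open>auto simp: koszul_def intro!: finsum_closed\<close>)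
  finally show ?thesis .
qed

end

section \<open>Cutting down a complex along a partial contraction\<close>

text \<open>
  If \<open>h\<close> has square zero and \<open>h D h = h\<close>, then \<open>D h + h D\<close> is a projection that is homotopic
  to zero. The complementary projection maps onto the subcomplex \<open>ker h \<inter> ker (h D)\<close>, which
  has the same cohomology. The additional datum \<open>\<rho>\<close> is a coordinate projection that identifies
  this subcomplex with the image of \<open>\<rho>\<close>, on which the differential becomes \<open>small_diff\<close>. This
  makes the small complex visibly free.
\<close>

locale partial_contraction = abelian_group C for C (structure) +
  fixes D h \<rho>
  assumes D_hom: "abelian_group_hom C C D"
    and h_hom: "abelian_group_hom C C h"
    and \<rho>_hom: "abelian_group_hom C C \<rho>"
    and D_D: "z \<in> carrier C \<Longrightarrow> D (D z) = \<zero>"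
    and h_h: "z \<in> carrier C \<Longrightarrow> h (h z) = \<zero>"
    and h_D_h: "z \<in> carrier C \<Longrightarrow> h (D (h z)) = h z"
    and h_\<rho>: "z \<in> carrier C \<Longrightarrow> h (\<rho> z) = \<zero>"
    and \<rho>_h: "z \<in> carrier C \<Longrightarrow> \<rho> (h z) = \<zero>"
    and \<rho>_recover: "z \<in> carrier C \<Longrightarrow> h z = \<zero> \<Longrightarrow> h (D z) = \<zero> \<Longrightarrow> \<rho> z \<ominus> h (D (\<rho> z)) = z"
begin

sublocale D: abelian_group_hom C C D by (rule D_hom)
sublocale h: abelian_group_hom C C h by (rule h_hom)
sublocale \<rho>: abelian_group_hom C C \<rho> by (rule \<rho>_hom)

lemma hom_minus:
  assumes "a \<in> carrier C" "b \<in> carrier C"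
  shows "D (a \<ominus> b) = D a \<ominus> D b" "h (a \<ominus> b) = h a \<ominus> h b" "\<rho> (a \<ominus> b) = \<rho> a \<ominus> \<rho> b"
  using assms by (simp_all add: a_minus_def)

lemma minus_zero_right: "a \<in> carrier C \<Longrightarrow> a \<ominus> \<zero> = a"
  by (simp add: a_minus_def)

lemma minus_self: "a \<in> carrier C \<Longrightarrow> a \<ominus> a = \<zero>"
  by (simp add: a_minus_def r_neg)

text \<open>
  The inverse of \<open>\<rho>\<close> on the subcomplex, the transported differential, and the projection onto
  the subcomplex.
\<close>

definition lift :: "'a \<Rightarrow> 'a" where "lift e = e \<ominus> h (D e)"

definition small_diff :: "'a \<Rightarrow> 'a" where "small_diff e = \<rho> (D (lift e))"

definition proj :: "'a \<Rightarrow> 'a" where "proj z = z \<ominus> D (h z) \<ominus> h (D z)"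

lemma lift_closed [simp]: "e \<in> carrier C \<Longrightarrow> lift e \<in> carrier C"
  by (simp add: lift_def)

lemma proj_closed [simp]: "z \<in> carrier C \<Longrightarrow> proj z \<in> carrier C"
  by (simp add: proj_def)

lemma lift_kernel:
  assumes "e \<in> carrier C" "\<rho> e = e"
  shows "h (lift e) = \<zero>" "h (D (lift e)) = \<zero>"
  using assms h_\<rho>[of e] by (simp_all add: lift_def hom_minus h_h h_D_h a_minus_def r_neg)

lemma \<rho>_lift:
  assumes "e \<in> carrier C" "\<rho> e = e" shows "\<rho> (lift e) = e"
  using assms by (simp add: lift_def hom_minus \<rho>_h minus_zero_right)

lemma lift_\<rho>:
  assumes "z \<in> carrier C" "h z = \<zero>" "h (D z) = \<zero>" shows "lift (\<rho> z) = z"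
  using assms \<rho>_recover by (simp add: lift_def)

lemma lift_small_diff:
  assumes "e \<in> carrier C" "\<rho> e = e" shows "lift (small_diff e) = D (lift e)"
  unfolding small_diff_def using assms lift_kernel[OF assms] by (intro lift_\<rho>) (simp_all add: D_D)

lemma small_diff_small_diff:
  assumes "e \<in> carrier C" "\<rho> e = e" shows "small_diff (small_diff e) = \<zero>"
  using assms by (subst small_diff_def) (simp add: lift_small_diff D_D)

lemma proj_kernel:
  assumes "z \<in> carrier C" shows "h (proj z) = \<zero>" "h (D (proj z)) = \<zero>"
  using assms by (simp_all add: proj_def hom_minus h_D_h h_h D_D minus_self minus_zero_right)

lemma D_proj: "z \<in> carrier C \<Longrightarrow> D (proj z) = D z \<ominus> D (h (D z))"
  by (simp add: proj_def hom_minus D_D minus_zero_right)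

lemma small_diff_eq_zero_iff:
  assumes "e \<in> carrier C" "\<rho> e = e"
  shows "small_diff e = \<zero> \<longleftrightarrow> D (lift e) = \<zero>"
proof
  assume "small_diff e = \<zero>"
  then have "D (lift e) = lift \<zero>" using lift_small_diff[OF assms] by simp
  then show "D (lift e) = \<zero>" by (simp add: lift_def minus_zero_right)
qed (simp add: small_diff_def)

text \<open>
  A boundary of the large complex that lies in the subcomplex is a boundary there, since the
  projection \<open>proj\<close> commutes with \<open>D\<close> and fixes the subcomplex.
\<close>

lemma small_boundary_iff:
  assumes "e \<in> carrier C" "\<rho> e = e" and \<rho>\<rho>: "\<And>z. z \<in> carrier C \<Longrightarrow> \<rho> (\<rho> z) = \<rho> z"
  shows "(\<exists>f\<in>carrier C. \<rho> f = f \<and> small_diff f = e) \<longleftrightarrow> (\<exists>z\<in>carrier C. D z = lift e)"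
proof
  assume "\<exists>f\<in>carrier C. \<rho> f = f \<and> small_diff f = e"
  then show "\<exists>z\<in>carrier C. D z = lift e" using lift_small_diff lift_closed by metis
next
  assume "\<exists>z\<in>carrier C. D z = lift e"
  then obtain z where z: "z \<in> carrier C" "D z = lift e" by blast
  have "D (proj z) = lift e"
    using z lift_kernel[OF assms(1,2)] by (simp add: D_proj minus_zero_right assms)
  then have "small_diff (\<rho> (proj z)) = e"
    using z(1) proj_kernel[OF z(1)] assms by (simp add: small_diff_def lift_\<rho> \<rho>_lift)
  then show "\<exists>f\<in>carrier C. \<rho> f = f \<and> small_diff f = e"
    using z(1) \<rho>\<rho> by (intro bexI[of _ "\<rho> (proj z)"]) simp_all
qed

end

section \<open>The cone of the contraction\<close>

text \<open>
  The mapping cone of the contraction with the two-form on the Koszul complex of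
  \<open>t 0, \<dots>, t (d - 1)\<close>. An element is a pair \<open>(x, y)\<close> of elements of the exterior algebra with
  differential \<open>(\<kappa> x, \<omega> x - \<kappa> y)\<close>. It is stored as one function on natural numbers: the
  coefficient of \<open>x\<close> at \<open>S\<close> sits at twice the code of \<open>S\<close>, and that of \<open>y\<close> at the following
  odd number.
\<close>

locale koszul_cone = half_ring +
  fixes t :: "nat \<Rightarrow> 'a" and d :: nat
  assumes t_closed: "j < d \<Longrightarrow> t j \<in> carrier R" and d_ge: "8 \<le> d"
begin

definition ix :: "nat set" where
  "ix = {n. set_decode (n div 2) \<subseteq> {..<d}}"

definition xp :: "(nat \<Rightarrow> 'a) \<Rightarrow> nat set \<Rightarrow> 'a" where
  "xp z S = (if S \<subseteq> {..<d} then z (2 * set_encode S) else \<zero>)"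

definition yp :: "(nat \<Rightarrow> 'a) \<Rightarrow> nat set \<Rightarrow> 'a" where
  "yp z S = (if S \<subseteq> {..<d} then z (Suc (2 * set_encode S)) else \<zero>)"

definition mk :: "(nat set \<Rightarrow> 'a) \<Rightarrow> (nat set \<Rightarrow> 'a) \<Rightarrow> nat \<Rightarrow> 'a" where
  "mk x y n = (if even n then x else y) (set_decode (n div 2))"

abbreviation L where "L \<equiv> fun_module R (Pow {..<d})"
abbreviation C where "C \<equiv> fun_module R ix"

lemma xp_closed: "z \<in> carrier C \<Longrightarrow> xp z \<in> carrier L"
  by (simp add: fun_module_carrier xp_def)

lemma yp_closed: "z \<in> carrier C \<Longrightarrow> yp z \<in> carrier L"
  by (simp add: fun_module_carrier yp_def)

lemma mk_closed: "x \<in> carrier L \<Longrightarrow> y \<in> carrier L \<Longrightarrow> mk x y \<in> carrier C"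
  by (auto simp: fun_module_carrier mk_def ix_def)

lemma set_encode_inv: "S \<subseteq> {..<d} \<Longrightarrow> set_decode (set_encode S) = S"
  by (rule set_encode_inverse) (rule finite_subset, auto)

lemma xp_mk: "x \<in> carrier L \<Longrightarrow> xp (mk x y) = x"
  by (auto simp: fun_eq_iff xp_def mk_def fun_module_carrier set_encode_inv)

lemma yp_mk: "y \<in> carrier L \<Longrightarrow> yp (mk x y) = y"
  by (auto simp: fun_eq_iff yp_def mk_def fun_module_carrier set_encode_inv)

lemma mk_xp_yp: "z \<in> carrier C \<Longrightarrow> mk (xp z) (yp z) = z"
proof
  fix n assume z: "z \<in> carrier C"
  show "mk (xp z) (yp z) n = z n"
  proof (cases "n \<in> ix")
    case False
    then show ?thesis using z by (simp add: fun_module_carrier mk_def xp_def yp_def ix_def)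
  next
    case True
    have "even n \<Longrightarrow> 2 * (n div 2) = n" "odd n \<Longrightarrow> Suc (2 * (n div 2)) = n" by simp_all
    then show ?thesis using True by (simp add: mk_def xp_def yp_def ix_def)
  qed
qed

lemma cone_eqI:
  "z \<in> carrier C \<Longrightarrow> z' \<in> carrier C \<Longrightarrow> xp z = xp z' \<Longrightarrow> yp z = yp z' \<Longrightarrow> z = z'"
  by (metis mk_xp_yp)

abbreviation \<kappa> where "\<kappa> \<equiv> koszul t d"

lemma \<kappa>_linear: "linear_map R L L \<kappa>"
  by (rule koszul_linear) (rule t_closed)

lemmas \<omega>_linear = pair_sum_linear[OF d_ge]
lemmas \<sigma>_linear = pair_inv_linear[OF d_ge]

definition cone_diff :: "(nat \<Rightarrow> 'a) \<Rightarrow> nat \<Rightarrow> 'a" where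
  "cone_diff z = mk (\<kappa> (xp z)) (\<lambda>S. pair_sum (xp z) S \<ominus> \<kappa> (yp z) S)"

text \<open>
  The partial inverse of the contraction, regarded as an operator from the second summand of
  the cone to the first.
\<close>

definition cone_htpy :: "(nat \<Rightarrow> 'a) \<Rightarrow> nat \<Rightarrow> 'a" where
  "cone_htpy z = mk (pair_inv (yp z)) (\<lambda>S. \<zero>)"

text \<open>
  The coordinates that survive: those of the first summand that are not columns, and those of
  the second summand that are not rows, of the invertible submatrix.
\<close>

definition small_ix :: "nat set" where
  "small_ix = {n \<in> ix. bits (set_decode (n div 2)) \<notin> (if even n then sources else targets)}"

definition cut :: "(nat \<Rightarrow> 'a) \<Rightarrow> nat \<Rightarrow> 'a" where
  "cut z n = (if n \<in> small_ix then z n else \<zero>)"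

lemma L_minus: "x \<in> carrier L \<Longrightarrow> y \<in> carrier L \<Longrightarrow> (\<lambda>S. x S \<ominus> y S) \<in> carrier L"
  by (simp add: fun_module_carrier a_minus_def)

lemma L_zero: "(\<lambda>S. \<zero>) \<in> carrier L"
  by (simp add: fun_module_carrier)

lemma cone_diff_parts:
  assumes "z \<in> carrier C"
  shows "xp (cone_diff z) = \<kappa> (xp z)" "yp (cone_diff z) = (\<lambda>S. pair_sum (xp z) S \<ominus> \<kappa> (yp z) S)"
  using assms unfolding cone_diff_def
  by (simp_all add: xp_mk yp_mk L_minus linear_map_closed[OF \<kappa>_linear] linear_map_closed[OF \<omega>_linear]
      xp_closed yp_closed)

lemma cone_htpy_parts:
  assumes "z \<in> carrier C"
  shows "xp (cone_htpy z) = pair_inv (yp z)" "yp (cone_htpy z) = (\<lambda>S. \<zero>)"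
  using assms unfolding cone_htpy_def
  by (simp_all add: xp_mk yp_mk L_zero linear_map_closed[OF \<sigma>_linear] xp_closed yp_closed)

lemma parts_add: "xp (\<lambda>n. z n \<oplus> z' n) = (\<lambda>S. xp z S \<oplus> xp z' S)" "yp (\<lambda>n. z n \<oplus> z' n) = (\<lambda>S. yp z S \<oplus> yp z' S)"
  by (auto simp: xp_def yp_def)

lemma parts_smult:
  assumes "a \<in> carrier R"
  shows "xp (\<lambda>n. a \<otimes> z n) = (\<lambda>S. a \<otimes> xp z S)" "yp (\<lambda>n. a \<otimes> z n) = (\<lambda>S. a \<otimes> yp z S)"
  using assms by (auto simp: xp_def yp_def)

lemma parts_minus: "xp (\<lambda>n. z n \<ominus> z' n) = (\<lambda>S. xp z S \<ominus> xp z' S)" "yp (\<lambda>n. z n \<ominus> z' n) = (\<lambda>S. yp z S \<ominus> yp z' S)"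
  by (auto simp: xp_def yp_def a_minus_def)

lemma parts_zero: "xp (\<lambda>n. \<zero>) = (\<lambda>S. \<zero>)" "yp (\<lambda>n. \<zero>) = (\<lambda>S. \<zero>)"
  by (auto simp: xp_def yp_def)

lemma cone_diff_linear: "linear_map R C C cone_diff"
proof (rule linear_mapI)
  fix f assume f: "f \<in> carrier C"
  note fx = xp_closed[OF f] and fy = yp_closed[OF f]
  note cl = linear_map_closed[OF \<kappa>_linear fx] linear_map_closed[OF \<kappa>_linear fy]
    linear_map_closed[OF \<omega>_linear fx]
  show "cone_diff f \<in> carrier C"
    unfolding cone_diff_def by (intro mk_closed L_minus cl)
  note fcl = cl[THEN fun_moduleD]
  fix n
  show "cone_diff (\<lambda>i. a \<otimes> f i) n = a \<otimes> cone_diff f n" if a: "a \<in> carrier R" for a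
  proof -
    have "a \<otimes> x \<ominus> a \<otimes> y = a \<otimes> (x \<ominus> y)" if "x \<in> carrier R" "y \<in> carrier R" for x y
      using that a by algebra
    then show ?thesis using a fcl
      by (simp add: cone_diff_def mk_def parts_smult linear_map_smult[OF \<kappa>_linear _ fx]
          linear_map_smult[OF \<kappa>_linear _ fy] linear_map_smult[OF \<omega>_linear _ fx])
  qed
  fix g assume g: "g \<in> carrier C"
  note gx = xp_closed[OF g] and gy = yp_closed[OF g]
  note gcl = linear_map_closed[OF \<kappa>_linear gx, THEN fun_moduleD] linear_map_closed[OF \<kappa>_linear gy, THEN fun_moduleD]
    linear_map_closed[OF \<omega>_linear gx, THEN fun_moduleD]
  have "(a \<oplus> a') \<ominus> (b \<oplus> b') = (a \<ominus> b) \<oplus> (a' \<ominus> b')"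
    if "a \<in> carrier R" "b \<in> carrier R" "a' \<in> carrier R" "b' \<in> carrier R" for a b a' b'
    using that by algebra
  then show "cone_diff (\<lambda>i. f i \<oplus> g i) n = cone_diff f n \<oplus> cone_diff g n"
    using fcl gcl
    by (simp add: cone_diff_def mk_def parts_add linear_map_add[OF \<kappa>_linear fx gx]
        linear_map_add[OF \<kappa>_linear fy gy] linear_map_add[OF \<omega>_linear fx gx])
qed

lemma cone_htpy_linear: "linear_map R C C cone_htpy"
proof (rule linear_mapI)
  fix f assume f: "f \<in> carrier C"
  note fy = yp_closed[OF f]
  note cl = linear_map_closed[OF \<sigma>_linear fy]
  show "cone_htpy f \<in> carrier C"
    unfolding cone_htpy_def by (intro mk_closed L_zero cl)
  fix n
  show "cone_htpy (\<lambda>i. a \<otimes> f i) n = a \<otimes> cone_htpy f n" if a: "a \<in> carrier R" for a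
    using a by (simp add: cone_htpy_def mk_def parts_smult linear_map_smult[OF \<sigma>_linear _ fy])
  fix g assume g: "g \<in> carrier C"
  show "cone_htpy (\<lambda>i. f i \<oplus> g i) n = cone_htpy f n \<oplus> cone_htpy g n"
    by (simp add: cone_htpy_def mk_def parts_add linear_map_add[OF \<sigma>_linear fy yp_closed[OF g]])
qed

lemma cut_linear: "linear_map R C C cut"
  by (rule linear_mapI) (auto simp: fun_module_carrier cut_def)

lemma linear_map_hom:
  assumes "linear_map R (fun_module R I) (fun_module R J) T"
  shows "abelian_group_hom (fun_module R I) (fun_module R J) T"
proof -
  interpret I: module R "fun_module R I" by (rule fun_module_module)
  interpret J: module R "fun_module R J" by (rule fun_module_module)
  have "group_hom (add_monoid (fun_module R I)) (add_monoid (fun_module R J)) T"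
    unfolding group_hom_def group_hom_axioms_def
    using assms I.M.a_group J.M.a_group by (simp only: linear_map_def)
  then show ?thesis
    by (intro abelian_group_homI I.M.abelian_group_axioms J.M.abelian_group_axioms)
qed

lemma pair_inv_zero: "pair_inv (\<lambda>S. \<zero>) = (\<lambda>S. \<zero>)"
  by (rule linear_map_zero[OF \<sigma>_linear])

text \<open>
  The equation \<open>h D h = h\<close> says that the partial inverse satisfies \<open>\<sigma> \<omega> \<sigma> = \<sigma>\<close>. A member of
  the subcomplex is recovered from its surviving coordinates because the chosen submatrix is
  invertible on both sides: its second component vanishes at the rows, and the coordinates of
  its first component at the columns can be solved for.
\<close>

lemma cone_partial_contraction: "partial_contraction C cone_diff cone_htpy cut"
proof -
  interpret C: module R C by (rule fun_module_module)
  note dcl = linear_map_closed[OF cone_diff_linear]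
  note hcl = linear_map_closed[OF cone_htpy_linear]
  note ccl = linear_map_closed[OF cut_linear]
  have zero: "(\<lambda>n. \<zero>) \<in> carrier C" by (simp add: fun_module_carrier)
  show ?thesis
  proof (unfold_locales, unfold fun_module_simps)
    fix z assume z: "z \<in> carrier C"
    note zx = xp_closed[OF z] and zy = yp_closed[OF z]
    note cl = fun_moduleD[OF zx] fun_moduleD[OF zy]
      fun_moduleD[OF linear_map_closed[OF \<kappa>_linear zx]] fun_moduleD[OF linear_map_closed[OF \<kappa>_linear zy]]
      fun_moduleD[OF linear_map_closed[OF \<omega>_linear zx]]
    have kk: "\<kappa> (\<kappa> (xp z)) = (\<lambda>S. \<zero>)" "\<kappa> (\<kappa> (yp z)) = (\<lambda>S. \<zero>)"
      using koszul_koszul[OF t_closed] cl by auto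
    have "pair_sum (\<kappa> (xp z)) S \<ominus> \<kappa> (\<lambda>S. pair_sum (xp z) S \<ominus> \<kappa> (yp z) S) S = \<zero>" for S
    proof -
      have "\<kappa> (\<lambda>S. pair_sum (xp z) S \<ominus> \<kappa> (yp z) S) S = \<kappa> (pair_sum (xp z)) S \<ominus> \<zero>"
        using linear_map_minus[OF \<kappa>_linear linear_map_closed[OF \<omega>_linear zx] linear_map_closed[OF \<kappa>_linear zy]]
        by (simp add: kk)
      also have "\<dots> = pair_sum (\<kappa> (xp z)) S"
        using koszul_pair_sum[OF t_closed cl(1)] pair_sum_linear[OF d_ge]
          fun_moduleD[OF linear_map_closed[OF \<omega>_linear linear_map_closed[OF \<kappa>_linear zx]]]
        by (simp add: a_minus_def)
      finally show ?thesis
        using fun_moduleD[OF linear_map_closed[OF \<omega>_linear linear_map_closed[OF \<kappa>_linear zx]]]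
        by (simp add: a_minus_def r_neg)
    qed
    then show "cone_diff (cone_diff z) = (\<lambda>n. \<zero>)"
      using z dcl zero by (intro cone_eqI) (simp_all add: cone_diff_parts parts_zero kk)
    show "cone_htpy (cone_htpy z) = (\<lambda>n. \<zero>)"
      using z hcl zero by (intro cone_eqI) (simp_all add: cone_htpy_parts parts_zero pair_inv_zero)
    have "pair_inv (\<lambda>S. pair_sum (pair_inv (yp z)) S \<ominus> \<zero>) = pair_inv (yp z)"
    proof
      fix S
      have "(\<lambda>S. pair_sum (pair_inv (yp z)) S \<ominus> \<zero>) = pair_sum (pair_inv (yp z))"
        using fun_moduleD[OF linear_map_closed[OF \<omega>_linear linear_map_closed[OF \<sigma>_linear zy]]]
        by (simp add: a_minus_def)
      then show "pair_inv (\<lambda>S. pair_sum (pair_inv (yp z)) S \<ominus> \<zero>) S = pair_inv (yp z) S"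
        using pair_inv_pair_sum[of "pair_inv (yp z)" S] cl(2) by (simp add: pair_inv_closed pair_inv_outside)
    qed
    then show "cone_htpy (cone_diff (cone_htpy z)) = cone_htpy z"
      using z dcl hcl
      by (intro cone_eqI) (simp_all add: cone_htpy_parts cone_diff_parts linear_map_zero[OF \<kappa>_linear])
    have yc: "yp (cut z) S = \<zero>" if "bits S \<in> targets" for S
      using that by (auto simp: yp_def cut_def small_ix_def set_encode_inv)
    then have "pair_inv (yp (cut z)) = (\<lambda>S. \<zero>)"
      using pair_inv_eq_zero by blast
    then show "cone_htpy (cut z) = (\<lambda>n. \<zero>)"
      using z hcl ccl zero by (intro cone_eqI) (simp_all add: cone_htpy_parts parts_zero)
    show "cut (cone_htpy z) = (\<lambda>n. \<zero>)"
      by (auto simp: cut_def small_ix_def cone_htpy_def mk_def pair_inv_outside)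
    assume h0: "cone_htpy z = (\<lambda>n. \<zero>)" and hD0: "cone_htpy (cone_diff z) = (\<lambda>n. \<zero>)"
    \<comment> \<open>The discarded coordinates of a member of the subcomplex form an element of the first summand on which
      the partial inverse is an honest inverse.\<close>
    define k where "k = (\<lambda>n. z n \<ominus> cut z n)"
    have kC: "k \<in> carrier C"
      using z ccl[OF z] by (simp add: k_def fun_module_carrier a_minus_def)
    have "pair_inv (yp z) = (\<lambda>S. \<zero>)"
      using cone_htpy_parts(1)[OF z] h0 by (simp add: parts_zero)
    have ky: "yp k = (\<lambda>S. \<zero>)"
    proof
      fix S
      show "yp k S = \<zero>"
      proof (cases "S \<subseteq> {..<d} \<and> bits S \<in> targets")
        case True
        have "yp z S = pair_sum (pair_inv (yp z)) S"
          using True cl(2) by (simp add: pair_sum_pair_inv)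
        also have "\<dots> = \<zero>"
          using \<open>pair_inv (yp z) = (\<lambda>S. \<zero>)\<close> linear_map_zero[OF \<omega>_linear] by simp
        finally have "yp z S = \<zero>" .
        moreover have "yp k S = yp z S \<ominus> yp (cut z) S" by (simp only: k_def parts_minus)
        ultimately show ?thesis using True yc[of S] by (simp add: a_minus_def)
      next
        case False
        then show ?thesis using z
          by (auto simp: k_def yp_def cut_def small_ix_def ix_def set_encode_inv a_minus_def r_neg fun_module_carrier)
      qed
    qed
    have kx: "xp k T = \<zero>" if "bits T \<notin> sources" for T
      using that z
      by (auto simp: k_def xp_def cut_def small_ix_def ix_def set_encode_inv a_minus_def r_neg fun_module_carrier)
    have "pair_inv (pair_sum (xp k)) S = xp k S" for S
      using fun_moduleD[OF xp_closed[OF kC]] kx by (rule pair_inv_pair_sum)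
    moreover have "(\<lambda>S. pair_sum (xp k) S \<ominus> \<zero>) = pair_sum (xp k)"
      using fun_moduleD[OF linear_map_closed[OF \<omega>_linear xp_closed[OF kC]]] by (simp add: a_minus_def)
    ultimately have hDk: "cone_htpy (cone_diff k) = k"
      using kC dcl hcl
      by (intro cone_eqI) (auto simp: cone_htpy_parts cone_diff_parts ky linear_map_zero[OF \<kappa>_linear])
    have ck: "cut z = (\<lambda>n. z n \<ominus> k n)"
    proof
      fix n
      have "z n \<in> carrier R" "cut z n \<in> carrier R" using fun_moduleD[OF z] fun_moduleD[OF ccl[OF z]] by auto
      then show "cut z n = z n \<ominus> k n" unfolding k_def by algebra
    qed
    have "cone_htpy (cone_diff (cut z)) = (\<lambda>n. \<zero> \<ominus> k n)"
      unfolding ck linear_map_minus[OF cone_diff_linear z kC]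
        linear_map_minus[OF cone_htpy_linear dcl[OF z] dcl[OF kC]] hD0 hDk ..
    then show "cut z \<ominus>\<^bsub>C\<^esub> cone_htpy (cone_diff (cut z)) = z"
    proof -
      assume eq: "cone_htpy (cone_diff (cut z)) = (\<lambda>n. \<zero> \<ominus> k n)"
      have "cut z \<ominus>\<^bsub>C\<^esub> cone_htpy (cone_diff (cut z)) = (\<lambda>n. cut z n \<ominus> (\<zero> \<ominus> k n))"
        using fun_module_minus[OF ccl[OF z] hcl[OF dcl[OF ccl[OF z]]]] by (simp add: eq)
      also have "\<dots> = z"
      proof
        fix n
        have "z n \<in> carrier R" "k n \<in> carrier R" using fun_moduleD[OF z] fun_moduleD[OF kC] by auto
        then show "cut z n \<ominus> (\<zero> \<ominus> k n) = z n" unfolding ck by algebra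
      qed
      finally show ?thesis .
    qed
  qed (use linear_map_hom[OF cone_diff_linear] linear_map_hom[OF cone_htpy_linear] linear_map_hom[OF cut_linear]
       in \<open>simp_all add: abelian_group_hom_def abelian_group_hom_axioms_def\<close>)
qed

text \<open>
  Conditions on coefficients that depend only on the size of the index set. Internal degrees
  and the filtration level are both of this kind, so that one lemma per operator suffices.
\<close>

definition sizewise :: "(nat \<Rightarrow> 'a set) \<Rightarrow> (nat \<Rightarrow> 'a set) \<Rightarrow> (nat \<Rightarrow> 'a) \<Rightarrow> bool" where
  "sizewise B B' z \<longleftrightarrow> (\<forall>S\<subseteq>{..<d}. xp z S \<in> B (card S) \<and> yp z S \<in> B' (card S))"

lemma cone_diff_sizewise:
  assumes z: "z \<in> carrier C" "sizewise B B' z"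
    and H: "\<And>n. additive_subgroup (H n) R" "\<And>n. additive_subgroup (H' n) R"
    and BH: "\<And>j n a. j < d \<Longrightarrow> a \<in> B (Suc n) \<Longrightarrow> t j \<otimes> a \<in> H n"
    and BH': "\<And>j n a. j < d \<Longrightarrow> a \<in> B' (Suc n) \<Longrightarrow> t j \<otimes> a \<in> H' n"
    and BH2: "\<And>n. B (Suc (Suc n)) \<subseteq> H' n"
  shows "sizewise H H' (cone_diff z)"
  unfolding sizewise_def cone_diff_parts[OF z(1)]
proof (intro allI impI conjI)
  fix S assume S: "S \<subseteq> {..<d}"
  then have fin: "finite S" by (rule finite_subset) simp
  note cl = fun_moduleD[OF xp_closed[OF z(1)]] fun_moduleD[OF yp_closed[OF z(1)]]
  have xB: "xp z T \<in> B (card T)" "yp z T \<in> B' (card T)" if "T \<subseteq> {..<d}" for T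
    using z(2) that by (auto simp: sizewise_def)
  have ins: "insert j S \<subseteq> {..<d}" "card (insert j S) = Suc (card S)" if "j < d" "j \<notin> S" for j
    using that S fin by auto
  have ins_mem: "t j \<otimes> xp z (insert j S) \<in> H (card S)" "t j \<otimes> yp z (insert j S) \<in> H' (card S)"
    if "j < d" "j \<notin> S" for j
    using BH[OF that(1)] BH'[OF that(1)] xB[OF ins(1)[OF that]] by (simp_all only: ins(2)[OF that])
  show "\<kappa> (xp z) S \<in> H (card S)"
    by (rule koszul_mem[OF H(1) _ cl(1)]) (simp_all add: t_closed ins_mem)
  have y: "\<kappa> (yp z) S \<in> H' (card S)"
    by (rule koszul_mem[OF H(2) _ cl(2)]) (simp_all add: t_closed ins_mem)
  have w: "pair_sum (xp z) S \<in> H' (card S)"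
  proof (rule pair_sum_mem[OF H(2) _ cl(1)])
    fix i :: nat assume i: "i < 4" "2 * i \<notin> S" "Suc (2 * i) \<notin> S"
    then have "set_pair i True S \<subseteq> {..<d}" "card (set_pair i True S) = Suc (Suc (card S))"
      using S d_ge fin by (auto simp: set_pair_True)
    then show "xp z (set_pair i True S) \<in> H' (card S)" using xB(1) BH2 by (metis subsetD)
  qed
  interpret H': additive_subgroup "H' (card S)" R by (rule H(2))
  show "pair_sum (xp z) S \<ominus> \<kappa> (yp z) S \<in> H' (card S)"
    using w y by (simp add: a_minus_def)
qed

lemma cone_htpy_sizewise:
  assumes z: "z \<in> carrier C" "sizewise B B' z"
    and H: "\<And>n. additive_subgroup (H n) R" "\<And>n. additive_subgroup (H' n) R"
    and uH: "\<And>n a. a \<in> H n \<Longrightarrow> u \<otimes> a \<in> H n"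
    and BH: "\<And>n. B' n \<subseteq> H (Suc (Suc n))"
  shows "sizewise H H' (cone_htpy z)"
  unfolding sizewise_def cone_htpy_parts[OF z(1)]
proof (intro allI impI conjI)
  fix S assume S: "S \<subseteq> {..<d}"
  then have fin: "finite S" by (rule finite_subset) simp
  show "pair_inv (yp z) S \<in> H (card S)"
  proof (rule pair_inv_mem[OF H(1) uH fin])
    fix T assume T: "finite T" "card T + 2 = card S" "T - {..<8} = S - {..<8}"
    then have "T \<subseteq> {..<d}" using S d_ge by fastforce
    then have "yp z T \<in> B' (card T)" using z(2) by (auto simp: sizewise_def)
    moreover have "Suc (Suc (card T)) = card S" using T by simp
    ultimately show "yp z T \<in> H (card S)" using BH by (metis subsetD)
  qed
  interpret H': additive_subgroup "H' (card S)" R by (rule H(2))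
  show "\<zero> \<in> H' (card S)" by simp
qed

end

section \<open>Bases, quotients and cohomology\<close>

lemma module_cong:
  assumes "module R M" "carrier N = carrier M" "add N = add M" "zero N = zero M"
    and "\<And>a x. a \<odot>\<^bsub>N\<^esub> x = a \<odot>\<^bsub>M\<^esub> x"
  shows "module R N"
proof -
  interpret M: module R M by fact
  show ?thesis
  proof (rule moduleI)
    show "abelian_group N"
    proof (rule abelian_groupI)
      fix x assume "x \<in> carrier N"
      then show "\<exists>y\<in>carrier N. y \<oplus>\<^bsub>N\<^esub> x = \<zero>\<^bsub>N\<^esub>"
        using assms M.l_neg[of x] by (intro bexI[of _ "\<ominus>\<^bsub>M\<^esub> x"]) simp_all
    qed (use assms in \<open>simp_all add: M.a_assoc\<close>, simp add: M.a_comm)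
  qed (use assms in \<open>simp_all add: M.is_cring M.smult_l_distr M.smult_r_distr M.smult_assoc1\<close>)
qed

lemma submoduleI_smult:
  assumes "module R M" "H \<subseteq> carrier M" "\<zero>\<^bsub>M\<^esub> \<in> H"
    and add: "\<And>x y. x \<in> H \<Longrightarrow> y \<in> H \<Longrightarrow> x \<oplus>\<^bsub>M\<^esub> y \<in> H"
    and smult: "\<And>a x. a \<in> carrier R \<Longrightarrow> x \<in> H \<Longrightarrow> a \<odot>\<^bsub>M\<^esub> x \<in> H"
  shows "submodule H R M"
proof -
  interpret M: module R M by fact
  show ?thesis
  proof (rule M.submoduleI)
    fix x assume x: "x \<in> H"
    have "\<ominus>\<^bsub>M\<^esub> x = (\<ominus>\<^bsub>R\<^esub> \<one>\<^bsub>R\<^esub>) \<odot>\<^bsub>M\<^esub> x"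
      using x assms(2) by (subst M.smult_l_minus) auto
    then show "\<ominus>\<^bsub>M\<^esub> x \<in> H" using smult[OF _ x] by simp
  qed (use assms in auto)
qed

lemma restrict_gmodule_simps [simp]:
  "carrier (restrict_gmodule M N) = N" "add (restrict_gmodule M N) = add M"
  "zero (restrict_gmodule M N) = zero M" "smult (restrict_gmodule M N) = smult M"
  "gr (restrict_gmodule M N) j = gr M j \<inter> N"
  by (simp_all add: restrict_gmodule_def)

lemma module_restrict:
  assumes "module R M" "submodule N R M" shows "module R (restrict_gmodule M N)"
  using submodule.submodule_is_module[OF assms(2,1)] by (rule module_cong) simp_all

lemma submodule_restrict:
  assumes "module R M" "submodule N R M" "submodule N' R M" "N \<subseteq> N'"
  shows "submodule N R (restrict_gmodule M N')"
proof (rule submoduleI_smult)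
  interpret M: module R M by fact
  show "module R (restrict_gmodule M N')" using assms(1,3) by (rule module_restrict)
  show "\<zero>\<^bsub>restrict_gmodule M N'\<^esub> \<in> N"
    using subgroup.one_closed[OF submodule.axioms(1)[OF assms(2)]] by simp
qed (use assms module.submoduleE[OF assms(1,2)] in auto)

text \<open>
  A basis is recognised by its dual functionals: if they are linear, dual to the given
  elements and jointly injective, then they compute the coefficients. The module is given as
  an image under \<open>q\<close>, which covers quotients, and \<open>act\<close> is the scalar action before passing to
  the image.
\<close>

lemma is_basis_by_coordinates:
  assumes R: "cring R" "\<one>\<^bsub>R\<^esub> \<noteq> \<zero>\<^bsub>R\<^esub>" and M: "abelian_monoid M"
    and Q: "carrier Q = q ` carrier M" "zero Q = q \<zero>\<^bsub>M\<^esub>"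
      "\<And>x y. x \<in> carrier M \<Longrightarrow> y \<in> carrier M \<Longrightarrow> q x \<oplus>\<^bsub>Q\<^esub> q y = q (x \<oplus>\<^bsub>M\<^esub> y)"
      "\<And>a x. a \<in> carrier R \<Longrightarrow> x \<in> carrier M \<Longrightarrow> a \<odot>\<^bsub>Q\<^esub> q x = q (act a x)"
    and act: "\<And>a x. a \<in> carrier R \<Longrightarrow> x \<in> carrier M \<Longrightarrow> act a x \<in> carrier M"
    and I: "finite I" "\<And>i. i \<in> I \<Longrightarrow> m i \<in> carrier M"
    and f: "\<And>i x. i \<in> I \<Longrightarrow> x \<in> carrier M \<Longrightarrow> f i x \<in> carrier R"
      "\<And>i x y. i \<in> I \<Longrightarrow> x \<in> carrier M \<Longrightarrow> y \<in> carrier M \<Longrightarrow> f i (x \<oplus>\<^bsub>M\<^esub> y) = f i x \<oplus>\<^bsub>R\<^esub> f i y"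
      "\<And>i a x. i \<in> I \<Longrightarrow> a \<in> carrier R \<Longrightarrow> x \<in> carrier M \<Longrightarrow> f i (act a x) = a \<otimes>\<^bsub>R\<^esub> f i x"
      "\<And>i k. i \<in> I \<Longrightarrow> k \<in> I \<Longrightarrow> f i (m k) = (if i = k then \<one>\<^bsub>R\<^esub> else \<zero>\<^bsub>R\<^esub>)"
    and separate: "\<And>x y. x \<in> carrier M \<Longrightarrow> y \<in> carrier M \<Longrightarrow> q x = q y \<longleftrightarrow> (\<forall>i\<in>I. f i x = f i y)"
  shows "is_basis R Q ((\<lambda>i. q (m i)) ` I)" and "inj_on (\<lambda>i. q (m i)) I"
proof -
  interpret R: cring R by fact
  interpret M: abelian_monoid M by fact
  interpret Q: abelian_monoid Q
  proof (rule abelian_monoidI)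
    fix x y assume xy: "x \<in> carrier Q" "y \<in> carrier Q"
    then show "x \<oplus>\<^bsub>Q\<^esub> y \<in> carrier Q" using Q by auto
    show "x \<oplus>\<^bsub>Q\<^esub> y = y \<oplus>\<^bsub>Q\<^esub> x" using xy Q by (auto simp: M.a_comm)
    fix z assume "z \<in> carrier Q"
    then show "x \<oplus>\<^bsub>Q\<^esub> y \<oplus>\<^bsub>Q\<^esub> z = x \<oplus>\<^bsub>Q\<^esub> (y \<oplus>\<^bsub>Q\<^esub> z)" using xy Q by (auto simp: M.a_assoc)
  next
    show "\<zero>\<^bsub>Q\<^esub> \<in> carrier Q" using Q by simp
    show "\<zero>\<^bsub>Q\<^esub> \<oplus>\<^bsub>Q\<^esub> x = x" if "x \<in> carrier Q" for x using that Q by auto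
  qed
  define b where "b i = q (m i)" for i
  define g where "g i s = f i (SOME x. x \<in> carrier M \<and> q x = s)" for i s
  have gq: "g i (q x) = f i x" if "i \<in> I" "x \<in> carrier M" for i x
  proof -
    have "(SOME y. y \<in> carrier M \<and> q y = q x) \<in> carrier M \<and> q (SOME y. y \<in> carrier M \<and> q y = q x) = q x"
      using that(2) by (intro someI[of "\<lambda>y. y \<in> carrier M \<and> q y = q x" x]) simp
    then show ?thesis using separate that unfolding g_def by blast
  qed
  have g_cl: "g i s \<in> carrier R" if "i \<in> I" "s \<in> carrier Q" for i s
    using that Q f gq by auto
  have g_add: "g i (s \<oplus>\<^bsub>Q\<^esub> s') = g i s \<oplus>\<^bsub>R\<^esub> g i s'" if "i \<in> I" "s \<in> carrier Q" "s' \<in> carrier Q" for i s s'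
    using that Q f gq by auto
  have g_smult: "g i (a \<odot>\<^bsub>Q\<^esub> s) = a \<otimes>\<^bsub>R\<^esub> g i s" "a \<odot>\<^bsub>Q\<^esub> s \<in> carrier Q"
    if "i \<in> I" "a \<in> carrier R" "s \<in> carrier Q" for i a s
    using that Q(1,4) f gq act by auto
  have smult_cl: "a \<odot>\<^bsub>Q\<^esub> s \<in> carrier Q" if "a \<in> carrier R" "s \<in> carrier Q" for a s
    using that Q(1,4) act by auto
  have g_zero: "g i \<zero>\<^bsub>Q\<^esub> = \<zero>\<^bsub>R\<^esub>" if "i \<in> I" for i
  proof -
    have "g i \<zero>\<^bsub>Q\<^esub> \<oplus>\<^bsub>R\<^esub> g i \<zero>\<^bsub>Q\<^esub> = g i \<zero>\<^bsub>Q\<^esub>" using g_add[OF that, of "\<zero>\<^bsub>Q\<^esub>" "\<zero>\<^bsub>Q\<^esub>"] by simp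
    then show ?thesis using g_cl[OF that] by (simp add: R.add.l_cancel_one')
  qed
  have g_sum: "g i (\<Oplus>\<^bsub>Q\<^esub>s\<in>F. h s) = (\<Oplus>\<^bsub>R\<^esub>s\<in>F. g i (h s))"
    if "i \<in> I" "finite F" "\<And>s. s \<in> F \<Longrightarrow> h s \<in> carrier Q" for i F h
    using that(2,3)
  proof (induction F rule: finite_induct)
    case (insert s F)
    then have "h \<in> F \<rightarrow> carrier Q" "h s \<in> carrier Q" "(\<lambda>s. g i (h s)) \<in> F \<rightarrow> carrier R" "g i (h s) \<in> carrier R"
      using g_cl that(1) by auto
    then show ?case using insert that(1) by (simp add: g_add)
  qed (simp add: g_zero that(1))
  have gb: "g i (b k) = (if i = k then \<one>\<^bsub>R\<^esub> else \<zero>\<^bsub>R\<^esub>)" if "i \<in> I" "k \<in> I" for i k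
    using that gq f(4) I(2) by (simp add: b_def)
  have bQ: "b i \<in> carrier Q" if "i \<in> I" for i using that I(2) Q(1) by (simp add: b_def)
  show inj: "inj_on (\<lambda>i. q (m i)) I"
  proof (rule inj_onI)
    fix i k assume ik: "i \<in> I" "k \<in> I" "q (m i) = q (m k)"
    then have "g i (b i) = g i (b k)" by (simp add: b_def)
    then show "i = k" using gb[OF ik(1) ik(1)] gb[OF ik(1) ik(2)] R(2) by (simp split: if_splits)
  qed
  have coeff: "g i (\<Oplus>\<^bsub>Q\<^esub>s\<in>{s. c s \<noteq> \<zero>\<^bsub>R\<^esub>}. c s \<odot>\<^bsub>Q\<^esub> s) = c (b i)"
    and sum_cl: "(\<Oplus>\<^bsub>Q\<^esub>s\<in>{s. c s \<noteq> \<zero>\<^bsub>R\<^esub>}. c s \<odot>\<^bsub>Q\<^esub> s) \<in> carrier Q"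
    if i: "i \<in> I" and c: "\<forall>s. c s \<in> carrier R" "finite {s. c s \<noteq> \<zero>\<^bsub>R\<^esub>}" "{s. c s \<noteq> \<zero>\<^bsub>R\<^esub>} \<subseteq> b ` I" for i c
  proof -
    let ?F = "{s. c s \<noteq> \<zero>\<^bsub>R\<^esub>}"
    have FQ: "s \<in> carrier Q" if "s \<in> ?F" for s using that c(3) bQ by auto
    show "(\<Oplus>\<^bsub>Q\<^esub>s\<in>?F. c s \<odot>\<^bsub>Q\<^esub> s) \<in> carrier Q" using FQ c(1) smult_cl by (intro Q.finsum_closed) auto
    have "g i (\<Oplus>\<^bsub>Q\<^esub>s\<in>?F. c s \<odot>\<^bsub>Q\<^esub> s) = (\<Oplus>\<^bsub>R\<^esub>s\<in>?F. g i (c s \<odot>\<^bsub>Q\<^esub> s))"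
      using i c FQ smult_cl by (intro g_sum) auto
    also have "\<dots> = (\<Oplus>\<^bsub>R\<^esub>s\<in>?F. if s = b i then c (b i) else \<zero>\<^bsub>R\<^esub>)"
    proof (intro R.finsum_cong' refl)
      fix s assume s: "s \<in> ?F"
      then obtain k where k: "k \<in> I" "s = b k" using c(3) by auto
      then have "g i (c s \<odot>\<^bsub>Q\<^esub> s) = c s \<otimes>\<^bsub>R\<^esub> (if i = k then \<one>\<^bsub>R\<^esub> else \<zero>\<^bsub>R\<^esub>)"
        using g_smult(1)[OF i] c(1) FQ[OF s] gb[OF i] by simp
      moreover have "b k = b i \<longleftrightarrow> i = k" using inj i k(1) by (auto simp: b_def dest: inj_onD)
      ultimately show "g i (c s \<odot>\<^bsub>Q\<^esub> s) = (if s = b i then c (b i) else \<zero>\<^bsub>R\<^esub>)" using c(1) k(2) by simp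
    qed (use c(1) in auto)
    also have "\<dots> = c (b i)"
    proof (cases "b i \<in> ?F")
      case True
      then show ?thesis using R.finsum_delta[OF c(2) True] c(1) by simp
    next
      case False
      then have "(\<Oplus>\<^bsub>R\<^esub>s\<in>?F. if s = b i then c (b i) else \<zero>\<^bsub>R\<^esub>) = (\<Oplus>\<^bsub>R\<^esub>s\<in>?F. \<zero>\<^bsub>R\<^esub>)"
        by (intro R.finsum_cong') auto
      then show ?thesis using False by simp
    qed
    finally show "g i (\<Oplus>\<^bsub>Q\<^esub>s\<in>?F. c s \<odot>\<^bsub>Q\<^esub> s) = c (b i)" .
  qed
  have g_eq: "s = s'" if "s \<in> carrier Q" "s' \<in> carrier Q" "\<And>i. i \<in> I \<Longrightarrow> g i s = g i s'" for s s'
  proof -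
    have "s \<in> q ` carrier M" "s' \<in> q ` carrier M" using that(1,2) Q(1) by simp_all
    then obtain x y where "x \<in> carrier M" "y \<in> carrier M" "s = q x" "s' = q y" by blast
    then show ?thesis using separate that(3) gq by auto
  qed
  have "\<exists>!c. (\<forall>s. c s \<in> carrier R) \<and> finite {s. c s \<noteq> \<zero>\<^bsub>R\<^esub>} \<and> {s. c s \<noteq> \<zero>\<^bsub>R\<^esub>} \<subseteq> b ` I \<and>
       x = (\<Oplus>\<^bsub>Q\<^esub>s\<in>{s. c s \<noteq> \<zero>\<^bsub>R\<^esub>}. c s \<odot>\<^bsub>Q\<^esub> s)" if x: "x \<in> carrier Q" for x
  proof (rule ex1I)
    define c where "c s = (if s \<in> b ` I then g (the_inv_into I b s) x else \<zero>\<^bsub>R\<^esub>)" for s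
    have cb: "c (b i) = g i x" if "i \<in> I" for i
      using that the_inv_into_f_f[OF inj that] by (simp add: c_def b_def[abs_def])
    have c: "\<forall>s. c s \<in> carrier R" "{s. c s \<noteq> \<zero>\<^bsub>R\<^esub>} \<subseteq> b ` I"
      using g_cl x cb by (auto simp: c_def split: if_splits)
    then have fin: "finite {s. c s \<noteq> \<zero>\<^bsub>R\<^esub>}" using I(1) by (auto intro: finite_subset)
    have "(\<Oplus>\<^bsub>Q\<^esub>s\<in>{s. c s \<noteq> \<zero>\<^bsub>R\<^esub>}. c s \<odot>\<^bsub>Q\<^esub> s) \<in> carrier Q"
      using c bQ smult_cl by (intro Q.finsum_closed) auto
    then have "x = (\<Oplus>\<^bsub>Q\<^esub>s\<in>{s. c s \<noteq> \<zero>\<^bsub>R\<^esub>}. c s \<odot>\<^bsub>Q\<^esub> s)"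
      using x coeff[OF _ c(1) fin c(2)] cb by (intro g_eq) auto
    then show "(\<forall>s. c s \<in> carrier R) \<and> finite {s. c s \<noteq> \<zero>\<^bsub>R\<^esub>} \<and> {s. c s \<noteq> \<zero>\<^bsub>R\<^esub>} \<subseteq> b ` I \<and>
       x = (\<Oplus>\<^bsub>Q\<^esub>s\<in>{s. c s \<noteq> \<zero>\<^bsub>R\<^esub>}. c s \<odot>\<^bsub>Q\<^esub> s)" using c fin by blast
    fix c' assume c': "(\<forall>s. c' s \<in> carrier R) \<and> finite {s. c' s \<noteq> \<zero>\<^bsub>R\<^esub>} \<and> {s. c' s \<noteq> \<zero>\<^bsub>R\<^esub>} \<subseteq> b ` I \<and>
       x = (\<Oplus>\<^bsub>Q\<^esub>s\<in>{s. c' s \<noteq> \<zero>\<^bsub>R\<^esub>}. c' s \<odot>\<^bsub>Q\<^esub> s)"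
    show "c' = c"
    proof
      fix s
      show "c' s = c s"
      proof (cases "s \<in> b ` I")
        case True
        then obtain i where i: "i \<in> I" "s = b i" by auto
        then show ?thesis using coeff[OF i(1), of c'] c' cb by simp
      next
        case False
        then show ?thesis using c' by (auto simp: c_def)
      qed
    qed
  qed
  then show "is_basis R Q ((\<lambda>i. q (m i)) ` I)"
    using bQ by (auto simp: is_basis_def b_def)
qed

lemma quotient_gmodule_simps [simp]:
  "carrier (quotient_gmodule M N) = a_rcosets\<^bsub>M\<^esub> N" "zero (quotient_gmodule M N) = N"
  "add (quotient_gmodule M N) = set_add M"
  "smult (quotient_gmodule M N) = (\<lambda>a S. \<Union>x\<in>S. N +>\<^bsub>M\<^esub> (a \<odot>\<^bsub>M\<^esub> x))"
  "gr (quotient_gmodule M N) j = (\<lambda>x. N +>\<^bsub>M\<^esub> x) ` gr M j"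
  by (simp_all add: quotient_gmodule_def)

locale module_quotient = module R M for R and M (structure) + fixes N
  assumes N: "submodule N R M"
begin

lemma N_subgroup: "abelian_subgroup N M"
  using submodule.axioms(1)[OF N] by (intro abelian_subgroupI3 additive_subgroup.intro M.abelian_group_axioms)

sublocale N: abelian_subgroup N M by (rule N_subgroup)

lemma coset_eq_iff:
  assumes "x \<in> carrier M" "y \<in> carrier M"
  shows "N +> x = N +> y \<longleftrightarrow> x \<ominus> y \<in> N"
proof -
  have "N +> x = N +> y \<longleftrightarrow> x \<in> N +> y"
    using N.a_repr_independence' N.a_repr_independenceD assms by metis
  also have "\<dots> \<longleftrightarrow> x \<ominus> y \<in> N" using N.a_rcos_module[OF assms(2,1)] by (simp add: a_minus_def)
  finally show ?thesis .
qed

lemma coset_zero: "N +> \<zero> = N"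
  using N.a_subset by (simp add: a_coset_add_zero)

lemma coset_smult:
  assumes a: "a \<in> carrier R" and x: "x \<in> carrier M"
  shows "(\<Union>y\<in>N +> x. N +> (a \<odot> y)) = N +> (a \<odot> x)"
proof -
  have "N +> (a \<odot> y) = N +> (a \<odot> x)" if y: "y \<in> N +> x" for y
  proof -
    obtain n where n: "n \<in> N" "y = n \<oplus> x" using y by (auto simp: a_r_coset_def')
    then have "n \<in> carrier M" using N.a_subset by auto
    then have "a \<odot> y \<ominus> a \<odot> x = a \<odot> n"
      using n a x by (simp add: smult_r_distr a_minus_def M.a_assoc M.r_neg)
    moreover have "a \<odot> n \<in> N" using submodule.smult_closed[OF N a n(1)] .
    ultimately show ?thesis using \<open>n \<in> carrier M\<close> n a x by (subst coset_eq_iff) auto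
  qed
  moreover have "x \<in> N +> x" using x by (rule N.a_rcos_self)
  ultimately show ?thesis by blast
qed

end

text \<open>
  The map \<open>\<phi>\<close> restricts the scalars, so that the criterion applies both to quotients of
  modules over the polynomial ring and to cohomology as a vector space over the field.
\<close>

lemma is_basis_quotient:
  assumes M: "module R M" "submodule N R M" and K: "cring K" "\<one>\<^bsub>K\<^esub> \<noteq> \<zero>\<^bsub>K\<^esub>"
    and Q: "carrier Q = carrier (quotient_gmodule M N)" "zero Q = zero (quotient_gmodule M N)"
      "add Q = add (quotient_gmodule M N)"
      "\<And>a s. a \<odot>\<^bsub>Q\<^esub> s = \<phi> a \<odot>\<^bsub>quotient_gmodule M N\<^esub> s"
    and \<phi>: "\<And>a. a \<in> carrier K \<Longrightarrow> \<phi> a \<in> carrier R"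
    and I: "finite I" "\<And>i. i \<in> I \<Longrightarrow> m i \<in> carrier M"
    and f: "\<And>i x. i \<in> I \<Longrightarrow> x \<in> carrier M \<Longrightarrow> f i x \<in> carrier K"
      "\<And>i x y. i \<in> I \<Longrightarrow> x \<in> carrier M \<Longrightarrow> y \<in> carrier M \<Longrightarrow> f i (x \<oplus>\<^bsub>M\<^esub> y) = f i x \<oplus>\<^bsub>K\<^esub> f i y"
      "\<And>i a x. i \<in> I \<Longrightarrow> a \<in> carrier K \<Longrightarrow> x \<in> carrier M \<Longrightarrow> f i (\<phi> a \<odot>\<^bsub>M\<^esub> x) = a \<otimes>\<^bsub>K\<^esub> f i x"
      "\<And>i k. i \<in> I \<Longrightarrow> k \<in> I \<Longrightarrow> f i (m k) = (if i = k then \<one>\<^bsub>K\<^esub> else \<zero>\<^bsub>K\<^esub>)"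
    and inN: "\<And>x. x \<in> carrier M \<Longrightarrow> x \<in> N \<longleftrightarrow> (\<forall>i\<in>I. f i x = \<zero>\<^bsub>K\<^esub>)"
  shows "is_basis K Q ((\<lambda>i. N +>\<^bsub>M\<^esub> m i) ` I)" and "inj_on (\<lambda>i. N +>\<^bsub>M\<^esub> m i) I"
    and "\<And>x y. x \<in> carrier M \<Longrightarrow> y \<in> carrier M \<Longrightarrow>
      N +>\<^bsub>M\<^esub> x = N +>\<^bsub>M\<^esub> y \<longleftrightarrow> (\<forall>i\<in>I. f i x = f i y)"
proof -
  interpret K: cring K by fact
  interpret module_quotient R M N using M by (simp add: module_quotient_def module_quotient_axioms_def)
  have diff: "f i x = f i (x \<ominus>\<^bsub>M\<^esub> y) \<oplus>\<^bsub>K\<^esub> f i y" if "i \<in> I" "x \<in> carrier M" "y \<in> carrier M" for i x y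
  proof -
    have "x = (x \<ominus>\<^bsub>M\<^esub> y) \<oplus>\<^bsub>M\<^esub> y" using that by (simp add: a_minus_def M.a_assoc M.l_neg)
    then show ?thesis using f(2)[OF that(1), of "x \<ominus>\<^bsub>M\<^esub> y" y] that by simp
  qed
  show sep: "N +>\<^bsub>M\<^esub> x = N +>\<^bsub>M\<^esub> y \<longleftrightarrow> (\<forall>i\<in>I. f i x = f i y)"
    if xy: "x \<in> carrier M" "y \<in> carrier M" for x y
  proof -
    have "f i (x \<ominus>\<^bsub>M\<^esub> y) = \<zero>\<^bsub>K\<^esub> \<longleftrightarrow> f i x = f i y" if i: "i \<in> I" for i
      using diff[OF i xy] f(1)[OF i] xy by (metis K.add.l_cancel_one K.add.l_cancel_one' K.l_zero M.minus_closed K.add.r_cancel_one)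
    then show ?thesis using coset_eq_iff[OF xy] inN[of "x \<ominus>\<^bsub>M\<^esub> y"] xy by simp
  qed
  have Q1: "carrier Q = (\<lambda>x. N +>\<^bsub>M\<^esub> x) ` carrier M"
    using Q(1) by (auto simp: A_RCOSETS_def')
  have Q2: "zero Q = N +>\<^bsub>M\<^esub> \<zero>\<^bsub>M\<^esub>" using Q(2) by (simp add: coset_zero)
  have Q3: "(N +>\<^bsub>M\<^esub> x) \<oplus>\<^bsub>Q\<^esub> (N +>\<^bsub>M\<^esub> y) = N +>\<^bsub>M\<^esub> (x \<oplus>\<^bsub>M\<^esub> y)"
    if "x \<in> carrier M" "y \<in> carrier M" for x y
    using that Q(3) by (simp add: N.a_rcos_sum)
  have Q4: "a \<odot>\<^bsub>Q\<^esub> (N +>\<^bsub>M\<^esub> x) = N +>\<^bsub>M\<^esub> (\<phi> a \<odot>\<^bsub>M\<^esub> x)" if "a \<in> carrier K" "x \<in> carrier M" for a x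
    using that \<phi> by (simp add: Q(4) coset_smult)
  have act: "\<phi> a \<odot>\<^bsub>M\<^esub> x \<in> carrier M" if "a \<in> carrier K" "x \<in> carrier M" for a x
    using that \<phi> by simp
  note image = is_basis_by_coordinates[of K M Q "\<lambda>x. N +>\<^bsub>M\<^esub> x" "\<lambda>a x. \<phi> a \<odot>\<^bsub>M\<^esub> x" I m f,
      OF K M.abelian_monoid_axioms Q1 Q2 Q3 Q4 act I f sep]
  show "is_basis K Q ((\<lambda>i. N +>\<^bsub>M\<^esub> m i) ` I)" "inj_on (\<lambda>i. N +>\<^bsub>M\<^esub> m i) I"
    by (rule image; assumption)+
qed

lemma cocycles_coboundaries_submodule:
  assumes M: "dg_module R A M"
  shows "submodule (cocycles M) R M" "submodule (coboundaries M) R M" "coboundaries M \<subseteq> cocycles M"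
proof -
  interpret M: module R M using M by (simp add: dg_module_def graded_module_def)
  have cl: "x \<in> carrier M \<Longrightarrow> diff M x \<in> carrier M"
    and add: "x \<in> carrier M \<Longrightarrow> y \<in> carrier M \<Longrightarrow> diff M (x \<oplus>\<^bsub>M\<^esub> y) = diff M x \<oplus>\<^bsub>M\<^esub> diff M y"
    and smult: "a \<in> carrier R \<Longrightarrow> x \<in> carrier M \<Longrightarrow> diff M (a \<odot>\<^bsub>M\<^esub> x) = a \<odot>\<^bsub>M\<^esub> diff M x"
    and sq: "x \<in> carrier M \<Longrightarrow> diff M (diff M x) = \<zero>\<^bsub>M\<^esub>" for a x y
    using M by (auto simp: dg_module_def linear_map_def hom_def)
  have zero: "diff M \<zero>\<^bsub>M\<^esub> = \<zero>\<^bsub>M\<^esub>"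
    using smult[of "\<zero>\<^bsub>R\<^esub>" "\<zero>\<^bsub>M\<^esub>"] cl[of "\<zero>\<^bsub>M\<^esub>"] by simp
  show "submodule (cocycles M) R M"
    by (rule submoduleI_smult) (auto simp: cocycles_def M.module_axioms zero add smult)
  show "submodule (coboundaries M) R M"
  proof (rule submoduleI_smult)
    show "\<zero>\<^bsub>M\<^esub> \<in> coboundaries M" unfolding coboundaries_def by (rule image_eqI[of _ _ "\<zero>\<^bsub>M\<^esub>"]) (simp_all add: zero)
    show "x \<oplus>\<^bsub>M\<^esub> y \<in> coboundaries M" if "x \<in> coboundaries M" "y \<in> coboundaries M" for x y
      using that unfolding coboundaries_def by (auto simp: add[symmetric])
    show "a \<odot>\<^bsub>M\<^esub> x \<in> coboundaries M" if "a \<in> carrier R" "x \<in> coboundaries M" for a x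
      using that unfolding coboundaries_def by (auto simp: smult[symmetric])
  qed (auto simp: coboundaries_def M.module_axioms cl)
  show "coboundaries M \<subseteq> cocycles M" by (auto simp: coboundaries_def cocycles_def cl sq)
qed

text \<open>
  The cohomology is known once there are linear functionals on cocycles, the one with index
  \<open>k\<close> living in degree \<open>k\<close> only, that are dual to a family of cocycles and whose common kernel
  consists of the coboundaries.
\<close>

theorem cohomology_by_functionals:
  assumes M: "dg_module R A M" and K: "cring K" "\<one>\<^bsub>K\<^esub> \<noteq> \<zero>\<^bsub>K\<^esub>"
    and \<phi>: "\<And>a. a \<in> carrier K \<Longrightarrow> \<phi> a \<in> carrier R \<inter> A 0"
    and J: "finite J" "\<And>k. k \<in> J \<Longrightarrow> z k \<in> gr M k \<inter> cocycles M"
    and f: "\<And>k x. k \<in> J \<Longrightarrow> x \<in> cocycles M \<Longrightarrow> f k x \<in> carrier K"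
      "\<And>k x y. k \<in> J \<Longrightarrow> x \<in> cocycles M \<Longrightarrow> y \<in> cocycles M \<Longrightarrow> f k (x \<oplus>\<^bsub>M\<^esub> y) = f k x \<oplus>\<^bsub>K\<^esub> f k y"
      "\<And>k a x. k \<in> J \<Longrightarrow> a \<in> carrier K \<Longrightarrow> x \<in> cocycles M \<Longrightarrow> f k (\<phi> a \<odot>\<^bsub>M\<^esub> x) = a \<otimes>\<^bsub>K\<^esub> f k x"
      "\<And>k l. k \<in> J \<Longrightarrow> l \<in> J \<Longrightarrow> f k (z l) = (if k = l then \<one>\<^bsub>K\<^esub> else \<zero>\<^bsub>K\<^esub>)"
      "\<And>k j x. k \<in> J \<Longrightarrow> x \<in> gr M j \<inter> cocycles M \<Longrightarrow> j \<noteq> k \<Longrightarrow> f k x = \<zero>\<^bsub>K\<^esub>"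
    and bd: "\<And>x. x \<in> cocycles M \<Longrightarrow> x \<in> coboundaries M \<longleftrightarrow> (\<forall>k\<in>J. f k x = \<zero>\<^bsub>K\<^esub>)"
  defines "H \<equiv> restrict_scalars \<phi> (cohomology M)"
  shows "j \<in> J \<Longrightarrow> module_iso K (H\<lparr>carrier := gr (cohomology M) j\<rparr>) (regular_module K)"
    and "j \<notin> J \<Longrightarrow> gr (cohomology M) j = {\<zero>\<^bsub>H\<^esub>}"
    and "\<exists>B. is_basis K H B \<and> finite B \<and> card B = card J"
proof -
  interpret K: cring K by fact
  interpret M: module R M using M by (simp add: dg_module_def graded_module_def)
  define Z where "Z = restrict_gmodule M (cocycles M)"
  define N where "N = coboundaries M"
  note sub = cocycles_coboundaries_submodule[OF M]
  have Z: "module R Z" unfolding Z_def by (rule module_restrict[OF M.module_axioms sub(1)])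
  have N: "submodule N R Z" unfolding Z_def N_def
    by (rule submodule_restrict[OF M.module_axioms sub(2,1,3)])
  have H_simps: "carrier H = carrier (quotient_gmodule Z N)" "zero H = zero (quotient_gmodule Z N)"
      "add H = add (quotient_gmodule Z N)"
      "smult H = (\<lambda>a s. \<phi> a \<odot>\<^bsub>quotient_gmodule Z N\<^esub> s)"
    by (simp_all add: H_def restrict_scalars_def cohomology_def Z_def N_def)
  interpret Q: module_quotient R Z N using Z N by (simp add: module_quotient_def module_quotient_axioms_def)
  have cZ: "carrier Z = cocycles M" by (simp add: Z_def)
  note basis = is_basis_quotient[of R Z N K H \<phi> J z f, OF Z N K H_simps(1-3)]
  have sep: "N +>\<^bsub>Z\<^esub> x = N +>\<^bsub>Z\<^esub> y \<longleftrightarrow> (\<forall>k\<in>J. f k x = f k y)" if "x \<in> cocycles M" "y \<in> cocycles M" for x y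
    by (rule basis(3)) (use that \<phi> J f bd in \<open>simp_all add: H_simps(4) Z_def N_def\<close>)
  have "is_basis K H ((\<lambda>k. N +>\<^bsub>Z\<^esub> z k) ` J)" "inj_on (\<lambda>k. N +>\<^bsub>Z\<^esub> z k) J"
    by (rule basis(1,2); use \<phi> J f bd in \<open>simp add: H_simps(4) Z_def N_def\<close>)+
  then show "\<exists>B. is_basis K H B \<and> finite B \<and> card B = card J"
    using J(1) card_image by blast
  have gr: "gr (cohomology M) j = (\<lambda>x. N +>\<^bsub>Z\<^esub> x) ` (gr M j \<inter> cocycles M)" for j
    by (simp add: cohomology_def Z_def N_def)
  have grM: "subgroup (gr M j) (add_monoid M)" for j using M by (simp add: dg_module_def graded_module_def)
  have gr_smult: "\<phi> a \<odot>\<^bsub>M\<^esub> x \<in> gr M j" if "a \<in> carrier K" "x \<in> gr M j" for a x j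
  proof -
    have "\<phi> a \<odot>\<^bsub>M\<^esub> x \<in> gr M (0 + j)"
      using M \<phi>[OF that(1)] that(2) unfolding dg_module_def graded_module_def by blast
    then show ?thesis by simp
  qed
  have cyc_smult: "\<phi> a \<odot>\<^bsub>M\<^esub> x \<in> cocycles M" if "a \<in> carrier K" "x \<in> cocycles M" for a x
    using submodule.smult_closed[OF sub(1)] \<phi> that by blast
  show "gr (cohomology M) j = {\<zero>\<^bsub>H\<^esub>}" if j: "j \<notin> J"
  proof -
    have zero: "\<zero>\<^bsub>M\<^esub> \<in> gr M j \<inter> cocycles M"
      using subgroup.one_closed[OF grM] subgroup.one_closed[OF submodule.axioms(1)[OF sub(1)]] by simp
    have "N +>\<^bsub>Z\<^esub> x = N +>\<^bsub>Z\<^esub> \<zero>\<^bsub>Z\<^esub>" if x: "x \<in> gr M j \<inter> cocycles M" for x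
    proof (subst sep)
      have "f k x = f k \<zero>\<^bsub>Z\<^esub>" if "k \<in> J" for k
        using f(5)[OF that x] f(5)[OF that zero] that j by (cases "j = k") (simp_all add: Z_def)
      then show "\<forall>k\<in>J. f k x = f k \<zero>\<^bsub>Z\<^esub>" by blast
    qed (use x zero in \<open>auto simp: Z_def\<close>)
    then have "gr (cohomology M) j = {N +>\<^bsub>Z\<^esub> \<zero>\<^bsub>Z\<^esub>}" unfolding gr using zero by auto
    then show ?thesis by (simp add: Q.coset_zero H_simps)
  qed
  show "module_iso K (H\<lparr>carrier := gr (cohomology M) j\<rparr>) (regular_module K)" if j: "j \<in> J"
  proof -
    define g where "g s = f j (SOME x. x \<in> cocycles M \<and> N +>\<^bsub>Z\<^esub> x = s)" for s
    have g: "g (N +>\<^bsub>Z\<^esub> x) = f j x" if "x \<in> cocycles M" for x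
    proof -
      let ?P = "\<lambda>y. y \<in> cocycles M \<and> N +>\<^bsub>Z\<^esub> y = N +>\<^bsub>Z\<^esub> x"
      have "?P (SOME y. ?P y)" using that by (intro someI[of ?P x]) simp
      then show ?thesis using sep that j unfolding g_def by blast
    qed
    have add: "(N +>\<^bsub>Z\<^esub> x) \<oplus>\<^bsub>H\<^esub> (N +>\<^bsub>Z\<^esub> y) = N +>\<^bsub>Z\<^esub> (x \<oplus>\<^bsub>M\<^esub> y)" "x \<oplus>\<^bsub>M\<^esub> y \<in> cocycles M"
      if "x \<in> cocycles M" "y \<in> cocycles M" for x y
      using that Q.N.a_rcos_sum[of x y] Q.M.a_closed[of x y] by (simp_all add: H_simps Z_def)
    have smult: "a \<odot>\<^bsub>H\<^esub> (N +>\<^bsub>Z\<^esub> x) = N +>\<^bsub>Z\<^esub> (\<phi> a \<odot>\<^bsub>M\<^esub> x)"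
      if "a \<in> carrier K" "x \<in> cocycles M" for a x
      using that Q.coset_smult[of "\<phi> a" x] \<phi> by (simp add: H_simps Z_def)
    have "linear_map K (H\<lparr>carrier := gr (cohomology M) j\<rparr>) (regular_module K) g"
      using f(1-3)[OF j] by (auto simp: linear_map_def hom_def regular_module_def gr g add smult cyc_smult)
    moreover have "bij_betw g (gr (cohomology M) j) (carrier K)"
      unfolding bij_betw_def
    proof
      show "inj_on g (gr (cohomology M) j)"
      proof (rule inj_onI)
        fix s s' assume "s \<in> gr (cohomology M) j" "s' \<in> gr (cohomology M) j" and eq: "g s = g s'"
        then obtain x y where x: "x \<in> gr M j \<inter> cocycles M" "s = N +>\<^bsub>Z\<^esub> x"
          and y: "y \<in> gr M j \<inter> cocycles M" "s' = N +>\<^bsub>Z\<^esub> y" unfolding gr by auto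
        have "f k x = f k y" if k: "k \<in> J" for k
        proof (cases "k = j")
          case True
          then show ?thesis using eq g x y by simp
        next
          case False
          then show ?thesis using f(5)[OF k x(1)] f(5)[OF k y(1)] by auto
        qed
        then show "s = s'" using sep x y by auto
      qed
      show "g ` gr (cohomology M) j = carrier K"
      proof
        show "g ` gr (cohomology M) j \<subseteq> carrier K" using f(1)[OF j] by (auto simp: gr g)
        show "carrier K \<subseteq> g ` gr (cohomology M) j"
        proof
          fix a assume a: "a \<in> carrier K"
          have "g (N +>\<^bsub>Z\<^esub> (\<phi> a \<odot>\<^bsub>M\<^esub> z j)) = a"
            using a J(2)[OF j] f(3)[OF j a, of "z j"] f(4)[OF j j] by (simp add: g cyc_smult)
          moreover have "\<phi> a \<odot>\<^bsub>M\<^esub> z j \<in> gr M j \<inter> cocycles M"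
            using a J(2)[OF j] gr_smult cyc_smult by blast
          ultimately show "a \<in> g ` gr (cohomology M) j" unfolding gr
            by (intro image_eqI[OF _ imageI]) simp_all
        qed
      qed
    qed
    ultimately show ?thesis by (auto simp: module_iso_def regular_module_def)
  qed
qed

section \<open>Graded free modules over the polynomial ring\<close>

text \<open>
  The grading of the \<open>i\<close>-th coordinate is shifted so that the \<open>i\<close>-th basis vector has degree
  \<open>dg i\<close>.
\<close>

definition free_dg_module ::
  "('a, 'y) ring_scheme \<Rightarrow> nat \<Rightarrow> nat set \<Rightarrow> (nat \<Rightarrow> int) \<Rightarrow> ((nat \<Rightarrow> 'a npoly) \<Rightarrow> nat \<Rightarrow> 'a npoly)
    \<Rightarrow> ('a npoly, nat \<Rightarrow> 'a npoly) dgmodule"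
  where "free_dg_module K d I dg D =
    \<lparr>carrier = carrier (fun_module (mpoly_ring K d) I), monoid.mult = undefined, one = undefined,
     zero = zero (fun_module (mpoly_ring K d) I), add = add (fun_module (mpoly_ring K d) I),
     smult = smult (fun_module (mpoly_ring K d) I),
     gr = (\<lambda>j. {f \<in> carrier (fun_module (mpoly_ring K d) I). \<forall>i\<in>I. f i \<in> mpoly_grading K d (j - dg i)}),
     diff = D\<rparr>"

lemma free_dg_module_simps [simp]:
  "carrier (free_dg_module K d I dg D) = carrier (fun_module (mpoly_ring K d) I)"
  "zero (free_dg_module K d I dg D) = (\<lambda>i. \<zero>\<^bsub>mpoly_ring K d\<^esub>)"
  "add (free_dg_module K d I dg D) = (\<lambda>f g i. f i \<oplus>\<^bsub>mpoly_ring K d\<^esub> g i)"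
  "smult (free_dg_module K d I dg D) = (\<lambda>a f i. a \<otimes>\<^bsub>mpoly_ring K d\<^esub> f i)"
  "gr (free_dg_module K d I dg D) =
    (\<lambda>j. {f \<in> carrier (fun_module (mpoly_ring K d) I). \<forall>i\<in>I. f i \<in> mpoly_grading K d (j - dg i)})"
  "diff (free_dg_module K d I dg D) = D"
  by (simp_all add: free_dg_module_def)

context cring
begin

lemma Poly_finsum_coeff:
  assumes "finite A" "\<And>a. a \<in> A \<Longrightarrow> f a \<in> carrier (Poly d)"
  shows "(\<Oplus>\<^bsub>Poly d\<^esub>a\<in>A. f a) m = (\<Oplus>a\<in>A. f a m)"
proof -
  interpret P: cring "Poly d" by (rule Poly_cring)
  show ?thesis using assms
  proof (induction A rule: finite_induct)
    case (insert a A)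
    then have "(\<lambda>a. f a m) \<in> A \<rightarrow> carrier R" "f a m \<in> carrier R" by (auto intro: Poly_coeff)
    then show ?case using insert by (simp add: Pi_def) (simp add: Poly_add)
  qed (simp add: Poly_zero)
qed

lemma Poly_grading: "P \<in> mpoly_grading R d j \<longleftrightarrow> P \<in> carrier (Poly d) \<and> (\<forall>m. P m \<noteq> \<zero> \<longrightarrow> 2 * int (size m) = j)"
  by (simp add: mpoly_grading_def)

lemma Poly_uminus:
  assumes "P \<in> carrier (Poly d)" shows "\<ominus>\<^bsub>Poly d\<^esub> P = (\<lambda>m. \<ominus> P m)"
proof -
  interpret P: cring "Poly d" by (rule Poly_cring)
  have "P \<oplus>\<^bsub>Poly d\<^esub> \<ominus>\<^bsub>Poly d\<^esub> P = \<zero>\<^bsub>Poly d\<^esub>" using assms by (rule P.r_neg)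
  then have "P m \<oplus> (\<ominus>\<^bsub>Poly d\<^esub> P) m = \<zero>" for m by (simp add: Poly_add Poly_zero fun_eq_iff)
  then have "(\<ominus>\<^bsub>Poly d\<^esub> P) m = \<ominus> P m" for m
    using minus_equality[of "(\<ominus>\<^bsub>Poly d\<^esub> P) m" "P m"] Poly_coeff[OF assms] Poly_coeff[OF P.a_inv_closed[OF assms]]
    by (simp add: a_comm)
  then show ?thesis by blast
qed

lemma Poly_grading_additive: "additive_subgroup (mpoly_grading R d j) (Poly d)"
proof -
  interpret P: cring "Poly d" by (rule Poly_cring)
  show ?thesis
  proof (rule additive_subgroupI, rule P.add.subgroupI)
    show "mpoly_grading R d j \<subseteq> carrier (Poly d)" by (auto simp: Poly_grading)
    have "\<zero>\<^bsub>Poly d\<^esub> \<in> mpoly_grading R d j" by (simp add: Poly_grading) (simp add: Poly_zero)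
    then show "mpoly_grading R d j \<noteq> {}" by blast
    fix P assume P: "P \<in> mpoly_grading R d j"
    then have "\<ominus> P m \<noteq> \<zero> \<Longrightarrow> P m \<noteq> \<zero>" for m by auto
    then show "\<ominus>\<^bsub>Poly d\<^esub> P \<in> mpoly_grading R d j"
      using P by (auto simp: Poly_grading Poly_uminus[symmetric]) (auto simp: Poly_uminus)
    fix Q assume Q: "Q \<in> mpoly_grading R d j"
    have "P m \<noteq> \<zero> \<or> Q m \<noteq> \<zero>" if "P m \<oplus> Q m \<noteq> \<zero>" for m using that by auto
    then show "P \<oplus>\<^bsub>Poly d\<^esub> Q \<in> mpoly_grading R d j"
      using P Q by (auto simp: Poly_grading) (auto simp: Poly_add)
  qed
qed

lemma Poly_grading_mult:
  assumes P: "P \<in> mpoly_grading R d i" and Q: "Q \<in> mpoly_grading R d j"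
  shows "P \<otimes>\<^bsub>Poly d\<^esub> Q \<in> mpoly_grading R d (i + j)"
proof -
  have cl: "P \<in> carrier (Poly d)" "Q \<in> carrier (Poly d)" using P Q by (auto simp: Poly_grading)
  have "2 * int (size m) = i + j" if nz: "(P \<otimes>\<^bsub>Poly d\<^esub> Q) m \<noteq> \<zero>" for m
  proof (rule ccontr)
    assume ne: "2 * int (size m) \<noteq> i + j"
    have "(\<Oplus>u\<in>{u. u \<subseteq># m}. P u \<otimes> Q (m - u)) = (\<Oplus>u\<in>{u. u \<subseteq># m}. \<zero>)"
    proof (intro finsum_cong' refl)
      fix u assume u: "u \<in> {u. u \<subseteq># m}"
      then have "int (size m) = int (size u) + int (size (m - u))"
        by (simp add: size_Diff_submset size_mset_mono of_nat_diff)
      then have "P u = \<zero> \<or> Q (m - u) = \<zero>" using P Q ne by (force simp: Poly_grading)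
      then show "P u \<otimes> Q (m - u) = \<zero>" using Poly_coeff[OF cl(1)] Poly_coeff[OF cl(2)] by auto
    qed auto
    then show False using nz by (simp add: Poly_mult)
  qed
  then show ?thesis using Poly_mult_closed[OF cl] by (simp add: Poly_grading)
qed

lemma Poly_grading_const: "k \<in> carrier R \<Longrightarrow> indexed_const k \<in> mpoly_grading R d 0"
  by (simp add: Poly_grading Poly_const) (simp add: indexed_const_def)

text \<open>
  A monomial \<open>m\<close> in coordinate \<open>i\<close> has the single degree \<open>2 * size m + dg i\<close>, so at most one
  summand contributes to its coefficient.
\<close>

lemma graded_sum_coeff:
  assumes I: "finite J" "\<And>j. c j \<in> gr (free_dg_module R d I dg D) j"
  shows "(\<Oplus>\<^bsub>free_dg_module R d I dg D\<^esub>j\<in>J. c j) i m =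
    (if i \<in> I \<and> 2 * int (size m) + dg i \<in> J then c (2 * int (size m) + dg i) i m else \<zero>)"
proof -
  interpret P: cring "Poly d" by (rule Poly_cring)
  let ?F = "fun_module (Poly d) I"
  have c: "c j \<in> carrier ?F" for j using I(2)[of j] by simp
  have cP: "c j i \<in> carrier (Poly d)" for j i using c[of j] by (rule fun_moduleD)
  have "finsum (free_dg_module R d I dg D) = (finsum ?F :: (int \<Rightarrow> _) \<Rightarrow> _)"
    by (intro ext) (simp add: finsum_def finprod_def)
  then have "(\<Oplus>\<^bsub>free_dg_module R d I dg D\<^esub>j\<in>J. c j) i = (\<Oplus>\<^bsub>Poly d\<^esub>j\<in>J. c j i)"
    using P.fun_module_finsum[OF I(1), of c I] c by simp
  then have eq: "(\<Oplus>\<^bsub>free_dg_module R d I dg D\<^esub>j\<in>J. c j) i m = (\<Oplus>j\<in>J. c j i m)"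
    using Poly_finsum_coeff[OF I(1), of "\<lambda>j. c j i"] cP by simp
  show ?thesis
  proof (cases "i \<in> I")
    case False
    then have "c j i m = \<zero>" for j using c[of j] by (simp add: fun_module_carrier Poly_zero)
    then show ?thesis using False eq by simp
  next
    case True
    let ?j = "2 * int (size m) + dg i"
    have z: "c j i m = \<zero>" if "j \<noteq> ?j" for j
    proof -
      have "c j i \<in> mpoly_grading R d (j - dg i)" using I(2)[of j] True by simp
      then show ?thesis using that by (force simp: Poly_grading)
    qed
    have "(\<Oplus>j\<in>J. c j i m) = (\<Oplus>j\<in>J. if j = ?j then c ?j i m else \<zero>)"
      using z Poly_coeff[OF cP] by (intro finsum_cong') auto
    also have "\<dots> = (if ?j \<in> J then c ?j i m else \<zero>)"
    proof (cases "?j \<in> J")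
      case True
      then show ?thesis using finsum_delta[OF I(1) True] Poly_coeff[OF cP] by simp
    next
      case False
      then have "(\<Oplus>j\<in>J. if j = ?j then c ?j i m else \<zero>) = (\<Oplus>j\<in>J. \<zero>)"
        by (intro finsum_cong') auto
      then show ?thesis using False by simp
    qed
    finally show ?thesis using True eq by simp
  qed
qed

definition component :: "nat set \<Rightarrow> (nat \<Rightarrow> int) \<Rightarrow> (nat \<Rightarrow> 'a npoly) \<Rightarrow> int \<Rightarrow> nat \<Rightarrow> 'a npoly" where
  "component I dg f j i m = (if i \<in> I \<and> 2 * int (size m) + dg i = j then f i m else \<zero>)"

lemma component_gr:
  assumes "f \<in> carrier (fun_module (Poly d) I)"
  shows "component I dg f j \<in> gr (free_dg_module R d I dg D) j"
proof -
  have cl: "component I dg f j i \<in> carrier (Poly d)" for i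
  proof -
    have f: "f i \<in> carrier (Poly d)" using assms by (rule fun_moduleD)
    have "{m. component I dg f j i m \<noteq> \<zero>} \<subseteq> {m. f i m \<noteq> \<zero>}" by (auto simp: component_def)
    then show ?thesis using f by (auto simp: Poly_carrier component_def intro: finite_subset)
  qed
  have "component I dg f j i = \<zero>\<^bsub>Poly d\<^esub>" if "i \<notin> I" for i
    using that by (simp add: Poly_zero component_def fun_eq_iff)
  then show ?thesis using cl by (auto simp: fun_module_carrier Poly_grading) (auto simp: component_def split: if_splits)
qed

lemma homog_decomp_iff:
  assumes I: "finite I" and f: "f \<in> carrier (fun_module (Poly d) I)"
  shows "homog_decomp (free_dg_module R d I dg D) c f \<longleftrightarrow> c = component I dg f"
proof
  let ?M = "free_dg_module R d I dg D"
  assume "homog_decomp ?M c f"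
  then have c: "\<And>j. c j \<in> gr ?M j" "finite {j. c j \<noteq> \<zero>\<^bsub>?M\<^esub>}" "f = (\<Oplus>\<^bsub>?M\<^esub>j\<in>{j. c j \<noteq> \<zero>\<^bsub>?M\<^esub>}. c j)"
    unfolding homog_decomp_def by blast+
  show "c = component I dg f"
  proof (intro ext)
    fix j i and m :: "nat multiset"
    let ?j = "2 * int (size m) + dg i"
    have f_eq: "f i m = (if i \<in> I \<and> ?j \<in> {j. c j \<noteq> \<zero>\<^bsub>?M\<^esub>} then c ?j i m else \<zero>)"
      using graded_sum_coeff[OF c(2,1)] c(3) by simp
    have zero: "c ?j i m = \<zero>" if "c ?j = \<zero>\<^bsub>?M\<^esub>" using that by (simp add: Poly_zero)
    show "c j i m = component I dg f j i m"
    proof (cases "i \<in> I")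
      case False
      then show ?thesis using c(1)[of j] by (simp add: component_def fun_module_carrier Poly_zero)
    next
      case True
      then have "c j i \<in> mpoly_grading R d (j - dg i)" using c(1)[of j] by simp
      then have "c j i m = \<zero>" if "j \<noteq> ?j" using that by (force simp: Poly_grading)
      then show ?thesis using True f_eq zero by (auto simp: component_def)
    qed
  qed
next
  let ?M = "free_dg_module R d I dg D" and ?c = "component I dg f"
  assume c: "c = ?c"
  let ?J = "{j. ?c j \<noteq> \<zero>\<^bsub>?M\<^esub>}"
  have "?J \<subseteq> (\<Union>i\<in>I. (\<lambda>m. 2 * int (size m) + dg i) ` {m. f i m \<noteq> \<zero>})"
  proof
    fix j assume "j \<in> ?J"
    then obtain i m where "?c j i m \<noteq> \<zero>" by (auto simp: fun_eq_iff Poly_zero)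
    then show "j \<in> (\<Union>i\<in>I. (\<lambda>m. 2 * int (size m) + dg i) ` {m. f i m \<noteq> \<zero>})"
      by (auto simp: component_def split: if_splits)
  qed
  moreover have "finite {m. f i m \<noteq> \<zero>}" for i using fun_moduleD[OF f, of i] by (simp add: Poly_carrier)
  ultimately have fin: "finite ?J" using I by (meson finite_UN finite_imageI finite_subset)
  have "f i m = (\<Oplus>\<^bsub>?M\<^esub>j\<in>?J. ?c j) i m" for i m
  proof -
    let ?j = "2 * int (size m) + dg i"
    have "f i m = \<zero>" if "i \<notin> I" using that f by (simp add: fun_module_carrier Poly_zero)
    moreover have "f i m = \<zero>" if "i \<in> I" "?j \<notin> ?J"
    proof -
      have "?c ?j i m = \<zero>" using that(2) by (simp add: Poly_zero fun_eq_iff)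
      then show ?thesis using that(1) by (simp add: component_def)
    qed
    moreover have "?c ?j i m = f i m" if "i \<in> I" using that by (simp add: component_def)
    ultimately show ?thesis
      using graded_sum_coeff[OF fin component_gr[OF f]] by auto
  qed
  then have "f = (\<Oplus>\<^bsub>?M\<^esub>j\<in>?J. ?c j)" by blast
  then show "homog_decomp ?M c f"
    unfolding homog_decomp_def c using component_gr[OF f] fin by blast
qed

lemma free_dg_module_module: "module (Poly d) (free_dg_module R d I dg D)"
proof -
  interpret P: cring "Poly d" by (rule Poly_cring)
  show ?thesis by (rule module_cong[OF P.fun_module_module[of I]]) simp_all
qed

lemma free_dg_module_graded:
  assumes I: "finite I"
  shows "graded_module (Poly d) (mpoly_grading R d) (free_dg_module R d I dg D)"
proof -
  interpret P: cring "Poly d" by (rule Poly_cring)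
  interpret M: module "Poly d" "free_dg_module R d I dg D" by (rule free_dg_module_module)
  interpret A: additive_subgroup "mpoly_grading R d j" "Poly d" for j by (rule Poly_grading_additive)
  have "subgroup (gr (free_dg_module R d I dg D) j) (add_monoid (free_dg_module R d I dg D))" for j
  proof (rule M.M.add.subgroupI)
    have "(\<lambda>i. \<zero>\<^bsub>Poly d\<^esub>) \<in> gr (free_dg_module R d I dg D) j" by (simp add: fun_module_carrier)
    then show "gr (free_dg_module R d I dg D) j \<noteq> {}" by blast
    fix f assume f: "f \<in> gr (free_dg_module R d I dg D) j"
    have "\<ominus>\<^bsub>free_dg_module R d I dg D\<^esub> f = (\<lambda>i. \<ominus>\<^bsub>Poly d\<^esub> f i)"
      using f by (intro M.M.minus_equality) (auto simp: fun_module_carrier P.l_neg)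
    then show "\<ominus>\<^bsub>free_dg_module R d I dg D\<^esub> f \<in> gr (free_dg_module R d I dg D) j"
      using f by (simp add: fun_module_carrier)
  next
    fix f g assume "f \<in> gr (free_dg_module R d I dg D) j" "g \<in> gr (free_dg_module R d I dg D) j"
    then show "f \<oplus>\<^bsub>free_dg_module R d I dg D\<^esub> g \<in> gr (free_dg_module R d I dg D) j"
      by (simp add: fun_module_carrier)
  qed auto
  moreover have "a \<odot>\<^bsub>free_dg_module R d I dg D\<^esub> f \<in> gr (free_dg_module R d I dg D) (i + j)"
    if a: "a \<in> mpoly_grading R d i" and f: "f \<in> gr (free_dg_module R d I dg D) j" for i j a f
  proof -
    have aP: "a \<in> carrier (Poly d)" using a by (simp add: Poly_grading)
    have "a \<otimes>\<^bsub>Poly d\<^esub> f k \<in> mpoly_grading R d (i + j - dg k)" if "k \<in> I" for k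
      using Poly_grading_mult[OF a, of "f k" "j - dg k"] f that by (simp add: add_diff_eq)
    then show ?thesis using f aP by (simp add: fun_module_carrier)
  qed
  ultimately show ?thesis
    unfolding graded_module_def using free_dg_module_module homog_decomp_iff[OF I]
    by (auto simp del: free_dg_module_simps(3-6))
qed

definition unit_vec :: "nat \<Rightarrow> nat \<Rightarrow> nat \<Rightarrow> 'a npoly" where
  "unit_vec d k i = (if i = k then \<one>\<^bsub>Poly d\<^esub> else \<zero>\<^bsub>Poly d\<^esub>)"

lemma unit_vec_gr: "k \<in> I \<Longrightarrow> unit_vec d k \<in> gr (free_dg_module R d I dg D) (dg k)"
proof -
  assume k: "k \<in> I"
  interpret P: cring "Poly d" by (rule Poly_cring)
  interpret A: additive_subgroup "mpoly_grading R d j" "Poly d" for j by (rule Poly_grading_additive)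
  have "\<one>\<^bsub>Poly d\<^esub> \<in> mpoly_grading R d 0"
    using Poly_grading_const[of \<one> d] by (simp add: Poly_one indexed_const_def)
  then show ?thesis using k by (auto simp: unit_vec_def fun_module_carrier)
qed

lemma free_dg_module_rank:
  assumes "\<one> \<noteq> \<zero>" "finite I"
  shows "free_rank (Poly d) (free_dg_module R d I dg D) \<le> enat (card I)"
proof -
  interpret P: cring "Poly d" by (rule Poly_cring)
  interpret M: module "Poly d" "free_dg_module R d I dg D" by (rule free_dg_module_module)
  have ne: "\<one>\<^bsub>Poly d\<^esub> \<noteq> \<zero>\<^bsub>Poly d\<^esub>" using assms(1) by (auto simp: Poly_one Poly_zero fun_eq_iff)
  have uv: "unit_vec d i \<in> carrier (fun_module (Poly d) I)" if "i \<in> I" for i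
    using unit_vec_gr[OF that] by simp
  note basis = is_basis_by_coordinates[of "Poly d" "free_dg_module R d I dg D" "free_dg_module R d I dg D" "\<lambda>x. x"
      "\<lambda>a f i. a \<otimes>\<^bsub>Poly d\<^esub> f i" I "unit_vec d" "\<lambda>i f. f i", OF P.is_cring ne M.M.abelian_monoid_axioms]
  have eq: "x = y \<longleftrightarrow> (\<forall>i\<in>I. x i = y i)"
    if "x \<in> carrier (fun_module (Poly d) I)" "y \<in> carrier (fun_module (Poly d) I)" for x y
    using that by (auto simp: fun_module_carrier fun_eq_iff)
  have "is_basis (Poly d) (free_dg_module R d I dg D) (unit_vec d ` I)" "inj_on (unit_vec d) I"
    by (rule basis[simplified]; use assms(2) uv eq in \<open>simp add: fun_module_carrier unit_vec_def\<close>)+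
  then have "is_basis (Poly d) (free_dg_module R d I dg D) (unit_vec d ` I)" "card (unit_vec d ` I) = card I"
    by (auto simp: card_image)
  then show ?thesis unfolding free_rank_def
    using assms(2) by (intro INF_lower2[of "unit_vec d ` I"]) auto
qed

lemma free_dg_module_dg:
  assumes I: "finite I" and D: "linear_map (Poly d) (fun_module (Poly d) I) (fun_module (Poly d) I) D"
    and D_gr: "\<And>j f. f \<in> gr (free_dg_module R d I dg D) j \<Longrightarrow> D f \<in> gr (free_dg_module R d I dg D) (j + 1)"
    and D_D: "\<And>f. f \<in> carrier (fun_module (Poly d) I) \<Longrightarrow> D (D f) = (\<lambda>i. \<zero>\<^bsub>Poly d\<^esub>)"
  shows "dg_module (Poly d) (mpoly_grading R d) (free_dg_module R d I dg D)"
proof -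
  have "linear_map (Poly d) (free_dg_module R d I dg D) (free_dg_module R d I dg D) D"
    using D by (simp add: linear_map_def hom_def)
  moreover have "\<forall>j. \<forall>x\<in>gr (free_dg_module R d I dg D) j. D x \<in> gr (free_dg_module R d I dg D) (j + 1)"
    using D_gr by blast
  ultimately show ?thesis
    unfolding dg_module_def free_dg_module_simps(6) using free_dg_module_graded[OF I] D_D
    by (simp only: free_dg_module_simps(1,2)) blast
qed

text \<open>
  If \<open>D\<close> lowers a level function on the basis, then the elements supported in levels at most
  \<open>l\<close> form the filtration, and the basis vectors of level \<open>l\<close> give a basis of the \<open>l\<close>-th
  quotient.
\<close>

theorem free_dg_module_semifree:
  fixes lev :: "nat \<Rightarrow> nat"
  assumes one: "\<one> \<noteq> \<zero>" and I: "finite I"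
    and D: "linear_map (Poly d) (fun_module (Poly d) I) (fun_module (Poly d) I) D"
    and D_gr: "\<And>j f. f \<in> gr (free_dg_module R d I dg D) j \<Longrightarrow> D f \<in> gr (free_dg_module R d I dg D) (j + 1)"
    and D_D: "\<And>f. f \<in> carrier (fun_module (Poly d) I) \<Longrightarrow> D (D f) = (\<lambda>i. \<zero>\<^bsub>Poly d\<^esub>)"
    and lower: "\<And>f l i. f \<in> carrier (fun_module (Poly d) I) \<Longrightarrow> (\<And>i. l < lev i \<Longrightarrow> f i = \<zero>\<^bsub>Poly d\<^esub>)
      \<Longrightarrow> l \<le> lev i \<Longrightarrow> D f i = \<zero>\<^bsub>Poly d\<^esub>"
  shows "semifree (Poly d) (mpoly_grading R d) (free_dg_module R d I dg D)"
proof -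
  let ?M = "free_dg_module R d I dg D"
  interpret P: cring "Poly d" by (rule Poly_cring)
  interpret M: module "Poly d" ?M by (rule free_dg_module_module)
  have ne: "\<one>\<^bsub>Poly d\<^esub> \<noteq> \<zero>\<^bsub>Poly d\<^esub>" using one by (auto simp: Poly_one Poly_zero fun_eq_iff)
  define F :: "int \<Rightarrow> (nat \<Rightarrow> 'a npoly) set"
    where "F l = {f \<in> carrier (fun_module (Poly d) I). \<forall>i. l < int (lev i) \<longrightarrow> f i = \<zero>\<^bsub>Poly d\<^esub>}" for l
  have F_mono: "F l \<subseteq> F l'" if "l \<le> l'" for l l' using that by (auto simp: F_def)
  have F_sub: "submodule (F l) (Poly d) ?M" for l
    by (rule submoduleI_smult) (auto simp: F_def M.module_axioms fun_module_carrier)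
  have F_graded: "graded_submodule (Poly d) ?M (F l)" for l
  proof -
    have "component I dg f j \<in> F l" if f: "f \<in> F l" for f j
    proof -
      have "f \<in> carrier (fun_module (Poly d) I)" using f by (simp add: F_def)
      then have "component I dg f j \<in> carrier (fun_module (Poly d) I)"
        using component_gr[of f d I dg j D] by simp
      moreover have "component I dg f j i = \<zero>\<^bsub>Poly d\<^esub>" if "f i = \<zero>\<^bsub>Poly d\<^esub>" for i
        using that by (auto simp: component_def Poly_zero fun_eq_iff)
      ultimately show ?thesis using f by (simp add: F_def)
    qed
    note comp = this
    show ?thesis unfolding graded_submodule_def
    proof (intro conjI ballI allI impI F_sub)
      fix f c j assume f: "f \<in> F l" and c: "homog_decomp ?M c f"
      have "f \<in> carrier (fun_module (Poly d) I)" using f by (simp add: F_def)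
      then have "c = component I dg f" using c homog_decomp_iff[OF I] by blast
      then show "c j \<in> F l" using comp[OF f] by simp
    qed
  qed
  have bottom: "F (-1) = {\<zero>\<^bsub>?M\<^esub>}"
    by (auto simp: F_def fun_module_carrier fun_eq_iff)
  have top: "f \<in> F (int (Max (insert 0 (lev ` I))))" if f: "f \<in> carrier (fun_module (Poly d) I)" for f
  proof -
    have "f i = \<zero>\<^bsub>Poly d\<^esub>" if "int (Max (insert 0 (lev ` I))) < int (lev i)" for i
    proof -
      have "i \<notin> I"
      proof
        assume "i \<in> I"
        then have "lev i \<le> Max (insert 0 (lev ` I))" using I by (intro Max_ge) auto
        then show False using that by simp
      qed
      then show ?thesis using f by (simp add: fun_module_carrier)
    qed
    then show ?thesis using f by (simp add: F_def)
  qed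
  have union: "(\<Union>l\<in>{0..}. F l) = carrier ?M"
  proof
    show "(\<Union>l\<in>{0..}. F l) \<subseteq> carrier ?M" by (auto simp: F_def)
    show "carrier ?M \<subseteq> (\<Union>l\<in>{0..}. F l)"
      using top by (intro subsetI UN_I[of "int (Max (insert 0 (lev ` I)))"]) simp_all
  qed
  have D_lower: "diff ?M ` F l \<subseteq> F (l - 1)" if l: "0 \<le> l" for l
  proof
    fix g assume "g \<in> diff ?M ` F l"
    then obtain f where f: "f \<in> F l" "g = D f" by auto
    obtain n where n: "l = int n" using l by (metis nonneg_int_cases)
    have "D f i = \<zero>\<^bsub>Poly d\<^esub>" if "l - 1 < int (lev i)" for i
      by (rule lower[of f n]) (use f n that in \<open>auto simp: F_def\<close>)
    then show "g \<in> F (l - 1)" using f P.linear_map_closed[OF D] by (auto simp: F_def)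
  qed
  have free: "graded_free (Poly d) (quotient_gmodule (restrict_gmodule ?M (F l)) (F (l - 1)))" for l
  proof -
    let ?Q = "quotient_gmodule (restrict_gmodule ?M (F l)) (F (l - 1))"
    let ?I = "{i \<in> I. int (lev i) = l}"
    let ?q = "\<lambda>x. F (l - 1) +>\<^bsub>restrict_gmodule ?M (F l)\<^esub> x"
    have N: "submodule (F (l - 1)) (Poly d) (restrict_gmodule ?M (F l))"
      by (rule submodule_restrict[OF M.module_axioms F_sub F_sub F_mono]) simp
    have uv: "unit_vec d i \<in> F l" if "i \<in> ?I" for i
      using that by (auto simp: F_def unit_vec_def fun_module_carrier)
    have inN: "x \<in> F (l - 1) \<longleftrightarrow> (\<forall>i\<in>?I. x i = \<zero>\<^bsub>Poly d\<^esub>)" if x: "x \<in> F l" for x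
    proof
      assume *: "\<forall>i\<in>?I. x i = \<zero>\<^bsub>Poly d\<^esub>"
      have "x i = \<zero>\<^bsub>Poly d\<^esub>" if "l - 1 < int (lev i)" for i
        using x * that by (cases "i \<in> I"; cases "int (lev i) = l") (auto simp: F_def fun_module_carrier)
      then show "x \<in> F (l - 1)" using x by (simp add: F_def)
    qed (auto simp: F_def)
    have Fx: "x i \<in> carrier (Poly d)" if "x \<in> F l" for x i using that by (simp add: F_def fun_module_carrier)
    have "is_basis (Poly d) ?Q ((\<lambda>i. ?q (unit_vec d i)) ` ?I)"
      by (rule is_basis_quotient(1)[OF module_restrict[OF M.module_axioms F_sub] N P.is_cring ne,
            where \<phi> = "\<lambda>a. a" and f = "\<lambda>i f. f i"])
        (use I uv inN Fx in \<open>simp_all add: unit_vec_def\<close>)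
    moreover have "?q (unit_vec d i) \<in> gr ?Q (dg i)" if "i \<in> ?I" for i
    proof -
      have "unit_vec d i \<in> gr ?M (dg i) \<inter> F l" using unit_vec_gr[of i I d dg D] that uv by blast
      then show ?thesis by (simp del: free_dg_module_simps)
    qed
    ultimately show ?thesis unfolding graded_free_def by blast
  qed
  have dgm: "dg_module (Poly d) (mpoly_grading R d) ?M"
    by (rule free_dg_module_dg[OF I D D_gr D_D])
  show ?thesis
    unfolding semifree_def
  proof (intro conjI exI[of _ F] allI impI)
    show "F (i - 1) \<subseteq> F i" for i by (rule F_mono) simp
  qed (use dgm bottom F_graded union free D_lower in \<open>blast+\<close>)
qed

end

section \<open>The rank of the contraction\<close>

text \<open>
  On subsets of the first eight indices the contraction consists of 32, 24, 8 and 1 copies of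
  the operators on Boolean lattices of rank 1, 2, 3 and 4, and
  \<open>32 * 1 + 24 * 2 + 8 * 5 + 1 * 9 = 129\<close>. The proof enumerates the 256 subsets.
\<close>

lemma card_sources_8: "card {S \<in> Pow {..<8}. bits S \<in> sources} = 129"
  and card_targets_8: "card {S \<in> Pow {..<8}. bits S \<in> targets} = 129"
proof -
  have card: "card {S \<in> Pow {..<8}. P S} = length (filter P (map set (subseqs [0..<8])))" for P :: "nat set \<Rightarrow> bool"
  proof -
    have "{S \<in> Pow {..<8}. P S} = set (filter P (map set (subseqs [0..<8])))"
      by (auto simp: subseqs_powset[of "[0..<8]", simplified] atLeast0LessThan simp flip: image_set)
    then show ?thesis using distinct_set_subseqs[of "[0..<8]"] by (simp add: distinct_card del: set_filter)
  qed
  have "length (filter (\<lambda>S. bits S \<in> sources) (map set (subseqs [0..<8]))) = 129"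
    by code_simp
  then show "card {S \<in> Pow {..<8}. bits S \<in> sources} = 129" by (simp only: card)
  have "length (filter (\<lambda>S. bits S \<in> targets) (map set (subseqs [0..<8]))) = 129"
    by code_simp
  then show "card {S \<in> Pow {..<8}. bits S \<in> targets} = 129" by (simp only: card)
qed

lemma bits_low: "bits (S \<inter> {..<8}) = bits S"
proof -
  have "even_pairs (S \<inter> {..<8}) = even_pairs S"
    unfolding even_pairs_def by (rule filter_cong) auto
  then show ?thesis unfolding bits_def by (auto simp: set_even_pairs)
qed

lemma card_bits:
  assumes "8 \<le> d"
  shows "card {S \<in> Pow {..<d}. P (bits S)} = card {S \<in> Pow {..<8}. P (bits S)} * 2 ^ (d - 8)"
proof -
  let ?f = "\<lambda>S. (S \<inter> {..<8}, S \<inter> {8..<d})"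
  have "bij_betw ?f {S \<in> Pow {..<d}. P (bits S)} ({S \<in> Pow {..<8}. P (bits S)} \<times> Pow {8..<d})"
  proof (rule bij_betwI[where g = "\<lambda>(A, B). A \<union> B"])
    show "?f \<in> {S \<in> Pow {..<d}. P (bits S)} \<rightarrow> {S \<in> Pow {..<8}. P (bits S)} \<times> Pow {8..<d}"
      by (auto simp: bits_low)
    have "bits (A \<union> B) = bits A" if "A \<subseteq> {..<8}" "B \<subseteq> {8..<d}" for A B
    proof -
      have "(A \<union> B) \<inter> {..<8} = A" using that by fastforce
      then show ?thesis using bits_low[of "A \<union> B"] by simp
    qed
    then show "(\<lambda>(A, B). A \<union> B) \<in> {S \<in> Pow {..<8}. P (bits S)} \<times> Pow {8..<d} \<rightarrow> {S \<in> Pow {..<d}. P (bits S)}"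
      using assms by fastforce
    show "(case ?f S of (A, B) \<Rightarrow> A \<union> B) = S" if "S \<in> {S \<in> Pow {..<d}. P (bits S)}" for S
    proof -
      have "S \<subseteq> {..<8} \<union> {8..<d}" using that by fastforce
      then show ?thesis by auto
    qed
    show "?f (case p of (A, B) \<Rightarrow> A \<union> B) = p" if "p \<in> {S \<in> Pow {..<8}. P (bits S)} \<times> Pow {8..<d}" for p
      using that by fastforce
  qed
  then have "card {S \<in> Pow {..<d}. P (bits S)} = card ({S \<in> Pow {..<8}. P (bits S)} \<times> Pow {8..<d})"
    by (rule bij_betw_same_card)
  then show ?thesis by (simp add: card_cartesian_product card_Pow)
qed

text \<open>
  Both summands of the cone lose \<open>129 * 2 ^ (d - 8)\<close> of their \<open>256 * 2 ^ (d - 8)\<close> coordinates,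
  which is more than half.
\<close>

lemma (in koszul_cone) card_small_ix: "card small_ix < 2 ^ d" "finite small_ix"
proof -
  let ?A = "{S \<in> Pow {..<d}. bits S \<notin> sources}" and ?B = "{S \<in> Pow {..<d}. bits S \<notin> targets}"
  have fin: "finite ?A" "finite ?B" by simp_all
  have sub: "small_ix \<subseteq> (\<lambda>S. 2 * set_encode S) ` ?A \<union> (\<lambda>S. Suc (2 * set_encode S)) ` ?B"
  proof
    fix n assume n: "n \<in> small_ix"
    have "even n \<Longrightarrow> n = 2 * set_encode (set_decode (n div 2))" "odd n \<Longrightarrow> n = Suc (2 * set_encode (set_decode (n div 2)))"
      by simp_all
    then show "n \<in> (\<lambda>S. 2 * set_encode S) ` ?A \<union> (\<lambda>S. Suc (2 * set_encode S)) ` ?B"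
      using n by (cases "even n") (auto simp: small_ix_def ix_def simp del: set_decode_inverse)
  qed
  then show "finite small_ix" using fin by (meson finite_UnI finite_imageI finite_subset)
  have compl: "card {S \<in> Pow {..<d}. \<not> P (bits S)} + card {S \<in> Pow {..<d}. P (bits S)} = 2 ^ d" for P
  proof -
    have "card {S \<in> Pow {..<d}. \<not> P (bits S)} + card {S \<in> Pow {..<d}. P (bits S)}
        = card ({S \<in> Pow {..<d}. \<not> P (bits S)} \<union> {S \<in> Pow {..<d}. P (bits S)})"
      by (rule card_Un_disjoint[symmetric]) auto
    also have "{S \<in> Pow {..<d}. \<not> P (bits S)} \<union> {S \<in> Pow {..<d}. P (bits S)} = Pow {..<d}" by auto
    finally show ?thesis by (simp add: card_Pow)
  qed
  have d: "(2::nat) ^ d = 256 * 2 ^ (d - 8)"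
    using power_add[of "2::nat" 8 "d - 8"] d_ge by simp
  have A: "card ?A + 129 * 2 ^ (d - 8) = 2 ^ d"
    using compl[of "\<lambda>b. b \<in> sources"] card_bits[OF d_ge, of "\<lambda>b. b \<in> sources"] card_sources_8 by simp
  have B: "card ?B + 129 * 2 ^ (d - 8) = 2 ^ d"
    using compl[of "\<lambda>b. b \<in> targets"] card_bits[OF d_ge, of "\<lambda>b. b \<in> targets"] card_targets_8 by simp
  have "card small_ix \<le> card ((\<lambda>S. 2 * set_encode S) ` ?A \<union> (\<lambda>S. Suc (2 * set_encode S)) ` ?B)"
    using sub fin by (intro card_mono) auto
  also have "\<dots> \<le> card ?A + card ?B"
    by (rule order.trans[OF card_Un_le add_mono[OF card_image_le[OF fin(1)] card_image_le[OF fin(2)]]])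
  also have "\<dots> < 2 ^ d"
  proof -
    have "0 < (2::nat) ^ (d - 8)" by simp
    then show ?thesis using A B d by linarith
  qed
  finally show "card small_ix < 2 ^ d" .
qed

section \<open>The Koszul complex of the polynomial ring\<close>

context cring
begin

abbreviation indet :: "nat \<Rightarrow> 'a npoly" where "indet j \<equiv> indexed_pmult (indexed_const \<one>) j"

lemma indet_closed: "j < d \<Longrightarrow> indet j \<in> carrier (Poly d)"
  by (simp add: Poly_pmult_closed Poly_const)

lemma Poly_one_const: "indexed_const \<one> = \<one>\<^bsub>Poly d\<^esub>"
  by (simp add: Poly_one indexed_const_def)

lemma indet_mult:
  assumes "P \<in> carrier (Poly d)" shows "indet j \<otimes>\<^bsub>Poly d\<^esub> P = indexed_pmult P j"
proof -
  interpret P: cring "Poly d" by (rule Poly_cring)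
  show ?thesis using assms Poly_pmult_mult[of "indexed_const \<one>" d P j] Poly_const[of \<one> d]
    by (simp add: Poly_one_const[of d])
qed

lemma Poly_sgn_ins: "cring.sgn_ins (Poly d) j S = indexed_const (sgn_ins j S)"
proof -
  interpret P: cring "Poly d" by (rule Poly_cring)
  have "\<ominus>\<^bsub>Poly d\<^esub> \<one>\<^bsub>Poly d\<^esub> = indexed_const (\<ominus> \<one>)"
    by (subst Poly_uminus[OF P.one_closed]) (auto simp: Poly_one indexed_const_def)
  then show ?thesis
    by (simp add: P.sgn_ins_def sgn_ins_def Poly_one_const[of d]) (simp add: Poly_zero indexed_const_def)
qed

text \<open>
  Coefficients of monomials are needed because the contraction of the Koszul complex below is
  linear over the ground ring but not over the polynomial ring.
\<close>

lemma koszul_coeff: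
  assumes x: "\<And>T. x T \<in> carrier (Poly d)"
  shows "cring.koszul (Poly d) indet d x S m =
    (\<Oplus>j\<in>{..<d}. if j \<in># m then sgn_ins j S \<otimes> x (insert j S) (m - {#j#}) else \<zero>)"
proof -
  interpret P: cring "Poly d" by (rule Poly_cring)
  have term_eq: "(indet j \<otimes>\<^bsub>Poly d\<^esub> P.sgn_ins j S) \<otimes>\<^bsub>Poly d\<^esub> x (insert j S)
      = indexed_pmult (\<lambda>m. sgn_ins j S \<otimes> x (insert j S) m) j" if "j < d" for j
  proof -
    have "(indet j \<otimes>\<^bsub>Poly d\<^esub> P.sgn_ins j S) \<otimes>\<^bsub>Poly d\<^esub> x (insert j S)
        = indet j \<otimes>\<^bsub>Poly d\<^esub> (P.sgn_ins j S \<otimes>\<^bsub>Poly d\<^esub> x (insert j S))"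
      using x indet_closed[OF that] by (simp add: P.m_assoc)
    also have "\<dots> = indexed_pmult (P.sgn_ins j S \<otimes>\<^bsub>Poly d\<^esub> x (insert j S)) j"
      using x by (intro indet_mult) simp
    finally show ?thesis using x by (simp add: Poly_sgn_ins Poly_const_mult)
  qed
  have term_coeff: "((indet j \<otimes>\<^bsub>Poly d\<^esub> P.sgn_ins j S) \<otimes>\<^bsub>Poly d\<^esub> x (insert j S)) m
      = (if j \<in># m then sgn_ins j S \<otimes> x (insert j S) (m - {#j#}) else \<zero>)" if "j < d" for j
    unfolding term_eq[OF that] by (simp add: indexed_pmult_def)
  have "P.koszul indet d x S m
      = (\<Oplus>j\<in>{..<d}. ((indet j \<otimes>\<^bsub>Poly d\<^esub> P.sgn_ins j S) \<otimes>\<^bsub>Poly d\<^esub> x (insert j S)) m)"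
    unfolding P.koszul_def using x indet_closed by (intro Poly_finsum_coeff) auto
  also have "\<dots> = (\<Oplus>j\<in>{..<d}. if j \<in># m then sgn_ins j S \<otimes> x (insert j S) (m - {#j#}) else \<zero>)"
    using Poly_coeff[OF x] by (intro finsum_cong') (auto simp: term_coeff)
  finally show ?thesis .
qed

text \<open>
  In terms of the basis vectors \<open>m e\<^sub>S\<close>: if the smallest index \<open>i\<close> occurring in \<open>m\<close> or \<open>S\<close> is
  not in \<open>S\<close>, then \<open>m e\<^sub>S\<close> is sent to \<open>(m / t\<^sub>i) e\<^sub>T\<close> with \<open>T = insert i S\<close>, and otherwise to
  zero. No sign occurs because \<open>i\<close> is smallest.
\<close>

definition koszul_htpy :: "(nat set \<Rightarrow> 'a npoly) \<Rightarrow> nat set \<Rightarrow> 'a npoly" where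
  "koszul_htpy x S m =
    (if S \<noteq> {} \<and> (\<forall>k\<in>#m. Min S \<le> k) then x (S - {Min S}) (add_mset (Min S) m) else \<zero>)"

lemma koszul_htpy_closed:
  assumes x: "x \<in> carrier (fun_module (Poly d) (Pow {..<d}))"
  shows "koszul_htpy x \<in> carrier (fun_module (Poly d) (Pow {..<d}))"
proof -
  have xP: "x T \<in> carrier (Poly d)" for T using x by (rule fun_moduleD)
  have "koszul_htpy x S \<in> carrier (Poly d)" for S
  proof -
    let ?Q = "x (S - {Min S})"
    have "finite (add_mset (Min S) -` {m. ?Q m \<noteq> \<zero>})"
      using xP[of "S - {Min S}"] by (intro finite_vimageI) (auto simp: Poly_carrier inj_on_def)
    then have "finite {m. koszul_htpy x S m \<noteq> \<zero>}"
      by (rule rev_finite_subset) (auto simp: koszul_htpy_def split: if_splits)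
    moreover have "set_mset m \<subseteq> {..<d}" if "koszul_htpy x S m \<noteq> \<zero>" for m
    proof -
      have "?Q (add_mset (Min S) m) \<noteq> \<zero>" using that by (auto simp: koszul_htpy_def split: if_splits)
      then have "set_mset (add_mset (Min S) m) \<subseteq> {..<d}" using xP[of "S - {Min S}"] unfolding Poly_carrier by blast
      then show ?thesis by simp
    qed
    ultimately show ?thesis using Poly_coeff[OF xP] by (simp add: Poly_carrier) (simp add: koszul_htpy_def)
  qed
  moreover have "koszul_htpy x S = \<zero>\<^bsub>Poly d\<^esub>" if S: "S \<notin> Pow {..<d}" for S
  proof
    fix m
    have "x (S - {Min S}) (add_mset (Min S) m) = \<zero>" if "S \<noteq> {}"
    proof (rule ccontr)
      assume nz: "x (S - {Min S}) (add_mset (Min S) m) \<noteq> \<zero>"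
      then have "x (S - {Min S}) \<noteq> \<zero>\<^bsub>Poly d\<^esub>" by (auto simp: Poly_zero)
      then have "S - {Min S} \<in> Pow {..<d}" using fun_module_outside[OF x, of "S - {Min S}"] by blast
      moreover have "insert (Min S) (set_mset m) \<subseteq> {..<d}"
        using set_mset_add_mset_insert[of "Min S" m] nz xP[of "S - {Min S}"] unfolding Poly_carrier by blast
      ultimately show False using S by auto
    qed
    then show "koszul_htpy x S m = \<zero>\<^bsub>Poly d\<^esub> m" by (simp add: koszul_htpy_def Poly_zero)
  qed
  ultimately show ?thesis by (simp add: fun_module_carrier)
qed

text \<open>
  The operator \<open>koszul_htpy\<close> contracts the Koszul complex onto the constants in exterior
  degree zero. Let \<open>i\<close> be the smallest index of \<open>m\<close> and \<open>S\<close>. If \<open>i\<close> is in \<open>S\<close>, the summands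
  for \<open>j \<noteq> i\<close> cancel in pairs, since inserting \<open>i\<close> below \<open>j\<close> changes the sign; otherwise they
  all vanish. In both cases the summand for \<open>i\<close> remains.
\<close>

lemma koszul_contraction:
  assumes x: "x \<in> carrier (fun_module (Poly d) (Pow {..<d}))" and S: "S \<subseteq> {..<d}"
  shows "cring.koszul (Poly d) indet d (koszul_htpy x) S m \<oplus> koszul_htpy (cring.koszul (Poly d) indet d x) S m
    = (if S = {} \<and> m = {#} then \<zero> else x S m)"
proof -
  interpret P: cring "Poly d" by (rule Poly_cring)
  let ?\<kappa> = "P.koszul indet d" and ?\<eta> = koszul_htpy
  have xP: "x T \<in> carrier (Poly d)" for T using x by (rule fun_moduleD)
  have \<eta>P: "?\<eta> x T \<in> carrier (Poly d)" for T using koszul_htpy_closed[OF x] by (rule fun_moduleD)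
  note xR [simp] = Poly_coeff[OF xP] and \<eta>R [simp] = Poly_coeff[OF \<eta>P]
  have fin: "finite S" using S by (rule finite_subset) simp
  let ?a = "\<lambda>j. if j \<in># m then sgn_ins j S \<otimes> ?\<eta> x (insert j S) (m - {#j#}) else \<zero>"
  have left: "?\<kappa> (?\<eta> x) S m = (\<Oplus>j\<in>{..<d}. ?a j)" by (rule koszul_coeff[OF \<eta>P])
  have a_cl: "?a j \<in> carrier R" for j by simp
  show ?thesis
  proof (cases "S = {} \<and> m = {#}")
    case True
    then have "?a j = \<zero>" for j by simp
    then have "?\<kappa> (?\<eta> x) S m = \<zero>" by (simp only: left finsum_zero)
    then show ?thesis using True by (simp add: koszul_htpy_def)
  next
    case False
    define i where "i = Min (S \<union> set_mset m)"
    have ne: "S \<union> set_mset m \<noteq> {}" using False by auto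
    have i_in: "i \<in> S \<union> set_mset m" unfolding i_def using fin ne by (intro Min_in) auto
    have i_le: "i \<le> k" if "k \<in> S \<union> set_mset m" for k unfolding i_def using fin that by (intro Min_le) auto
    have Min_i: "Min T = i" if "finite T" "i \<in> T" "T \<subseteq> S \<union> set_mset m" for T
      using that i_le by (intro Min_eqI) auto
    show ?thesis
    proof (cases "i \<in> S")
      case True
      have MinS: "Min S = i" using fin True by (intro Min_i) auto
      have sgn_i: "sgn_ins i (S - {i}) = \<one>"
      proof -
        have none: "{k \<in> S - {i}. k < i} = {}" using i_le by force
        show ?thesis unfolding sgn_ins_def none by simp
      qed
      let ?b = "\<lambda>j. if j \<in># add_mset i m then sgn_ins j (S - {i}) \<otimes> x (insert j (S - {i})) (add_mset i m - {#j#}) else \<zero>"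
      have "?\<eta> (?\<kappa> x) S m = ?\<kappa> x (S - {i}) (add_mset i m)"
        using True i_le by (auto simp: koszul_htpy_def MinS)
      also have "\<dots> = (\<Oplus>j\<in>{..<d}. ?b j)" by (rule koszul_coeff[OF xP])
      finally have right: "?\<eta> (?\<kappa> x) S m = (\<Oplus>j\<in>{..<d}. ?b j)" .
      have ab: "?a j \<oplus> ?b j = (if j = i then x S m else \<zero>)" for j
      proof (cases "j = i")
        case ji: True
        have "sgn_ins i S = \<zero>" using True by (simp add: sgn_ins_def)
        then have "?a i = \<zero>" by simp
        moreover have "?b i = x S m" using True by (simp add: sgn_i insert_absorb)
        ultimately have "?a i \<oplus> ?b i = x S m" by (simp only: l_zero xR)
        then show ?thesis by (simp only: ji if_True refl)
      next
        case ji: False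
        show ?thesis
        proof (cases "j \<in># m")
          case jm: True
          show ?thesis
          proof (cases "j \<in> S")
            case jS: True
            then show ?thesis using ji jm by (simp add: sgn_ins_def)
          next
            case jS: False
            have lt: "i < j" using i_le[of j] jm ji by auto
            have S_eq: "insert i (S - {i}) = S" using True by auto
            have sgn_j: "sgn_ins j S = \<ominus> sgn_ins j (S - {i})"
              using sgn_ins_insert_less[OF lt, of "S - {i}"] unfolding S_eq by simp
            have Min_j: "Min (insert j S) = i" using fin True jm by (intro Min_i) auto
            have "?\<eta> x (insert j S) (m - {#j#}) = x (insert j S - {i}) (add_mset i (m - {#j#}))"
              using i_le by (auto simp: koszul_htpy_def Min_j dest: in_diffD)
            moreover have "insert j S - {i} = insert j (S - {i})" using ji by auto
            moreover have "add_mset i m - {#j#} = add_mset i (m - {#j#})"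
              using jm by (simp add: diff_union_single_conv)
            ultimately show ?thesis
              using ji jm by (simp add: sgn_j l_minus l_neg)
          qed
        next
          case False
          then show ?thesis using ji by simp
        qed
      qed
      have b_cl: "?b j \<in> carrier R" for j by simp
      have "(\<Oplus>j\<in>{..<d}. ?a j) \<oplus> (\<Oplus>j\<in>{..<d}. ?b j) = (\<Oplus>j\<in>{..<d}. ?a j \<oplus> ?b j)"
        using a_cl b_cl by (intro finsum_addf[symmetric]) auto
      also have "\<dots> = x S m"
        unfolding ab using True S by (intro finsum_delta) auto
      finally show ?thesis unfolding left right if_not_P[OF False] .
    next
      case iS: False
      then have im: "i \<in># m" using i_in by auto
      have "?\<eta> (?\<kappa> x) S m = \<zero>"
      proof (cases "S = {}")
        case False
        then have "Min S \<in> S" using fin by simp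
        then have "i < Min S" using i_le[of "Min S"] iS by (cases "i = Min S") auto
        then have "\<not> (\<forall>k\<in>#m. Min S \<le> k)" using im by (meson not_le)
        then show ?thesis by (auto simp: koszul_htpy_def)
      qed (simp add: koszul_htpy_def)
      moreover have "(\<Oplus>j\<in>{..<d}. ?a j) = x S m"
      proof (cases "i < d")
        case True
        have sgn_i: "sgn_ins i S = \<one>"
        proof -
          have none: "{k \<in> S. k < i} = {}" using i_le by force
          show ?thesis unfolding sgn_ins_def none using iS by simp
        qed
        have "?a j = (if j = i then x S m else \<zero>)" for j
        proof (cases "j = i")
          case ji: True
          have "Min (insert i S) = i" using fin im by (intro Min_i) auto
          then have "?\<eta> x (insert i S) (m - {#i#}) = x S m"
            using i_le im iS by (auto simp: koszul_htpy_def dest: in_diffD)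
          then show ?thesis using ji im by (simp add: sgn_i)
        next
          case ji: False
          have "?\<eta> x (insert j S) (m - {#j#}) = \<zero>" if jm: "j \<in># m"
          proof -
            have "Min (insert j S) \<in> insert j S" using fin by (intro Min_in) auto
            then have "i < Min (insert j S)"
              using i_le[of "Min (insert j S)"] iS ji jm by (cases "i = Min (insert j S)") auto
            moreover have "i \<in># m - {#j#}" using im ji by (simp add: in_diff_count)
            ultimately have "\<not> (\<forall>k\<in>#m - {#j#}. Min (insert j S) \<le> k)" by (meson not_le)
            then show ?thesis by (auto simp: koszul_htpy_def)
          qed
          then show ?thesis using ji by simp
        qed
        then show ?thesis using True by (simp add: finsum_delta)
      next
        case False
        have "j \<notin># m" if "j < d" for j using i_le[of j] that False by auto
        then have "(\<Oplus>j\<in>{..<d}. ?a j) = (\<Oplus>j\<in>{..<d}. \<zero>)" by (intro finsum_cong') auto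
        moreover have "x S m = \<zero>"
        proof (rule ccontr)
          assume "x S m \<noteq> \<zero>"
          then have "set_mset m \<subseteq> {..<d}" using xP[of S] unfolding Poly_carrier by blast
          then show False using im False by auto
        qed
        ultimately show ?thesis by simp
      qed
      ultimately show ?thesis unfolding left if_not_P[OF False] by (simp only: r_zero xR)
    qed
  qed
qed

end

section \<open>The small semifree module\<close>

text \<open>
  The basis vector \<open>e\<^sub>S\<close> has degree \<open>card S\<close> in the first summand. Since the contraction
  lowers the size by two and the differential raises the degree by one, the second summand is
  shifted by three. The level drops by one under the differential, which forces a shift by one
  in the second summand.
\<close>

definition upper_degree :: "nat \<Rightarrow> int" where
  "upper_degree n = int (card (set_decode (n div 2))) + (if even n then 0 else 3)"

definition level :: "nat \<Rightarrow> nat" where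
  "level n = card (set_decode (n div 2)) + (if even n then 0 else 1)"

lemma (in koszul_cone) sizewise_iff:
  "sizewise B B' z \<longleftrightarrow> (\<forall>n\<in>ix. z n \<in> (if even n then B else B') (card (set_decode (n div 2))))"
proof
  assume z: "sizewise B B' z"
  show "\<forall>n\<in>ix. z n \<in> (if even n then B else B') (card (set_decode (n div 2)))"
  proof
    fix n assume "n \<in> ix"
    then have S: "set_decode (n div 2) \<subseteq> {..<d}" by (simp add: ix_def)
    then have "xp z (set_decode (n div 2)) \<in> B (card (set_decode (n div 2)))"
      "yp z (set_decode (n div 2)) \<in> B' (card (set_decode (n div 2)))"
      using z by (auto simp: sizewise_def)
    moreover have "even n \<Longrightarrow> 2 * (n div 2) = n" "odd n \<Longrightarrow> Suc (2 * (n div 2)) = n" by simp_all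
    ultimately show "z n \<in> (if even n then B else B') (card (set_decode (n div 2)))"
      using S by (cases "even n") (simp_all add: xp_def yp_def)
  qed
next
  assume z: "\<forall>n\<in>ix. z n \<in> (if even n then B else B') (card (set_decode (n div 2)))"
  show "sizewise B B' z"
    unfolding sizewise_def
  proof (intro allI impI)
    fix S assume S: "S \<subseteq> {..<d}"
    then have "2 * set_encode S \<in> ix" "Suc (2 * set_encode S) \<in> ix" by (simp_all add: ix_def set_encode_inv)
    from z[rule_format, OF this(1)] z[rule_format, OF this(2)]
    show "xp z S \<in> B (card S) \<and> yp z S \<in> B' (card S)"
      using S by (simp add: xp_def yp_def set_encode_inv)
  qed
qed

lemma (in cring) linear_map_comp:
  "linear_map R L M S \<Longrightarrow> linear_map R M N T \<Longrightarrow> linear_map R L N (\<lambda>x. T (S x))"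
  unfolding linear_map_def hom_def by (auto simp: Pi_def)

lemma (in cring) linear_map_diff:
  assumes "linear_map R (fun_module R I) (fun_module R J) S" "linear_map R (fun_module R I) (fun_module R J) T"
  shows "linear_map R (fun_module R I) (fun_module R J) (\<lambda>f i. S f i \<ominus> T f i)"
proof (rule linear_mapI)
  fix f assume f: "f \<in> carrier (fun_module R I)"
  note cl = linear_map_closed[OF assms(1) f] linear_map_closed[OF assms(2) f]
  show "(\<lambda>i. S f i \<ominus> T f i) \<in> carrier (fun_module R J)"
    using cl by (simp add: fun_module_carrier a_minus_def)
  note clR = cl[THEN fun_moduleD]
  fix i
  show "S (\<lambda>i. a \<otimes> f i) i \<ominus> T (\<lambda>i. a \<otimes> f i) i = a \<otimes> (S f i \<ominus> T f i)" if "a \<in> carrier R" for a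
    using that clR by (simp add: linear_map_smult[OF assms(1) that f] linear_map_smult[OF assms(2) that f]
        a_minus_def r_distr r_minus)
  fix g assume g: "g \<in> carrier (fun_module R I)"
  note clS = linear_map_closed[OF assms(1) g, THEN fun_moduleD] linear_map_closed[OF assms(2) g, THEN fun_moduleD]
  have "(a \<oplus> a') \<ominus> (b \<oplus> b') = (a \<ominus> b) \<oplus> (a' \<ominus> b')"
    if "a \<in> carrier R" "b \<in> carrier R" "a' \<in> carrier R" "b' \<in> carrier R" for a b a' b'
    using that by algebra
  then show "S (\<lambda>i. f i \<oplus> g i) i \<ominus> T (\<lambda>i. f i \<oplus> g i) i = (S f i \<ominus> T f i) \<oplus> (S g i \<ominus> T g i)"
    using clR clS by (simp add: linear_map_add[OF assms(1) f g] linear_map_add[OF assms(2) f g])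
qed

locale koszul_example = field +
  fixes half :: 'a and d :: nat
  assumes half_closed: "half \<in> carrier R" and half_half: "half \<oplus> half = \<one>" and d_ge_8: "8 \<le> d"
begin

lemma koszul_cone: "koszul_cone (Poly d) (indexed_const half) indet d"
proof -
  interpret P: cring "Poly d" by (rule Poly_cring)
  show ?thesis
    by unfold_locales
      (use half_closed half_half d_ge_8 in
        \<open>simp_all add: Poly_const indet_closed Poly_add Poly_one fun_eq_iff\<close>, simp add: indexed_const_def)
qed

sublocale P: koszul_cone "Poly d" "indexed_const half" indet d by (rule koszul_cone)

sublocale N: partial_contraction P.C P.cone_diff P.cone_htpy P.cut by (rule P.cone_partial_contraction)

abbreviation A :: "int \<Rightarrow> 'a npoly set" where "A \<equiv> mpoly_grading R d"

lemma A_half: "a \<in> A j \<Longrightarrow> indexed_const half \<otimes>\<^bsub>Poly d\<^esub> a \<in> A j"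
  using Poly_grading_mult[OF Poly_grading_const[OF half_closed], of a d j] by simp

lemma A_indet: "j < d \<Longrightarrow> a \<in> A i \<Longrightarrow> indet j \<otimes>\<^bsub>Poly d\<^esub> a \<in> A (i + 2)"
proof -
  assume j: "j < d" and a: "a \<in> A i"
  have "indet j \<in> A 2"
    using indet_closed[OF j] by (auto simp: Poly_grading)
      (auto simp: indexed_pmult_def indexed_const_def split: if_splits dest!: multi_member_split)
  then show ?thesis using Poly_grading_mult[OF _ a, of "indet j" 2] by (simp add: add.commute)
qed

definition homog :: "int \<Rightarrow> (nat \<Rightarrow> 'a npoly) \<Rightarrow> bool" where
  "homog j z \<longleftrightarrow> z \<in> carrier P.C \<and> P.sizewise (\<lambda>n. A (j - int n)) (\<lambda>n. A (j - int n - 3)) z"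

lemma homog_iff:
  "homog j z \<longleftrightarrow> z \<in> carrier P.C \<and> (\<forall>n\<in>P.ix. z n \<in> A (j - upper_degree n))"
  unfolding homog_def P.sizewise_iff upper_degree_def by (auto simp: algebra_simps)

lemma homog_diff:
  assumes z: "homog j z" shows "homog (j + 1) (P.cone_diff z)"
proof -
  have zC: "z \<in> carrier P.C" and zt: "P.sizewise (\<lambda>n. A (j - int n)) (\<lambda>n. A (j - int n - 3)) z"
    using z by (auto simp: homog_def)
  have 1: "indet i \<otimes>\<^bsub>Poly d\<^esub> a \<in> A (j + 1 - int n)" if "i < d" "a \<in> A (j - int (Suc n))" for i n a
    using A_indet[OF that] by (simp add: algebra_simps)
  have 2: "indet i \<otimes>\<^bsub>Poly d\<^esub> a \<in> A (j + 1 - int n - 3)" if "i < d" "a \<in> A (j - int (Suc n) - 3)" for i n a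
    using A_indet[OF that] by (simp add: algebra_simps)
  have "j - int (Suc (Suc n)) = j + 1 - int n - 3" for n by simp
  then have 3: "A (j - int (Suc (Suc n))) \<subseteq> A (j + 1 - int n - 3)" for n by (simp only: order_refl)
  have "P.sizewise (\<lambda>n. A (j + 1 - int n)) (\<lambda>n. A (j + 1 - int n - 3)) (P.cone_diff z)"
    by (rule P.cone_diff_sizewise[OF zC zt Poly_grading_additive Poly_grading_additive]; (rule 1 2 3; assumption)?)
  then show ?thesis using zC P.linear_map_closed[OF P.cone_diff_linear] by (simp add: homog_def)
qed

lemma homog_htpy:
  assumes z: "homog j z" shows "homog (j - 1) (P.cone_htpy z)"
proof -
  have zC: "z \<in> carrier P.C" and zt: "P.sizewise (\<lambda>n. A (j - int n)) (\<lambda>n. A (j - int n - 3)) z"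
    using z by (auto simp: homog_def)
  have "j - int n - 3 = j - 1 - int (Suc (Suc n))" for n by simp
  then have 1: "A (j - int n - 3) \<subseteq> A (j - 1 - int (Suc (Suc n)))" for n by (simp only: order_refl)
  have "P.sizewise (\<lambda>n. A (j - 1 - int n)) (\<lambda>n. A (j - 1 - int n - 3)) (P.cone_htpy z)"
    by (rule P.cone_htpy_sizewise[OF zC zt Poly_grading_additive Poly_grading_additive A_half 1])
  then show ?thesis using zC P.linear_map_closed[OF P.cone_htpy_linear] by (simp add: homog_def)
qed

lemma homog_minus: "homog j z \<Longrightarrow> homog j z' \<Longrightarrow> homog j (z \<ominus>\<^bsub>P.C\<^esub> z')"
proof -
  assume z: "homog j z" "homog j z'"
  interpret A: additive_subgroup "A i" "Poly d" for i by (rule Poly_grading_additive)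
  have "z \<ominus>\<^bsub>P.C\<^esub> z' \<in> carrier P.C" using z by (intro N.minus_closed) (auto simp: homog_def)
  then show ?thesis
    using z by (auto simp: homog_iff P.fun_module_minus a_minus_def[of "Poly d"])
qed

lemma homog_cut: "homog j z \<Longrightarrow> homog j (P.cut z)"
proof -
  assume z: "homog j z"
  interpret A: additive_subgroup "A i" "Poly d" for i by (rule Poly_grading_additive)
  show ?thesis
    using z P.linear_map_closed[OF P.cut_linear] by (auto simp: homog_iff) (auto simp: P.cut_def)
qed

lemma homog_lift: "homog j z \<Longrightarrow> homog j (N.lift z)"
  unfolding N.lift_def using homog_htpy[OF homog_diff, of j z] by (intro homog_minus) simp_all

lemma homog_small_diff: "homog j z \<Longrightarrow> homog (j + 1) (N.small_diff z)"
  unfolding N.small_diff_def by (intro homog_cut homog_diff homog_lift)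

lemma homog_proj: "homog j z \<Longrightarrow> homog j (N.proj z)"
  unfolding N.proj_def
  using homog_htpy[OF homog_diff, of j z] homog_diff[OF homog_htpy, of j z]
  by (intro homog_minus) simp_all

definition bounded :: "int \<Rightarrow> (nat \<Rightarrow> 'a npoly) \<Rightarrow> bool" where
  "bounded l z \<longleftrightarrow> z \<in> carrier P.C \<and>
    P.sizewise (\<lambda>n. if int n \<le> l then carrier (Poly d) else {\<zero>\<^bsub>Poly d\<^esub>})
      (\<lambda>n. if int n + 1 \<le> l then carrier (Poly d) else {\<zero>\<^bsub>Poly d\<^esub>}) z"

lemma bounded_iff:
  "bounded l z \<longleftrightarrow> z \<in> carrier P.C \<and> (\<forall>n. l < int (level n) \<longrightarrow> z n = \<zero>\<^bsub>Poly d\<^esub>)"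
proof -
  have "P.sizewise (\<lambda>n. if int n \<le> l then carrier (Poly d) else {\<zero>\<^bsub>Poly d\<^esub>})
      (\<lambda>n. if int n + 1 \<le> l then carrier (Poly d) else {\<zero>\<^bsub>Poly d\<^esub>}) z
    \<longleftrightarrow> (\<forall>n. l < int (level n) \<longrightarrow> z n = \<zero>\<^bsub>Poly d\<^esub>)" if z: "z \<in> carrier P.C"
  proof -
    have "z n \<in> (if even n then (\<lambda>n. if int n \<le> l then carrier (Poly d) else {\<zero>\<^bsub>Poly d\<^esub>})
        else (\<lambda>n. if int n + 1 \<le> l then carrier (Poly d) else {\<zero>\<^bsub>Poly d\<^esub>})) (card (set_decode (n div 2)))
      \<longleftrightarrow> (l < int (level n) \<longrightarrow> z n = \<zero>\<^bsub>Poly d\<^esub>)" for n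
      using fun_moduleD[OF z, of n] by (auto simp: level_def)
    then show ?thesis unfolding P.sizewise_iff using fun_module_outside[OF z] by blast
  qed
  then show ?thesis unfolding bounded_def by blast
qed

lemma level_subgroup: "additive_subgroup (if b then carrier (Poly d) else {\<zero>\<^bsub>Poly d\<^esub>}) (Poly d)"
  by (cases b) (auto intro!: additive_subgroupI P.add.subgroup_self P.add.triv_subgroup)

lemma bounded_diff: "bounded l z \<Longrightarrow> bounded (l - 1) (P.cone_diff z)"
proof -
  assume z: "bounded l z"
  have "P.sizewise (\<lambda>n. if int n \<le> l - 1 then carrier (Poly d) else {\<zero>\<^bsub>Poly d\<^esub>})
      (\<lambda>n. if int n + 1 \<le> l - 1 then carrier (Poly d) else {\<zero>\<^bsub>Poly d\<^esub>}) (P.cone_diff z)"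
    by (rule P.cone_diff_sizewise[OF _ _ level_subgroup level_subgroup])
      (use z indet_closed in \<open>auto simp: bounded_def split: if_splits\<close>)
  then show ?thesis using z P.linear_map_closed[OF P.cone_diff_linear] by (simp add: bounded_def)
qed

lemma bounded_htpy: "bounded l z \<Longrightarrow> bounded (l + 1) (P.cone_htpy z)"
proof -
  assume z: "bounded l z"
  have "P.sizewise (\<lambda>n. if int n \<le> l + 1 then carrier (Poly d) else {\<zero>\<^bsub>Poly d\<^esub>})
      (\<lambda>n. if int n + 1 \<le> l + 1 then carrier (Poly d) else {\<zero>\<^bsub>Poly d\<^esub>}) (P.cone_htpy z)"
    by (rule P.cone_htpy_sizewise[OF _ _ level_subgroup level_subgroup])
      (use z in \<open>auto simp: bounded_def split: if_splits\<close>)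
  then show ?thesis using z P.linear_map_closed[OF P.cone_htpy_linear] by (simp add: bounded_def)
qed

lemma bounded_small_diff: "bounded l z \<Longrightarrow> bounded (l - 1) (N.small_diff z)"
proof -
  assume z: "bounded l z"
  have hD: "bounded l (P.cone_htpy (P.cone_diff z))" using bounded_htpy[OF bounded_diff[OF z]] by simp
  have "N.lift z \<in> carrier P.C" using z by (simp add: bounded_def)
  then have "bounded l (N.lift z)"
    using z hD by (auto simp: bounded_iff N.lift_def P.fun_module_minus a_minus_def[of "Poly d"])
  then have b: "bounded (l - 1) (P.cone_diff (N.lift z))" by (rule bounded_diff)
  then show ?thesis
    using P.linear_map_closed[OF P.cut_linear, of "P.cone_diff (N.lift z)"]
    by (auto simp: bounded_iff N.small_diff_def) (auto simp: P.cut_def)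
qed

abbreviation E where "E \<equiv> fun_module (Poly d) P.small_ix"

lemma E_iff: "e \<in> carrier E \<longleftrightarrow> e \<in> carrier P.C \<and> P.cut e = e"
  by (auto simp: fun_module_carrier P.cut_def fun_eq_iff P.small_ix_def)

lemma E_C: "e \<in> carrier E \<Longrightarrow> e \<in> carrier P.C"
  by (simp add: E_iff)

lemma cut_E: "z \<in> carrier P.C \<Longrightarrow> P.cut z \<in> carrier E"
  by (simp add: E_iff P.linear_map_closed[OF P.cut_linear]) (simp add: P.cut_def fun_eq_iff)

lemma lift_linear: "linear_map (Poly d) E P.C N.lift"
proof -
  have id: "linear_map (Poly d) E P.C (\<lambda>e. e)"
    by (auto simp: linear_map_def hom_def E_iff)
  have "linear_map (Poly d) E P.C (\<lambda>e n. e n \<ominus>\<^bsub>Poly d\<^esub> P.cone_htpy (P.cone_diff e) n)"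
    by (intro P.linear_map_diff P.linear_map_comp[OF P.linear_map_comp[OF id P.cone_diff_linear] P.cone_htpy_linear] id)
  moreover have "N.lift e = (\<lambda>n. e n \<ominus>\<^bsub>Poly d\<^esub> P.cone_htpy (P.cone_diff e) n)" if "e \<in> carrier E" for e
    using E_C[OF that] unfolding N.lift_def by (intro P.fun_module_minus) simp_all
  ultimately show ?thesis
    by (auto simp: linear_map_def hom_def P.fun_module_module module.smult_closed[OF P.fun_module_module] Pi_def
        abelian_monoid.a_closed[OF abelian_group.axioms(1)[OF module.axioms(2)[OF P.fun_module_module]], simplified]
        module.smult_closed[OF P.fun_module_module, simplified])
qed

lemma small_diff_linear: "linear_map (Poly d) E E N.small_diff"
proof -
  have "linear_map (Poly d) E P.C N.small_diff"
    unfolding N.small_diff_def[abs_def]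
    by (intro P.linear_map_comp[OF P.linear_map_comp[OF lift_linear P.cone_diff_linear] P.cut_linear])
  then show ?thesis by (auto simp: linear_map_def hom_def N.small_diff_def E_C cut_E)
qed

abbreviation G where "G \<equiv> free_dg_module R d P.small_ix upper_degree N.small_diff"

lemma G_gr: "e \<in> gr G j \<longleftrightarrow> e \<in> carrier E \<and> homog j e"
proof -
  have "(\<forall>n\<in>P.small_ix. e n \<in> A (j - upper_degree n)) \<longleftrightarrow> (\<forall>n\<in>P.ix. e n \<in> A (j - upper_degree n))"
    if e: "e \<in> carrier E"
  proof
    assume *: "\<forall>n\<in>P.small_ix. e n \<in> A (j - upper_degree n)"
    show "\<forall>n\<in>P.ix. e n \<in> A (j - upper_degree n)"
    proof
      fix n
      have "\<zero>\<^bsub>Poly d\<^esub> \<in> A (j - upper_degree n)"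
        by (rule additive_subgroup.zero_closed[OF Poly_grading_additive])
      then show "e n \<in> A (j - upper_degree n)"
        using * fun_module_outside[OF e, of n] by (cases "n \<in> P.small_ix") auto
    qed
  qed (auto simp: P.small_ix_def)
  then show ?thesis unfolding free_dg_module_simps homog_iff mem_Collect_eq using E_C[of e] by argo
qed

lemma small_diff_gr_and_square:
  "\<And>j f. f \<in> gr G j \<Longrightarrow> N.small_diff f \<in> gr G (j + 1)"
  "\<And>f. f \<in> carrier E \<Longrightarrow> N.small_diff (N.small_diff f) = (\<lambda>i. \<zero>\<^bsub>Poly d\<^esub>)"
  unfolding G_gr using homog_small_diff P.linear_map_closed[OF small_diff_linear] N.small_diff_small_diff
  by (auto simp: E_iff)

lemma G_semifree: "semifree (Poly d) A G"
proof (rule free_dg_module_semifree[where lev = level, OF one_not_zero P.card_small_ix(2) small_diff_linear small_diff_gr_and_square])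
  fix f l i
  assume "f \<in> carrier E" "\<And>i. l < level i \<Longrightarrow> f i = \<zero>\<^bsub>Poly d\<^esub>" "l \<le> level i"
  then have "bounded (int l) f" by (simp add: bounded_iff E_C)
  then have "bounded (int l - 1) (N.small_diff f)" by (rule bounded_small_diff)
  then show "N.small_diff f i = \<zero>\<^bsub>Poly d\<^esub>" using \<open>l \<le> level i\<close> by (simp add: bounded_iff)
qed

lemma G_dg: "dg_module (Poly d) A G"
  using G_semifree by (simp add: semifree_def)

lemma G_rank: "free_rank (Poly d) G < enat (2 ^ d)"
  using free_dg_module_rank[OF one_not_zero P.card_small_ix(2), of d upper_degree N.small_diff]
    P.card_small_ix(1) by (meson enat_ord_simps(2) order_le_less_trans)

end

context koszul_example
begin

abbreviation \<kappa> where "\<kappa> \<equiv> P.koszul indet d"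
abbreviation \<omega> where "\<omega> \<equiv> P.pair_sum"

lemma koszul_constant_coeff:
  assumes "x \<in> carrier P.L" shows "\<kappa> x S {#} = \<zero>"
  using koszul_coeff[of x d S "{#}"] fun_moduleD[OF assms] by simp

text \<open>
  A cycle of the Koszul complex without constant coefficient is a boundary, with an explicit
  preimage.
\<close>

lemma koszul_exact:
  assumes x: "x \<in> carrier P.L" "\<kappa> x = (\<lambda>S. \<zero>\<^bsub>Poly d\<^esub>)" "x {} {#} = \<zero>"
  shows "\<kappa> (koszul_htpy x) = x"
proof (intro ext)
  fix S m
  have \<eta>: "koszul_htpy x \<in> carrier P.L" using x(1) by (rule koszul_htpy_closed)
  have \<kappa>\<eta>: "\<kappa> (koszul_htpy x) \<in> carrier P.L" using \<eta> by (rule P.linear_map_closed[OF P.\<kappa>_linear])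
  show "\<kappa> (koszul_htpy x) S m = x S m"
  proof (cases "S \<subseteq> {..<d}")
    case True
    have "koszul_htpy (\<lambda>S. \<zero>\<^bsub>Poly d\<^esub>) S m = \<zero>" by (simp add: koszul_htpy_def Poly_zero)
    then have "\<kappa> (koszul_htpy x) S m \<oplus> \<zero> = x S m"
      using koszul_contraction[OF x(1) True, of m] x(2,3) by (simp split: if_splits)
    then show ?thesis using Poly_coeff[OF fun_moduleD[OF \<kappa>\<eta>]] by simp
  next
    case False
    then show ?thesis using fun_module_outside[OF x(1), of S] fun_module_outside[OF \<kappa>\<eta>, of S] by simp
  qed
qed

text \<open>
  The two cohomology classes of the cone are detected by constant coefficients. For a cocycle
  \<open>(x, y)\<close> the first obstruction to being a coboundary is the constant coefficient of \<open>x\<close>. If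
  it vanishes, then \<open>x = \<kappa> x'\<close> for \<open>x' = koszul_htpy x\<close>, and subtracting the coboundary of
  \<open>(x', 0)\<close> leaves the cocycle \<open>(0, y - \<omega> x')\<close>, whose constant coefficient is the second
  obstruction.
\<close>

definition \<Phi>0 :: "(nat \<Rightarrow> 'a npoly) \<Rightarrow> 'a" where
  "\<Phi>0 z = P.xp z {} {#}"

definition \<Phi>3 :: "(nat \<Rightarrow> 'a npoly) \<Rightarrow> 'a" where
  "\<Phi>3 z = P.yp z {} {#} \<ominus> \<omega> (koszul_htpy (P.xp z)) {} {#}"

lemma \<omega>_closed: "x \<in> carrier P.L \<Longrightarrow> \<omega> x \<in> carrier P.L"
  by (rule P.linear_map_closed[OF P.\<omega>_linear])

lemma \<kappa>_closed: "x \<in> carrier P.L \<Longrightarrow> \<kappa> x \<in> carrier P.L"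
  by (rule P.linear_map_closed[OF P.\<kappa>_linear])

lemma coeff_closed: "x \<in> carrier P.L \<Longrightarrow> x S m \<in> carrier R"
  by (rule Poly_coeff[OF fun_moduleD])

lemma \<Phi>_closed:
  assumes "z \<in> carrier P.C" shows "\<Phi>0 z \<in> carrier R" "\<Phi>3 z \<in> carrier R"
  using coeff_closed[OF P.xp_closed[OF assms]] coeff_closed[OF P.yp_closed[OF assms]]
    coeff_closed[OF \<omega>_closed[OF koszul_htpy_closed[OF P.xp_closed[OF assms]]]]
  by (simp_all add: \<Phi>0_def \<Phi>3_def)

lemma koszul_htpy_add:
  "koszul_htpy (\<lambda>S. x S \<oplus>\<^bsub>Poly d\<^esub> y S) = (\<lambda>S. koszul_htpy x S \<oplus>\<^bsub>Poly d\<^esub> koszul_htpy y S)"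
  by (auto simp: fun_eq_iff koszul_htpy_def Poly_add)

lemma koszul_htpy_smult:
  assumes "a \<in> carrier R" "x \<in> carrier P.L"
  shows "koszul_htpy (\<lambda>S. indexed_const a \<otimes>\<^bsub>Poly d\<^esub> x S) = (\<lambda>S. indexed_const a \<otimes>\<^bsub>Poly d\<^esub> koszul_htpy x S)"
  using assms fun_moduleD[OF assms(2)] fun_moduleD[OF koszul_htpy_closed[OF assms(2)]]
  by (auto simp: fun_eq_iff Poly_const_mult) (auto simp: koszul_htpy_def)

lemma \<Phi>_add:
  assumes z: "z \<in> carrier P.C" "z' \<in> carrier P.C"
  shows "\<Phi>0 (\<lambda>n. z n \<oplus>\<^bsub>Poly d\<^esub> z' n) = \<Phi>0 z \<oplus> \<Phi>0 z'" "\<Phi>3 (\<lambda>n. z n \<oplus>\<^bsub>Poly d\<^esub> z' n) = \<Phi>3 z \<oplus> \<Phi>3 z'"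
proof -
  show "\<Phi>0 (\<lambda>n. z n \<oplus>\<^bsub>Poly d\<^esub> z' n) = \<Phi>0 z \<oplus> \<Phi>0 z'"
    by (simp only: \<Phi>0_def P.parts_add) (simp add: Poly_add)
  note x = P.xp_closed[OF z(1)] P.xp_closed[OF z(2)]
  have "(a \<oplus> a') \<ominus> (b \<oplus> b') = (a \<ominus> b) \<oplus> (a' \<ominus> b')"
    if "a \<in> carrier R" "b \<in> carrier R" "a' \<in> carrier R" "b' \<in> carrier R" for a b a' b'
    using that by algebra
  then show "\<Phi>3 (\<lambda>n. z n \<oplus>\<^bsub>Poly d\<^esub> z' n) = \<Phi>3 z \<oplus> \<Phi>3 z'"
    using x[THEN koszul_htpy_closed, THEN \<omega>_closed, THEN coeff_closed]
      P.yp_closed[OF z(1), THEN coeff_closed] P.yp_closed[OF z(2), THEN coeff_closed]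
    by (simp add: \<Phi>3_def P.parts_add koszul_htpy_add
        P.linear_map_add[OF P.\<omega>_linear x(1)[THEN koszul_htpy_closed] x(2)[THEN koszul_htpy_closed]]) (simp add: Poly_add)
qed

lemma \<Phi>_smult:
  assumes a: "a \<in> carrier R" and z: "z \<in> carrier P.C"
  shows "\<Phi>0 (\<lambda>n. indexed_const a \<otimes>\<^bsub>Poly d\<^esub> z n) = a \<otimes> \<Phi>0 z"
    "\<Phi>3 (\<lambda>n. indexed_const a \<otimes>\<^bsub>Poly d\<^esub> z n) = a \<otimes> \<Phi>3 z"
proof -
  note x = P.xp_closed[OF z] and y = P.yp_closed[OF z]
  note wx = x[THEN koszul_htpy_closed, THEN \<omega>_closed]
  show "\<Phi>0 (\<lambda>n. indexed_const a \<otimes>\<^bsub>Poly d\<^esub> z n) = a \<otimes> \<Phi>0 z"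
    using a fun_moduleD[OF x] by (simp add: \<Phi>0_def P.parts_smult Poly_const Poly_const_mult)
  have "a \<otimes> b \<ominus> a \<otimes> c = a \<otimes> (b \<ominus> c)" if "b \<in> carrier R" "c \<in> carrier R" for b c
    using that a by algebra
  then show "\<Phi>3 (\<lambda>n. indexed_const a \<otimes>\<^bsub>Poly d\<^esub> z n) = a \<otimes> \<Phi>3 z"
    using a coeff_closed[OF wx] coeff_closed[OF y] fun_moduleD[OF wx] fun_moduleD[OF y]
    by (simp add: \<Phi>3_def P.parts_smult Poly_const koszul_htpy_smult[OF a x]
        P.linear_map_smult[OF P.\<omega>_linear _ koszul_htpy_closed[OF x]] Poly_const_mult)
qed

text \<open>
  Constant coefficients of Koszul boundaries vanish. For a boundary \<open>(\<kappa> x, \<omega> x - \<kappa> y)\<close> the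
  contraction of the Koszul complex rewrites \<open>\<omega> x\<close> as \<open>\<omega> (koszul_htpy (\<kappa> x))\<close> up to a Koszul
  boundary, because \<open>\<omega>\<close> commutes with \<open>\<kappa>\<close> and does not see the coefficient at the empty set.
\<close>

lemma \<Phi>_boundary:
  assumes z: "z \<in> carrier P.C"
  shows "\<Phi>0 (P.cone_diff z) = \<zero>" "\<Phi>3 (P.cone_diff z) = \<zero>"
proof -
  let ?x = "P.xp z" and ?y = "P.yp z"
  note x = P.xp_closed[OF z] and y = P.yp_closed[OF z]
  show "\<Phi>0 (P.cone_diff z) = \<zero>" by (simp add: \<Phi>0_def P.cone_diff_parts[OF z] koszul_constant_coeff[OF x])
  have \<eta>x: "koszul_htpy ?x \<in> carrier P.L" and \<eta>\<kappa>x: "koszul_htpy (\<kappa> ?x) \<in> carrier P.L"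
    by (intro koszul_htpy_closed x \<kappa>_closed)+
  define v where "v = (\<lambda>S. \<kappa> (koszul_htpy ?x) S \<oplus>\<^bsub>Poly d\<^esub> koszul_htpy (\<kappa> ?x) S)"
  have v: "v S = ?x S" if "S \<subseteq> {..<d}" "S \<noteq> {}" for S
    using koszul_contraction[OF x that(1)] that(2) by (auto simp: v_def Poly_add fun_eq_iff)
  have v_cl: "v S \<in> carrier (Poly d)" for S
    using fun_moduleD[OF \<kappa>_closed[OF \<eta>x]] fun_moduleD[OF \<eta>\<kappa>x] by (simp add: v_def)
  have a: "\<omega> v {} = \<omega> ?x {}"
    unfolding P.pair_sum_def
  proof (intro P.finsum_cong' refl)
    fix i :: nat assume "i \<in> {..<4}"
    then have "set_pair i True {} \<subseteq> {..<d}" "set_pair i True {} \<noteq> {}" using d_ge_8 by (auto simp: set_pair_True)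
    then show "P.pair_coeff i {} \<otimes>\<^bsub>Poly d\<^esub> v (set_pair i True {}) = P.pair_coeff i {} \<otimes>\<^bsub>Poly d\<^esub> ?x (set_pair i True {})"
      by (simp add: v)
  qed (use fun_moduleD[OF x] in auto)
  have b: "\<omega> v = (\<lambda>S. \<omega> (\<kappa> (koszul_htpy ?x)) S \<oplus>\<^bsub>Poly d\<^esub> \<omega> (koszul_htpy (\<kappa> ?x)) S)"
    unfolding v_def by (rule P.linear_map_add[OF P.\<omega>_linear \<kappa>_closed[OF \<eta>x] \<eta>\<kappa>x])
  have c: "\<omega> (\<kappa> (koszul_htpy ?x)) {} {#} = \<zero>"
  proof -
    have "\<omega> (\<kappa> (koszul_htpy ?x)) {} = \<kappa> (\<omega> (koszul_htpy ?x)) {}"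
      using fun_moduleD[OF \<eta>x] by (intro P.koszul_pair_sum[symmetric] indet_closed)
    then show ?thesis using koszul_constant_coeff[OF \<omega>_closed[OF \<eta>x]] by simp
  qed
  have w: "\<omega> ?x {} {#} = \<omega> (koszul_htpy (\<kappa> ?x)) {} {#}"
    unfolding a[symmetric] b Poly_add c by (rule l_zero) (rule coeff_closed[OF \<omega>_closed[OF \<eta>\<kappa>x]])
  have "(\<omega> ?x {} \<ominus>\<^bsub>Poly d\<^esub> \<kappa> ?y {}) {#} = \<omega> ?x {} {#}"
    using fun_moduleD[OF \<kappa>_closed[OF y]] coeff_closed[OF \<omega>_closed[OF x]] koszul_constant_coeff[OF y]
    by (simp add: a_minus_def Poly_uminus Poly_add)
  then show "\<Phi>3 (P.cone_diff z) = \<zero>"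
    using coeff_closed[OF \<omega>_closed[OF \<eta>\<kappa>x]]
    by (simp add: \<Phi>3_def P.cone_diff_parts[OF z] w)
qed

lemma \<Phi>_exact:
  assumes z: "z \<in> carrier P.C" "P.cone_diff z = (\<lambda>n. \<zero>\<^bsub>Poly d\<^esub>)" and \<Phi>: "\<Phi>0 z = \<zero>" "\<Phi>3 z = \<zero>"
  shows "\<exists>z'\<in>carrier P.C. P.cone_diff z' = z"
proof -
  let ?x = "P.xp z" and ?y = "P.yp z"
  note x = P.xp_closed[OF z(1)] and y = P.yp_closed[OF z(1)]
  have \<kappa>x: "\<kappa> ?x = (\<lambda>S. \<zero>\<^bsub>Poly d\<^esub>)"
    using P.cone_diff_parts(1)[OF z(1)] z(2) by (simp add: P.parts_zero)
  have sub_eq: "\<omega> ?x S \<ominus>\<^bsub>Poly d\<^esub> \<kappa> ?y S = \<zero>\<^bsub>Poly d\<^esub>" for S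
    using P.cone_diff_parts(2)[OF z(1)] z(2) by (simp add: P.parts_zero fun_eq_iff)
  have \<omega>x: "\<omega> ?x = \<kappa> ?y"
    using sub_eq fun_moduleD[OF \<omega>_closed[OF x]] fun_moduleD[OF \<kappa>_closed[OF y]]
    by (intro ext P.r_right_minus_eq[THEN iffD1]) auto
  define x' where "x' = koszul_htpy ?x"
  have x': "x' \<in> carrier P.L" unfolding x'_def by (rule koszul_htpy_closed[OF x])
  have \<kappa>x': "\<kappa> x' = ?x"
    unfolding x'_def using \<Phi>(1) by (intro koszul_exact x \<kappa>x) (simp add: \<Phi>0_def)
  \<comment> \<open>Subtracting the coboundary of \<open>(x', 0)\<close> leaves the cocycle \<open>(0, v)\<close>.\<close>
  define v where "v = (\<lambda>S. ?y S \<ominus>\<^bsub>Poly d\<^esub> \<omega> x' S)"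
  have v: "v \<in> carrier P.L" unfolding v_def by (rule P.L_minus[OF y \<omega>_closed[OF x']])
  have "\<kappa> (\<omega> x') = \<omega> ?x"
    using P.koszul_pair_sum[of d indet x'] fun_moduleD[OF x'] indet_closed by (auto simp: \<kappa>x')
  then have \<kappa>v: "\<kappa> v = (\<lambda>S. \<zero>\<^bsub>Poly d\<^esub>)"
    unfolding v_def P.linear_map_minus[OF P.\<kappa>_linear y \<omega>_closed[OF x']] \<omega>x
    using fun_moduleD[OF \<kappa>_closed[OF y]] by (simp add: a_minus_def P.r_neg)
  have "v {} {#} = \<Phi>3 z"
    using fun_moduleD[OF \<omega>_closed[OF x']] by (simp add: v_def \<Phi>3_def x'_def a_minus_def Poly_add Poly_uminus)
  then have \<kappa>\<eta>v: "\<kappa> (koszul_htpy v) = v" using \<Phi>(2) by (intro koszul_exact v \<kappa>v) simp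
  have \<eta>v: "koszul_htpy v \<in> carrier P.L" by (rule koszul_htpy_closed[OF v])
  define y' where "y' = (\<lambda>S. \<ominus>\<^bsub>Poly d\<^esub> koszul_htpy v S)"
  have y': "y' \<in> carrier P.L" using \<eta>v by (auto simp: y'_def fun_module_carrier)
  have \<kappa>y': "\<kappa> y' = (\<lambda>S. \<ominus>\<^bsub>Poly d\<^esub> v S)"
    unfolding y'_def P.linear_map_uminus[OF P.\<kappa>_linear \<eta>v] \<kappa>\<eta>v ..
  have "\<omega> x' S \<ominus>\<^bsub>Poly d\<^esub> \<kappa> y' S = ?y S" for S
  proof -
    have "\<omega> x' S \<in> carrier (Poly d)" "?y S \<in> carrier (Poly d)" using fun_moduleD[OF \<omega>_closed[OF x']] fun_moduleD[OF y] by auto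
    then show ?thesis unfolding \<kappa>y' v_def by algebra
  qed
  then have "P.cone_diff (P.mk x' y') = z"
    using P.mk_xp_yp[OF z(1)] by (simp add: P.cone_diff_def P.xp_mk[OF x'] P.yp_mk[OF y'] \<kappa>x')
  then show ?thesis using P.mk_closed[OF x' y'] by blast
qed

lemma koszul_htpy_grading:
  assumes x: "x \<in> carrier P.L" "\<And>S. S \<subseteq> {..<d} \<Longrightarrow> x S \<in> A (j - int (card S))" and S: "S \<subseteq> {..<d}"
  shows "koszul_htpy x S \<in> A (j - 1 - int (card S))"
proof -
  have "2 * int (size m) = j - 1 - int (card S)" if nz: "koszul_htpy x S m \<noteq> \<zero>" for m
  proof -
    have ne: "S \<noteq> {}" and nz': "x (S - {Min S}) (add_mset (Min S) m) \<noteq> \<zero>"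
      using nz by (auto simp: koszul_htpy_def split: if_splits)
    have fin: "finite S" using S by (rule finite_subset) simp
    then have "Min S \<in> S" using ne by simp
    then have card: "int (card S) = int (card (S - {Min S})) + 1" using fin
      by (metis card.remove add.commute of_nat_Suc plus_1_eq_Suc)
    have "x (S - {Min S}) \<in> A (j - int (card (S - {Min S})))" using S by (intro x(2)) auto
    then have "2 * int (size (add_mset (Min S) m)) = j - int (card (S - {Min S}))"
      using nz' by (simp only: Poly_grading) blast
    then show ?thesis using card by simp
  qed
  then show ?thesis using fun_moduleD[OF koszul_htpy_closed[OF x(1)]] by (simp add: Poly_grading)
qed

lemma \<Phi>_homog:
  assumes z: "homog j z"
  shows "j \<noteq> 0 \<Longrightarrow> \<Phi>0 z = \<zero>" "j \<noteq> 3 \<Longrightarrow> \<Phi>3 z = \<zero>"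
proof -
  interpret A: additive_subgroup "A i" "Poly d" for i by (rule Poly_grading_additive)
  have zC: "z \<in> carrier P.C" and parts: "\<And>S. S \<subseteq> {..<d} \<Longrightarrow>
      P.xp z S \<in> A (j - int (card S)) \<and> P.yp z S \<in> A (j - int (card S) - 3)"
    using z by (simp_all add: homog_def P.sizewise_def)
  have zx: "P.xp z S \<in> A (j - int (card S))" if "S \<subseteq> {..<d}" for S using parts[OF that] by blast
  have zy: "P.yp z {} \<in> A (j - 3)" using parts[of "{}"] by simp
  have const: "p {#} = \<zero>" if "p \<in> A i" "i \<noteq> 0" for p i
    using that by (auto simp: Poly_grading)
  show "\<Phi>0 z = \<zero>" if "j \<noteq> 0" using const[OF zx[of "{}"]] that by (simp add: \<Phi>0_def)
  show "\<Phi>3 z = \<zero>" if j: "j \<noteq> 3"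
  proof -
    have \<eta>: "koszul_htpy (P.xp z) \<in> carrier P.L" by (rule koszul_htpy_closed[OF P.xp_closed[OF zC]])
    have "\<omega> (koszul_htpy (P.xp z)) {} \<in> A (j - 3)"
    proof (rule P.pair_sum_mem[OF Poly_grading_additive _ fun_moduleD[OF \<eta>]])
      fix i :: nat assume "i < 4"
      then have "set_pair i True {} \<subseteq> {..<d}" "card (set_pair i True {}) = 2" using d_ge_8 by (auto simp: set_pair_True)
      then show "koszul_htpy (P.xp z) (set_pair i True {}) \<in> A (j - 3)"
        using koszul_htpy_grading[OF P.xp_closed[OF zC] zx, of "set_pair i True {}"] by simp
    qed
    then have "\<omega> (koszul_htpy (P.xp z)) {} {#} = \<zero>" by (rule const) (use j in simp)
    moreover have "P.yp z {} {#} = \<zero>" by (rule const[OF zy]) (use j in simp)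
    ultimately show ?thesis by (simp add: \<Phi>3_def a_minus_def)
  qed
qed

text \<open>
  The unit of the exterior algebra. It represents both classes of the cone, once in each
  summand, and the coordinates of these representatives are \<open>0\<close> and \<open>1\<close>, as the empty set has
  code zero.
\<close>

definition \<epsilon> :: "nat set \<Rightarrow> 'a npoly" where
  "\<epsilon> S = (if S = {} then \<one>\<^bsub>Poly d\<^esub> else \<zero>\<^bsub>Poly d\<^esub>)"

lemma \<epsilon>_closed: "\<epsilon> \<in> carrier P.L"
  by (auto simp: \<epsilon>_def fun_module_carrier)

lemma \<kappa>_\<epsilon>: "\<kappa> \<epsilon> = (\<lambda>S. \<zero>\<^bsub>Poly d\<^esub>)"
proof
  fix S
  have "\<kappa> \<epsilon> S = (\<Oplus>\<^bsub>Poly d\<^esub>j\<in>{..<d}. \<zero>\<^bsub>Poly d\<^esub>)"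
    unfolding P.koszul_def by (intro P.finsum_cong') (auto simp: \<epsilon>_def indet_closed)
  then show "\<kappa> \<epsilon> S = \<zero>\<^bsub>Poly d\<^esub>" by simp
qed

lemma \<omega>_\<epsilon>: "\<omega> \<epsilon> = (\<lambda>S. \<zero>\<^bsub>Poly d\<^esub>)"
proof
  fix S
  have "\<omega> \<epsilon> S = (\<Oplus>\<^bsub>Poly d\<^esub>j\<in>{..<4::nat}. \<zero>\<^bsub>Poly d\<^esub>)"
    unfolding P.pair_sum_def by (intro P.finsum_cong') (auto simp: \<epsilon>_def set_pair_True)
  then show "\<omega> \<epsilon> S = \<zero>\<^bsub>Poly d\<^esub>" by simp
qed

lemma set_encode_eq_0: "S \<subseteq> {..<d} \<Longrightarrow> set_encode S = 0 \<longleftrightarrow> S = {}"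
  using P.set_encode_inv[of S] by auto

lemma unit_vec_parts:
  "P.xp (unit_vec d 0) = \<epsilon>" "P.yp (unit_vec d 0) = (\<lambda>S. \<zero>\<^bsub>Poly d\<^esub>)"
  "P.xp (unit_vec d (Suc 0)) = (\<lambda>S. \<zero>\<^bsub>Poly d\<^esub>)" "P.yp (unit_vec d (Suc 0)) = \<epsilon>"
proof -
  have odd: "2 * n \<noteq> (1::nat)" for n by presburger
  show "P.xp (unit_vec d 0) = \<epsilon>" "P.yp (unit_vec d 0) = (\<lambda>S. \<zero>\<^bsub>Poly d\<^esub>)"
    "P.xp (unit_vec d (Suc 0)) = (\<lambda>S. \<zero>\<^bsub>Poly d\<^esub>)" "P.yp (unit_vec d (Suc 0)) = \<epsilon>"
    using odd by (auto simp: fun_eq_iff P.xp_def P.yp_def unit_vec_def \<epsilon>_def set_encode_eq_0)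
qed

lemma unit_vec_C: "unit_vec d 0 \<in> carrier P.C" "unit_vec d (Suc 0) \<in> carrier P.C"
  by (auto simp: fun_module_carrier unit_vec_def P.ix_def)

lemma unit_vec_homog: "homog 0 (unit_vec d 0)" "homog 3 (unit_vec d (Suc 0))"
proof -
  interpret A: additive_subgroup "A i" "Poly d" for i by (rule Poly_grading_additive)
  have "\<one>\<^bsub>Poly d\<^esub> \<in> A 0"
    using Poly_grading_const[of \<one> d] by (simp add: Poly_one_const[of d])
  then show "homog 0 (unit_vec d 0)" "homog 3 (unit_vec d (Suc 0))"
    using unit_vec_C by (auto simp: homog_iff unit_vec_def upper_degree_def)
qed

lemma cone_diff_unit_vec:
  "P.cone_diff (unit_vec d 0) = (\<lambda>n. \<zero>\<^bsub>Poly d\<^esub>)" "P.cone_diff (unit_vec d (Suc 0)) = (\<lambda>n. \<zero>\<^bsub>Poly d\<^esub>)"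
  unfolding P.cone_diff_def unit_vec_parts \<kappa>_\<epsilon> \<omega>_\<epsilon> P.linear_map_zero[OF P.\<kappa>_linear] P.linear_map_zero[OF P.\<omega>_linear]
  by (simp_all add: fun_eq_iff P.mk_def a_minus_def)

lemma koszul_htpy_\<epsilon>: "koszul_htpy \<epsilon> = (\<lambda>S. \<zero>\<^bsub>Poly d\<^esub>)"
  by (auto simp: fun_eq_iff koszul_htpy_def \<epsilon>_def Poly_one Poly_zero)

lemma koszul_htpy_zero: "koszul_htpy (\<lambda>S. \<zero>\<^bsub>Poly d\<^esub>) = (\<lambda>S. \<zero>\<^bsub>Poly d\<^esub>)"
  by (auto simp: fun_eq_iff koszul_htpy_def Poly_zero)

lemma \<Phi>_unit_vec:
  "\<Phi>0 (unit_vec d 0) = \<one>" "\<Phi>3 (unit_vec d 0) = \<zero>" "\<Phi>0 (unit_vec d (Suc 0)) = \<zero>" "\<Phi>3 (unit_vec d (Suc 0)) = \<one>"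
  unfolding \<Phi>0_def \<Phi>3_def unit_vec_parts koszul_htpy_\<epsilon> koszul_htpy_zero P.linear_map_zero[OF P.\<omega>_linear]
  by (simp_all add: \<epsilon>_def Poly_one Poly_zero a_minus_def)

text \<open>
  The representative in the second summand has its only coordinate among the rows that were
  discarded, so it must be projected into the subcomplex first.
\<close>

definition class3 :: "nat \<Rightarrow> 'a npoly" where
  "class3 = P.cut (N.proj (unit_vec d (Suc 0)))"

lemma unit_vec_E: "unit_vec d 0 \<in> carrier E"
proof -
  have "bits {} \<notin> sources" by (simp add: bits_def even_pairs_def upt_rec sources_def)
  then have "0 \<in> P.small_ix" by (simp add: P.small_ix_def P.ix_def)
  then show ?thesis by (auto simp: fun_module_carrier unit_vec_def)
qed

lemma htpy_zero: "P.cone_htpy (\<lambda>n. \<zero>\<^bsub>Poly d\<^esub>) = (\<lambda>n. \<zero>\<^bsub>Poly d\<^esub>)"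
  by (rule P.linear_map_zero[OF P.cone_htpy_linear])

lemma lift_unit_vec: "N.lift (unit_vec d 0) = unit_vec d 0"
  unfolding N.lift_def cone_diff_unit_vec htpy_zero using N.minus_zero_right[OF unit_vec_C(1)] by simp

lemma class3_E: "class3 \<in> carrier E"
  unfolding class3_def using unit_vec_C(2) by (intro cut_E N.proj_closed)

lemma lift_class3: "N.lift class3 = N.proj (unit_vec d (Suc 0))"
  unfolding class3_def using N.proj_kernel[OF unit_vec_C(2)] unit_vec_C(2) by (intro N.lift_\<rho>) simp_all

lemma cone_diff_class3: "P.cone_diff (N.proj (unit_vec d (Suc 0))) = (\<lambda>n. \<zero>\<^bsub>Poly d\<^esub>)"
proof -
  have "P.cone_diff (N.proj (unit_vec d (Suc 0))) = (\<lambda>n. \<zero>\<^bsub>Poly d\<^esub>) \<ominus>\<^bsub>P.C\<^esub> (\<lambda>n. \<zero>\<^bsub>Poly d\<^esub>)"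
    using N.D_proj[OF unit_vec_C(2)]
    unfolding cone_diff_unit_vec htpy_zero P.linear_map_zero[OF P.cone_diff_linear] .
  also have "\<dots> = (\<lambda>n. \<zero>\<^bsub>Poly d\<^esub>)" using N.minus_zero_right[OF N.zero_closed] by simp
  finally show ?thesis .
qed

lemma \<Phi>_class3: "\<Phi>0 (N.lift class3) = \<zero>" "\<Phi>3 (N.lift class3) = \<one>"
proof -
  let ?u = "unit_vec d (Suc 0)" let ?p = "N.proj ?u" and ?b = "P.cone_diff (P.cone_htpy ?u)"
  have p: "?p \<in> carrier P.C" and h: "P.cone_htpy ?u \<in> carrier P.C" and b: "?b \<in> carrier P.C"
    using unit_vec_C(2) by simp_all
  have "?p = ?u \<ominus>\<^bsub>P.C\<^esub> ?b"
    unfolding N.proj_def cone_diff_unit_vec htpy_zero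
    using N.minus_zero_right[of "?u \<ominus>\<^bsub>P.C\<^esub> ?b"] unit_vec_C(2) b by simp
  then have "?u = ?p \<oplus>\<^bsub>P.C\<^esub> ?b"
    using unit_vec_C(2) b by (simp only: a_minus_def N.a_assoc N.l_neg N.a_inv_closed N.r_zero)
  then have eq: "?u = (\<lambda>n. ?p n \<oplus>\<^bsub>Poly d\<^esub> ?b n)" by (simp only: fun_module_simps)
  have "\<Phi>0 ?u = \<Phi>0 ?p \<oplus> \<Phi>0 ?b" "\<Phi>3 ?u = \<Phi>3 ?p \<oplus> \<Phi>3 ?b"
    by (rule trans[OF arg_cong[OF eq, of \<Phi>0] \<Phi>_add(1)[OF p b]], rule trans[OF arg_cong[OF eq, of \<Phi>3] \<Phi>_add(2)[OF p b]])
  then have "\<zero> = \<Phi>0 ?p" "\<one> = \<Phi>3 ?p"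
    unfolding \<Phi>_unit_vec(3,4) \<Phi>_boundary[OF h] r_zero[OF \<Phi>_closed(1)[OF p]] r_zero[OF \<Phi>_closed(2)[OF p]]
    by this
  then show "\<Phi>0 (N.lift class3) = \<zero>" "\<Phi>3 (N.lift class3) = \<one>"
    unfolding lift_class3 by simp_all
qed

theorem G_cohomology:
  shows "module_iso R (cohomology_at R G 0) (regular_module R)"
    and "module_iso R (cohomology_at R G 3) (regular_module R)"
    and "j \<noteq> 0 \<Longrightarrow> j \<noteq> 3 \<Longrightarrow> carrier (cohomology_at R G j) = {\<zero>\<^bsub>cohomology_at R G j\<^esub>}"
    and "\<exists>B. is_basis R (cohomology_vs R G) B \<and> finite B \<and> card B = 2"
proof -
  define f where "f k e = (if k = (0::int) then \<Phi>0 (N.lift e) else \<Phi>3 (N.lift e))" for k e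
  define z where "z k = (if k = (0::int) then unit_vec d 0 else class3)" for k
  have cyc: "e \<in> cocycles G \<longleftrightarrow> e \<in> carrier E \<and> P.cone_diff (N.lift e) = (\<lambda>n. \<zero>\<^bsub>Poly d\<^esub>)" for e
    using N.small_diff_eq_zero_iff[of e] by (auto simp: cocycles_def E_iff)
  have cycC: "N.lift e \<in> carrier P.C" if "e \<in> cocycles G" for e
    using that by (auto simp: cyc E_C)
  have cycE: "e \<in> carrier E" if "e \<in> cocycles G" for e using that by (simp add: cyc)
  have bd: "e \<in> coboundaries G \<longleftrightarrow> (\<forall>k\<in>{0, 3}. f k e = \<zero>)" if e: "e \<in> cocycles G" for e
  proof -
    have "e \<in> coboundaries G \<longleftrightarrow> (\<exists>g\<in>carrier P.C. P.cut g = g \<and> N.small_diff g = e)"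
      by (auto simp: coboundaries_def E_iff)
    also have "\<dots> \<longleftrightarrow> (\<exists>w\<in>carrier P.C. P.cone_diff w = N.lift e)"
      using cycE[OF e] cut_E by (intro N.small_boundary_iff) (auto simp: E_iff)
    also have "\<dots> \<longleftrightarrow> \<Phi>0 (N.lift e) = \<zero> \<and> \<Phi>3 (N.lift e) = \<zero>"
      using \<Phi>_boundary \<Phi>_exact[OF cycC[OF e]] e unfolding cyc by metis
    finally show ?thesis by (simp add: f_def)
  qed
  have z: "z k \<in> gr G k \<inter> cocycles G" if "k \<in> {0, 3}" for k
  proof -
    have "unit_vec d 0 \<in> gr G 0" using unit_vec_E unit_vec_homog by (simp only: G_gr)
    moreover have "class3 \<in> gr G 3"
      using class3_E homog_cut[OF homog_proj[OF unit_vec_homog(2)]] by (simp only: G_gr class3_def)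
    ultimately show ?thesis
      using that unit_vec_E class3_E lift_unit_vec lift_class3 cone_diff_unit_vec(1) cone_diff_class3
      by (auto simp: z_def cyc simp del: free_dg_module_simps)
  qed
  have f_add: "f k (e \<oplus>\<^bsub>G\<^esub> e') = f k e \<oplus> f k e'" if "e \<in> cocycles G" "e' \<in> cocycles G" for k e e'
    using \<Phi>_add[OF cycC[OF that(1)] cycC[OF that(2)]]
    by (simp add: f_def P.linear_map_add[OF lift_linear cycE[OF that(1)] cycE[OF that(2)]])
  have f_smult: "f k (indexed_const a \<odot>\<^bsub>G\<^esub> e) = a \<otimes> f k e" if "a \<in> carrier R" "e \<in> cocycles G" for k a e
    using \<Phi>_smult[OF that(1) cycC[OF that(2)]]
    by (simp add: f_def P.linear_map_smult[OF lift_linear Poly_const[OF that(1)] cycE[OF that(2)]])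
  have f_z: "f k (z l) = (if k = l then \<one> else \<zero>)" if "k \<in> {0, 3}" "l \<in> {0, 3}" for k l
    using that \<Phi>_unit_vec \<Phi>_class3 by (auto simp: f_def z_def lift_unit_vec)
  have f_gr: "f k e = \<zero>" if "k \<in> {0, 3}" "e \<in> gr G j \<inter> cocycles G" "j \<noteq> k" for k j e
  proof -
    have "homog j (N.lift e)" using that(2) G_gr homog_lift by blast
    then show ?thesis using that(1,3) \<Phi>_homog by (auto simp: f_def)
  qed
  have f_closed: "f k e \<in> carrier R" if "e \<in> cocycles G" for k e
    using \<Phi>_closed[OF cycC[OF that]] by (simp add: f_def)
  have const: "indexed_const a \<in> carrier (Poly d) \<inter> A 0" if "a \<in> carrier R" for a
    using that Poly_const Poly_grading_const by blast
  note coh = cohomology_by_functionals[where R = "Poly d" and A = A and M = G and K = R and \<phi> = indexed_const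
        and J = "{0, 3}" and z = z and f = f,
      OF G_dg is_cring one_not_zero const _ z f_closed f_add f_smult f_z _ bd]
  show "module_iso R (cohomology_at R G 0) (regular_module R)"
    unfolding cohomology_at_def cohomology_vs_def by (rule coh(1); (erule (2) f_gr | simp))
  show "module_iso R (cohomology_at R G 3) (regular_module R)"
    unfolding cohomology_at_def cohomology_vs_def by (rule coh(1); (erule (2) f_gr | simp))
  show "carrier (cohomology_at R G j) = {\<zero>\<^bsub>cohomology_at R G j\<^esub>}" if "j \<noteq> 0" "j \<noteq> 3"
  proof -
    have "gr (cohomology G) j = {\<zero>\<^bsub>restrict_scalars indexed_const (cohomology G)\<^esub>}"
      by (rule coh(2); (erule (2) f_gr | simp add: that))
    then show ?thesis by (simp add: cohomology_at_def cohomology_vs_def)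
  qed
  show "\<exists>B. is_basis R (cohomology_vs R G) B \<and> finite B \<and> card B = 2"
  proof -
    have "\<exists>B. is_basis R (restrict_scalars indexed_const (cohomology G)) B \<and> finite B \<and> card B = card {0 :: int, 3}"
      by (rule coh(3); (erule (2) f_gr | simp))
    then show ?thesis by (simp add: cohomology_vs_def numeral_2_eq_2)
  qed
qed

end

section \<open>The counterexample over every field of characteristic other than two\<close>

lemma (in field) ring_char_ne_2_iff: "ring_char R \<noteq> 2 \<longleftrightarrow> \<one> \<oplus> \<one> \<noteq> \<zero>"
proof -
  have two: "[(2::nat)] \<cdot> \<one> = \<one> \<oplus> \<one>"
    by (simp add: numeral_2_eq_2)
  have ord: "[n] \<cdot> \<one> = \<zero> \<longleftrightarrow> ring_char R dvd n" for n :: nat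
    using add.pow_eq_id[of \<one> n] by (simp add: ring_char_def)
  have "ring_char R \<noteq> 1"
    using ord[of 1] one_not_zero by simp
  then show ?thesis using ord[of 2] two
    by (metis dvd_refl prime_nat_iff two_is_prime_nat)
qed

text \<open>
  The basis of the total cohomology is recorded in addition, as the rank conjecture speaks
  about its dimension.
\<close>

theorem small_semifree_exists:
  fixes K :: "'a ring"
  assumes K: "field K" "ring_char K \<noteq> 2" and d: "8 \<le> d"
  shows "\<exists>G :: ('a npoly, nat \<Rightarrow> 'a npoly) dgmodule.
    semifree (mpoly_ring K d) (mpoly_grading K d) G \<and>
    module_iso K (cohomology_at K G 0) (regular_module K) \<and>
    module_iso K (cohomology_at K G 3) (regular_module K) \<and>
    (\<forall>j. j \<noteq> 0 \<and> j \<noteq> 3 \<longrightarrow> carrier (cohomology_at K G j) = {\<zero>\<^bsub>cohomology_at K G j\<^esub>}) \<and>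
    free_rank (mpoly_ring K d) G < enat (2 ^ d) \<and>
    (\<exists>B. is_basis K (cohomology_vs K G) B \<and> finite B \<and> card B = 2)"
proof -
  interpret K: field K by fact
  let ?two = "\<one>\<^bsub>K\<^esub> \<oplus>\<^bsub>K\<^esub> \<one>\<^bsub>K\<^esub>"
  have two: "?two \<in> carrier K - {\<zero>\<^bsub>K\<^esub>}" using K.ring_char_ne_2_iff K(2) by simp
  define h where "h = inv\<^bsub>K\<^esub> ?two"
  have unit: "?two \<in> Units K" using two by (simp add: K.field_Units)
  then have h: "h \<in> carrier K" "h \<otimes>\<^bsub>K\<^esub> ?two = \<one>\<^bsub>K\<^esub>"
    unfolding h_def by (rule K.Units_inv_closed, rule K.Units_l_inv)
  then have "h \<oplus>\<^bsub>K\<^esub> h = \<one>\<^bsub>K\<^esub>" by (simp add: K.r_distr)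
  then interpret koszul_example K h d
    using h(1) d by unfold_locales
  show ?thesis
    using G_semifree G_cohomology G_rank by blast
qed

text \<open>
  The empty set is not a basis, as all elements of a module with an empty basis are equal to
  the empty sum.
\<close>

lemma free_rank_two_dimensional:
  assumes K: "\<one>\<^bsub>K\<^esub> \<noteq> \<zero>\<^bsub>K\<^esub>" and B: "is_basis K V B" "finite B" "card B = 2"
  shows "free_rank K V \<noteq> \<infinity>" and "free_rank K V \<noteq> 0"
proof -
  have "free_rank K V \<le> enat 2"
    unfolding free_rank_def using B by (intro INF_lower2[of B]) auto
  then show "free_rank K V \<noteq> \<infinity>" by (cases "free_rank K V") auto
  have "\<not> is_basis K V {}"
  proof
    assume "is_basis K V {}"
    let ?w = "\<Oplus>\<^bsub>V\<^esub>b\<in>{}. \<zero>\<^bsub>K\<^esub> \<odot>\<^bsub>V\<^esub> b"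
    have w: "x = ?w" if "x \<in> carrier V" for x
    proof -
      obtain c where c: "{b. c b \<noteq> \<zero>\<^bsub>K\<^esub>} \<subseteq> {}"
        and x: "x = (\<Oplus>\<^bsub>V\<^esub>b\<in>{b. c b \<noteq> \<zero>\<^bsub>K\<^esub>}. c b \<odot>\<^bsub>V\<^esub> b)"
        using \<open>is_basis K V {}\<close> \<open>x \<in> carrier V\<close> unfolding is_basis_def by blast
      have "c = (\<lambda>b. \<zero>\<^bsub>K\<^esub>)" using c by blast
      then show ?thesis using x by simp
    qed
    have "B \<subseteq> {?w}" using B(1) w unfolding is_basis_def by blast
    then have "card B \<le> 1" using card_mono[of "{?w}" B] by simp
    then show False using B(3) by simp
  qed
  then have "1 \<le> (if finite B' then enat (card B') else \<infinity>)" if "is_basis K V B'" for B'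
    using that by (auto simp: one_enat_def Suc_le_eq card_gt_0_iff)
  then have "1 \<le> free_rank K V"
    unfolding free_rank_def by (intro INF_greatest) auto
  then show "free_rank K V \<noteq> 0" by auto
qed

lemma residue_field_3: "field (residue_ring 3)" "ring_char (residue_ring 3) \<noteq> 2"
proof -
  interpret residues_prime 3 "residue_ring 3" by unfold_locales simp_all
  show F: "field (residue_ring 3)" by (rule is_field)
  show "ring_char (residue_ring 3) \<noteq> 2"
    unfolding field.ring_char_ne_2_iff[OF F] by (simp add: residue_ring_def)
qed

theorem corollary4p7:
  shows "(\<forall>(K :: 'a ring) (d :: nat). field K \<and> ring_char K \<noteq> 2 \<and> d \<ge> 8 \<longrightarrow>
      (\<exists>G :: ('a npoly, nat \<Rightarrow> 'a npoly) dgmodule.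
         semifree (mpoly_ring K d) (mpoly_grading K d) G \<and>
         module_iso K (cohomology_at K G 0) (regular_module K) \<and>
         module_iso K (cohomology_at K G 3) (regular_module K) \<and>
         (\<forall>j. j \<noteq> 0 \<and> j \<noteq> 3 \<longrightarrow>
            carrier (cohomology_at K G j) = {\<zero>\<^bsub>cohomology_at K G j\<^esub>}) \<and>
         free_rank (mpoly_ring K d) G < enat (2 ^ d))) \<and>
    \<not> (\<forall>(K :: int ring) (d :: nat) (F :: (int npoly, nat \<Rightarrow> int npoly) dgmodule).
      field K \<and> semifree (mpoly_ring K d) (mpoly_grading K d) F \<and>
      free_rank K (cohomology_vs K F) \<noteq> \<infinity> \<and> free_rank K (cohomology_vs K F) \<noteq> 0 \<longrightarrow>
      free_rank (mpoly_ring K d) F \<ge> enat (2 ^ d))"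
proof (intro conjI allI impI notI, goal_cases)
  case (1 K d)
  then show ?case using small_semifree_exists[of K d] by blast
next
  case 2
  \<comment> \<open>The field with three elements has characteristic different from two and lives on the integers.\<close>
  obtain G :: "(int npoly, nat \<Rightarrow> int npoly) dgmodule" and B
    where G: "semifree (mpoly_ring (residue_ring 3) 8) (mpoly_grading (residue_ring 3) 8) G"
      "free_rank (mpoly_ring (residue_ring 3) 8) G < enat (2 ^ 8)"
      and B: "is_basis (residue_ring 3) (cohomology_vs (residue_ring 3) G) B" "finite B" "card B = 2"
    using small_semifree_exists[OF residue_field_3, of 8] by blast
  have "\<one>\<^bsub>residue_ring 3\<^esub> \<noteq> \<zero>\<^bsub>residue_ring 3\<^esub>" by (simp add: residue_ring_def)
  note rank = free_rank_two_dimensional[OF this B]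
  have "free_rank (mpoly_ring (residue_ring 3) 8) G \<ge> enat (2 ^ 8)"
    by (rule 2[rule_format]) (intro conjI residue_field_3 G(1) rank)
  then show ?case using G(2) leD by blast
qed

end
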